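(* Let $3\le k\le n$, let $\Lambda$ be a coherent $k\times n$ matching field, and let $M\in\mathbb{R}^{k\times n}$ be a weight matrix inducing $\Lambda$. If $\Lambda$ has a hexagonal submatching field, then $\Lambda$ does not produce a toric degeneration of $\mathrm{Gr}(k,n)$, i.e. the initial ideal $\mathrm{in}_{w_M}(\mathcal{I}_{k,n})$ of the Plücker ideal is not both prime and binomial.
   Context: Fix a field $\mathbb{K}$. Write $[n]=\{1,\dots,n\}$ and let $\mathbf{I}_{k,n}$ be the set of $k$-element subsets of $[n]$. Plücker ideal: let $X=(x_{ij})$ be a $k\times n$ matrix of indeterminates and $X_I$ the submatrix with columns $I\in\mathbf{I}_{k,n}$. The Plücker ideal $\mathcal{I}_{k,n}\subset\mathbb{K}[P_I : I\in\mathbf{I}_{k,n}]$ is the kernel of $\mathbb{K}[P_I]\to\mathbb{K}[x_{ij}]$, $P_I\mapsto\det(X_I)$. The symbol $P_I$ is also used for the Plücker form $\det(X_I)$. Matching fields: a $k\times n$ matching field is a map $\Lambda:\mathbf{I}_{k,n}\to S_k$. For $I=\{i_1<\dots<i_k\}$ and $\sigma=\Lambda(I)$, we say that $i_r$ is placed in row $\sigma(r)$, and put $\mathbf{x}_{\Lambda(I)}=x_{\sigma(1)i_1}\cdots x_{\sigma(k)i_k}$. A matrix $M=(a_{ij})\in\mathbb{R}^{k\times n}$ assigns weight $a_{ij}$ to $x_{ij}$; $\mathrm{in}_M(f)$ is the sum of all terms of $f$ of lowest weight. $\Lambda$ is coherent if there is $M$ with $\mathrm{in}_M(P_I)=\mathrm{sgn}(\Lambda(I))\,\mathbf{x}_{\Lambda(I)}$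 for all $I$; then $M$ induces $\Lambda$. The weight $w_M$ on the variables $P_I$ assigns to $P_I$ the $M$-weight of $\mathrm{in}_M(\det X_I)$, and $\mathrm{in}_{w_M}(\mathcal{I}_{k,n})$ is the ideal generated by the lowest-$w_M$-weight forms of the elements of $\mathcal{I}_{k,n}$. Hexagonal $3\times 6$ matching fields: every coherent matching field is induced by a matrix with first row zero. For $M=(a_{ij})\in\mathbb{R}^{3\times 6}$ with first row zero, let $H_j\subset\mathbb{R}^2$ be the non-differentiability locus of $\max\{0,\,x_2-a_{2j},\,x_3-a_{3j}\}$, i.e. the tropical line with vertex $(a_{2j},a_{3j})$ and rays in directions $(1,1),(-1,0),(0,-1)$. Put $v_1=(1,1)$, $v_2=(-1,0)$, $v_3=(0,-1)$. For a $2$-dimensional cell $\tau$ (closure of a connected component of the complement of $\bigcup_j H_j$), its covector is $(S_1,S_2,S_3)$, where $S_i$ is the set of $j$ such that $H_j$ meets the ray $\{x+tv_i: t\ge 0\}$ for $x$ in the interior of $\tau$; its coarse covector is $(|S_1|,|S_2|,|S_3|)$. A coherent $3\times 6$ matching field is hexagonal if it is induced by some $M\in\mathbb{R}^{3\times 6}$ with zero first row whose arrangement is such that its unique cell with coarse covector $(2,2,2)$ is a hexagon (a polygon with exactly six edges). Submatching fields: $\Lambda$ is pointed on $S\subset[n]$ if for every $i\in S$ there is a row $j_i\in[k]$ such that, for every $I\in\mathbf{I}_{k,n}$ with $i\in I$, the element $i$ is placed in row $j_i$. Given $S\subset T\subset[n]$, the submatching field $\Lambda|_{T-S,T}$ is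 obtained by restricting $\Lambda$ to the sets $I\in\mathbf{I}_{k,n}$ with $S\subset I\subset T$ and restricting the matching (assignment of elements to rows) to $I\setminus S$. It is called hexagonal if $\Lambda$ is pointed on $S$ and $\Lambda|_{T-S,T}$ is a hexagonal matching field of size $3\times 6$ (so $|S|=k-3$, $|T|=k+3$; the six elements of $T\setminus S$ are identified with $[6]$ and the three rows not of the form $j_i$, $i\in S$, are identified with $[3]$, both order-preservingly). *)

theory Defs
  imports
    "HOL-Analysis.Analysis"
    "HOL-Algebra.Ideal"
    "HOL-Combinatorics.Permutations"
    "HOL-Library.Poly_Mapping"
    "Jordan_Normal_Form.Determinant"
begin

section \<open>Polynomials, weights and initial forms\<close>

text \<open>A polynomial with coefficients in \<open>'a\<close> and variables indexed by \<open>'v\<close> is a finitely supported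
  function from exponent vectors to coefficients; \<open>keys f\<close> is then the set of exponent vectors of
  the terms of \<open>f\<close>. The ring structure is the convolution product of \<^theory>\<open>HOL-Library.Poly_Mapping\<close>.\<close>

type_synonym ('v, 'a) mpoly = "('v \<Rightarrow>\<^sub>0 nat) \<Rightarrow>\<^sub>0 'a"

definition Const :: "'a::comm_ring_1 \<Rightarrow> ('v, 'a) mpoly" where
  "Const c = Poly_Mapping.single 0 c"

definition Var :: "'v \<Rightarrow> ('v, 'a::comm_ring_1) mpoly" where
  "Var v = Poly_Mapping.single (Poly_Mapping.single v 1) 1"

definition mpoly_ring :: "'v set \<Rightarrow> ('v, 'a::comm_ring_1) mpoly ring" where
  "mpoly_ring V =
    \<lparr>carrier = {p. \<forall>m \<in> Poly_Mapping.keys p. Poly_Mapping.keys m \<subseteq> V},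
     monoid.mult = (*), one = 1, zero = 0, add = (+)\<rparr>"

definition poly_subst :: "('v \<Rightarrow> ('w, 'a) mpoly) \<Rightarrow> ('v, 'a::comm_ring_1) mpoly \<Rightarrow> ('w, 'a) mpoly" where
  "poly_subst g p = (\<Sum>m \<in> Poly_Mapping.keys p. Const (Poly_Mapping.lookup p m) *
      (\<Prod>v \<in> Poly_Mapping.keys m. g v ^ Poly_Mapping.lookup m v))"

definition monom_weight :: "('v \<Rightarrow> real) \<Rightarrow> ('v \<Rightarrow>\<^sub>0 nat) \<Rightarrow> real" where
  "monom_weight w m = (\<Sum>v \<in> Poly_Mapping.keys m. real (Poly_Mapping.lookup m v) * w v)"

text \<open>Only meaningful for a nonzero polynomial.\<close>

definition poly_weight :: "('v \<Rightarrow> real) \<Rightarrow> ('v, 'a::comm_ring_1) mpoly \<Rightarrow> real" where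
  "poly_weight w f = Min (monom_weight w ` Poly_Mapping.keys f)"

definition initial_form :: "('v \<Rightarrow> real) \<Rightarrow> ('v, 'a::comm_ring_1) mpoly \<Rightarrow> ('v, 'a) mpoly" where
  "initial_form w f =
    (\<Sum>m \<in> {m \<in> Poly_Mapping.keys f. monom_weight w m = poly_weight w f}.
        Poly_Mapping.single m (Poly_Mapping.lookup f m))"

text \<open>A binomial has at most two terms, so monomials are admitted as binomials.\<close>

definition binomial_ideal :: "'v set \<Rightarrow> ('v, 'a::comm_ring_1) mpoly set \<Rightarrow> bool" where
  "binomial_ideal V J \<longleftrightarrow>
    (\<exists>B \<subseteq> carrier (mpoly_ring V).
        (\<forall>b \<in> B. card (Poly_Mapping.keys b) \<le> 2) \<and> J = Idl\<^bsub>mpoly_ring V\<^esub> B)"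

section \<open>The Pluecker ideal\<close>

definition ksets :: "nat \<Rightarrow> nat \<Rightarrow> nat set set" where
  "ksets k n = {I. I \<subseteq> {1..n} \<and> card I = k}"

text \<open>\<open>nth_elem A\<close> is the increasing enumeration of a finite set \<open>A\<close>, with positions starting at 1,
  and \<open>position A\<close> is its inverse.\<close>

definition nth_elem :: "nat set \<Rightarrow> nat \<Rightarrow> nat" where
  "nth_elem A r = sorted_list_of_set A ! (r - 1)"

definition position :: "nat set \<Rightarrow> nat \<Rightarrow> nat" where
  "position A a = card {b \<in> A. b \<le> a}"

text \<open>The maximal minor of the generic matrix on the columns \<open>I\<close>. Library matrices are indexed from
  0, all other indices here from 1.\<close>

definition plucker_form :: "nat \<Rightarrow> nat set \<Rightarrow> (nat \<times> nat, 'a::comm_ring_1) mpoly" where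
  "plucker_form k I =
    Determinant.det (Matrix.mat k k (\<lambda>(i, r). Var (i + 1, nth_elem I (r + 1))))"

definition plucker_ideal :: "nat \<Rightarrow> nat \<Rightarrow> (nat set, 'a::comm_ring_1) mpoly set" where
  "plucker_ideal k n =
    {p \<in> carrier (mpoly_ring (ksets k n)). poly_subst (plucker_form k) p = 0}"

section \<open>Matching fields\<close>

text \<open>A matching field and a \<open>k \<times> n\<close> matrix are total functions, of which only the values on
  \<open>ksets k n\<close> and on \<open>{1..k} \<times> {1..n}\<close> are used. The argument of type \<open>'a itself\<close> is the
  ground field.\<close>

definition matching_field :: "nat \<Rightarrow> nat \<Rightarrow> (nat set \<Rightarrow> nat \<Rightarrow> nat) \<Rightarrow> bool" where
  "matching_field k n \<Lambda> \<longleftrightarrow> (\<forall>I \<in> ksets k n. \<Lambda> I permutes {1..k})"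

definition matching_monomial ::
  "nat \<Rightarrow> (nat set \<Rightarrow> nat \<Rightarrow> nat) \<Rightarrow> nat set \<Rightarrow> (nat \<times> nat, 'a::comm_ring_1) mpoly" where
  "matching_monomial k \<Lambda> I = (\<Prod>r \<in> {1..k}. Var (\<Lambda> I r, nth_elem I r))"

definition induces ::
  "'a::field itself \<Rightarrow> nat \<Rightarrow> nat \<Rightarrow> (nat \<Rightarrow> nat \<Rightarrow> real) \<Rightarrow> (nat set \<Rightarrow> nat \<Rightarrow> nat) \<Rightarrow> bool" where
  "induces _ k n M \<Lambda> \<longleftrightarrow>
    (\<forall>I \<in> ksets k n. initial_form (\<lambda>(i, j). M i j) (plucker_form k I) =
       (of_int (sign (\<Lambda> I)) * matching_monomial k \<Lambda> I :: (nat \<times> nat, 'a) mpoly))"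

definition coherent_matching_field ::
  "'a::field itself \<Rightarrow> nat \<Rightarrow> nat \<Rightarrow> (nat set \<Rightarrow> nat \<Rightarrow> nat) \<Rightarrow> bool" where
  "coherent_matching_field F k n \<Lambda> \<longleftrightarrow>
    matching_field k n \<Lambda> \<and> (\<exists>M. induces F k n M \<Lambda>)"

definition plucker_weight ::
  "'a::field itself \<Rightarrow> nat \<Rightarrow> (nat \<Rightarrow> nat \<Rightarrow> real) \<Rightarrow> nat set \<Rightarrow> real" where
  "plucker_weight _ k M I = poly_weight (\<lambda>(i, j). M i j)
     (initial_form (\<lambda>(i, j). M i j) (plucker_form k I :: (nat \<times> nat, 'a) mpoly))"

definition initial_plucker_ideal ::
  "nat \<Rightarrow> nat \<Rightarrow> (nat \<Rightarrow> nat \<Rightarrow> real) \<Rightarrow> (nat set, 'a::field) mpoly set" where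
  "initial_plucker_ideal k n M =
    Idl\<^bsub>mpoly_ring (ksets k n)\<^esub>
      (initial_form (plucker_weight TYPE('a) k M) ` plucker_ideal k n)"

section \<open>Hexagonal matching fields\<close>

text \<open>Points of the plane are pairs \<open>(x\<^sub>2, x\<^sub>3)\<close>.\<close>

definition tropical_line :: "(nat \<Rightarrow> nat \<Rightarrow> real) \<Rightarrow> nat \<Rightarrow> (real \<times> real) set" where
  "tropical_line M j =
    {x. \<not> (\<lambda>(x2, x3). max 0 (max (x2 - M 2 j) (x3 - M 3 j))) differentiable (at x)}"

definition ray_direction :: "nat \<Rightarrow> real \<times> real" where
  "ray_direction i = (if i = 1 then (1, 1) else if i = 2 then (-1, 0) else (0, -1))"

definition cells :: "(nat \<Rightarrow> nat \<Rightarrow> real) \<Rightarrow> (real \<times> real) set set" where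
  "cells M = closure ` components (- (\<Union>j \<in> {1..6}. tropical_line M j))"

text \<open>Whether the ray from \<open>x\<close> meets the line does not depend on the choice of \<open>x\<close> in the
  interior of a cell.\<close>

definition covector :: "(nat \<Rightarrow> nat \<Rightarrow> real) \<Rightarrow> (real \<times> real) set \<Rightarrow> nat \<Rightarrow> nat set" where
  "covector M \<tau> i = {j \<in> {1..6}. \<forall>x \<in> interior \<tau>.
      {x + t *\<^sub>R ray_direction i | t. 0 \<le> t} \<inter> tropical_line M j \<noteq> {}}"

definition coarse_covector :: "(nat \<Rightarrow> nat \<Rightarrow> real) \<Rightarrow> (real \<times> real) set \<Rightarrow> nat \<times> nat \<times> nat" where
  "coarse_covector M \<tau> = (card (covector M \<tau> 1), card (covector M \<tau> 2), card (covector M \<tau> 3))"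

definition hexagon :: "(real \<times> real) set \<Rightarrow> bool" where
  "hexagon P \<longleftrightarrow> polytope P \<and> aff_dim P = 2 \<and> card {e. e edge_of P} = 6"

definition hexagonal_matching_field ::
  "'a::field itself \<Rightarrow> (nat set \<Rightarrow> nat \<Rightarrow> nat) \<Rightarrow> bool" where
  "hexagonal_matching_field F \<Lambda> \<longleftrightarrow>
    coherent_matching_field F 3 6 \<Lambda> \<and>
    (\<exists>M. (\<forall>j \<in> {1..6}. M 1 j = 0) \<and> induces F 3 6 M \<Lambda> \<and>
         (\<exists>\<tau> \<in> cells M. coarse_covector M \<tau> = (2, 2, 2) \<and> hexagon \<tau>))"

section \<open>Submatching fields\<close>

definition row_of :: "(nat set \<Rightarrow> nat \<Rightarrow> nat) \<Rightarrow> nat set \<Rightarrow> nat \<Rightarrow> nat" where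
  "row_of \<Lambda> I i = \<Lambda> I (position I i)"

definition pointed_via ::
  "nat \<Rightarrow> nat \<Rightarrow> (nat set \<Rightarrow> nat \<Rightarrow> nat) \<Rightarrow> nat set \<Rightarrow> (nat \<Rightarrow> nat) \<Rightarrow> bool" where
  "pointed_via k n \<Lambda> S \<rho> \<longleftrightarrow>
    (\<forall>i \<in> S. \<rho> i \<in> {1..k} \<and> (\<forall>I \<in> ksets k n. i \<in> I \<longrightarrow> row_of \<Lambda> I i = \<rho> i))"

text \<open>\<open>\<Lambda>\<close> restricted to the sets between \<open>S\<close> and \<open>T\<close>, where the columns \<open>T - S\<close> and the set
  \<open>R\<close> of rows not used by \<open>S\<close> are renumbered increasingly from 1. The result sends a set \<open>J\<close> of
  renumbered columns to a permutation of \<open>{1..card R}\<close>, extended by the identity as required by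
  \<^const>\<open>permutes\<close>.\<close>

definition submatching_field ::
  "(nat set \<Rightarrow> nat \<Rightarrow> nat) \<Rightarrow> nat set \<Rightarrow> nat set \<Rightarrow> nat set \<Rightarrow> nat set \<Rightarrow> nat \<Rightarrow> nat" where
  "submatching_field \<Lambda> S T R J r =
    (if r \<in> {1..card R}
     then position R (row_of \<Lambda> (S \<union> nth_elem (T - S) ` J) (nth_elem (T - S) (nth_elem J r)))
     else r)"

definition has_hexagonal_submatching_field ::
  "'a::field itself \<Rightarrow> nat \<Rightarrow> nat \<Rightarrow> (nat set \<Rightarrow> nat \<Rightarrow> nat) \<Rightarrow> bool" where
  "has_hexagonal_submatching_field F k n \<Lambda> \<longleftrightarrow>
    (\<exists>S T \<rho>. S \<subset> T \<and> T \<subseteq> {1..n} \<and> card S = k - 3 \<and> card T = k + 3 \<and>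
       pointed_via k n \<Lambda> S \<rho> \<and>
       hexagonal_matching_field F (submatching_field \<Lambda> S T ({1..k} - \<rho> ` S)))"

end

theory Submission
  imports Defs
begin

text \<open>Let \<open>J\<close> be the initial ideal and suppose that it is prime. The monomial map sends \<open>P\<^sub>A\<close> to the
  initial form of the minor with columns \<open>A\<close>, which is a signed monomial. It annihilates \<open>J\<close>, because the lowest
  terms of a relation among the minors form a relation among their initial forms. In particular \<open>J\<close>
  contains no monomial, and being prime it makes ``proportional modulo \<open>J\<close>'' a congruence with
  cancellation on the monomials in the \<open>P\<^sub>A\<close> (locale \<open>prime_initial_ideal\<close>).

  The contradiction comes from counting in one multidegree: twice each column in \<open>S\<close>, once each of the
  six columns in \<open>X = T - S\<close>. It contains ten monomials \<open>P\<^sub>A P\<^sub>B\<close>, one for each way to split \<open>X\<close> into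
  two triples \<open>A - S\<close> and \<open>B - S\<close>. As polynomials in the entries of the generic matrix they span a space of
  dimension five, the number of standard tableaux with three rows and two columns; the lower bound
  follows by evaluating at matrices whose columns are multiples of unit vectors. Passing to
  the initial ideal does not change dimensions, so the ten monomials cannot fall into only four
  classes of monomials proportional modulo \<open>J\<close> (lemma \<open>four_classes_impossible\<close>).

  The hexagon forces four classes. Its cell distributes the six columns into three pairs, one for each
  row, the row in which the column is cheapest. In a triple that meets all pairs, every column is
  placed in its own row. In a triple formed by the pair of row \<open>i\<close> and a column \<open>x\<close> of row \<open>m\<close>, the
  remaining row \<open>l\<close> must be filled. The cell has an edge on the line on which rows \<open>i\<close> and \<open>l\<close> compete,
  and this means that moving a column of row \<open>i\<close> directly to row \<open>l\<close> is strictly cheaper than moving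
  it to row \<open>m\<close> and \<open>x\<close> to row \<open>l\<close>. So \<open>x\<close> stays in row \<open>m\<close>, and which column of row \<open>i\<close> moves
  does not depend on \<open>x\<close> (lemma \<open>hexagonal_rows\<close>).

  With these placements, suitable three-term Pluecker relations have two terms with the same image
  under the monomial map and a third term with a different one. Their initial forms are then
  binomials in \<open>J\<close> (lemmas \<open>three_term_rel\<close> and \<open>exchange\<close>). Multiplying two such binomial relations and
  cancelling shows that the four products of two triples meeting all pairs are proportional modulo
  \<open>J\<close>, and that the other six products are proportional in twos (lemma \<open>hexagon_impossible\<close>).\<close>

section \<open>Substitution homomorphisms\<close>

lemma Const_zero [simp]: "Const 0 = 0"
  and Const_one [simp]: "Const 1 = 1"
  by (simp_all add: Const_def)

lemma Const_mult: "Const (a * b) = Const a * Const b"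
  by (simp add: Const_def mult_single)

lemma Const_add: "Const (a + b) = Const a + Const b"
  by (simp add: Const_def single_add)

lemma Const_mult_single: "Const c * Poly_Mapping.single m d = Poly_Mapping.single m (c * d)"
  by (simp add: Const_def mult_single)

lemma lookup_Const_mult: "Poly_Mapping.lookup (Const c * p) m = c * Poly_Mapping.lookup p m"
  by (simp add: Const_def flip: mult_map_scale_conv_mult) (simp add: Poly_Mapping.map.rep_eq when_def)

lemma poly_mapping_eq_sum_single:
  "p = (\<Sum>m \<in> Poly_Mapping.keys p. Poly_Mapping.single m (Poly_Mapping.lookup p m))"
  by (rule poly_mapping_eqI)
    (auto simp: lookup_sum lookup_single when_def in_keys_iff)

definition subst_monom :: "('v \<Rightarrow> 'r::comm_ring_1) \<Rightarrow> ('v \<Rightarrow>\<^sub>0 nat) \<Rightarrow> 'r" where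
  "subst_monom g m = (\<Prod>v \<in> Poly_Mapping.keys m. g v ^ Poly_Mapping.lookup m v)"

lemma subst_monom_superset:
  assumes "finite A" "Poly_Mapping.keys m \<subseteq> A"
  shows "subst_monom g m = (\<Prod>v \<in> A. g v ^ Poly_Mapping.lookup m v)"
  unfolding subst_monom_def
  by (rule prod.mono_neutral_left) (use assms in \<open>auto simp: in_keys_iff\<close>)

lemma subst_monom_zero [simp]: "subst_monom g 0 = 1"
  by (simp add: subst_monom_def)

lemma subst_monom_add: "subst_monom g (m + m') = subst_monom g m * subst_monom g m'"
proof -
  let ?A = "Poly_Mapping.keys m \<union> Poly_Mapping.keys m'"
  have "Poly_Mapping.keys (m + m') \<subseteq> ?A" by (rule keys_add)
  then show ?thesis
    by (subst (1 2 3) subst_monom_superset[of ?A])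
      (auto simp: lookup_add power_add prod.distrib)
qed

lemma subst_monom_single [simp]: "subst_monom g (Poly_Mapping.single v n) = g v ^ n"
  by (cases "n = 0") (simp_all add: subst_monom_def)

lemma poly_subst_superset:
  assumes "finite A" "Poly_Mapping.keys p \<subseteq> A"
  shows "poly_subst g p = (\<Sum>m \<in> A. Const (Poly_Mapping.lookup p m) * subst_monom g m)"
  unfolding poly_subst_def subst_monom_def
  by (rule sum.mono_neutral_left) (use assms in \<open>auto simp: in_keys_iff\<close>)

lemma poly_subst_add: "poly_subst g (p + q) = poly_subst g p + poly_subst g q"
proof -
  let ?A = "Poly_Mapping.keys p \<union> Poly_Mapping.keys q"
  have "Poly_Mapping.keys (p + q) \<subseteq> ?A" by (rule keys_add)
  then show ?thesis
    by (subst (1 2 3) poly_subst_superset[of ?A])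
      (auto simp: lookup_add Const_add distrib_right sum.distrib)
qed

lemma poly_subst_zero [simp]: "poly_subst g 0 = 0"
  by (simp add: poly_subst_def)

lemma poly_subst_single [simp]:
  "poly_subst g (Poly_Mapping.single m c) = Const c * subst_monom g m"
  by (cases "c = 0") (simp_all add: poly_subst_def subst_monom_def)

lemma poly_subst_one [simp]: "poly_subst g 1 = 1"
  using poly_subst_single[of g 0 1] by simp

lemma poly_subst_Var [simp]: "poly_subst g (Var v) = g v"
  by (simp add: Var_def)

lemma poly_subst_sum: "finite A \<Longrightarrow> poly_subst g (\<Sum>x\<in>A. p x) = (\<Sum>x\<in>A. poly_subst g (p x))"
  by (induction A rule: finite_induct) (simp_all add: poly_subst_add)

lemma poly_subst_mult: "poly_subst g (p * q) = poly_subst g p * poly_subst g q"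
proof -
  let ?s = "\<lambda>p m. Poly_Mapping.single m (Poly_Mapping.lookup p m)"
  have "p * q = (\<Sum>m\<in>Poly_Mapping.keys p. \<Sum>m'\<in>Poly_Mapping.keys q. ?s p m * ?s q m')"
    by (subst poly_mapping_eq_sum_single[of p], subst poly_mapping_eq_sum_single[of q])
      (simp add: sum_product)
  also have "poly_subst g \<dots> =
      (\<Sum>m\<in>Poly_Mapping.keys p. \<Sum>m'\<in>Poly_Mapping.keys q. poly_subst g (?s p m) * poly_subst g (?s q m'))"
    by (simp add: poly_subst_sum mult_single Const_mult subst_monom_add algebra_simps)
  also have "\<dots> = poly_subst g (\<Sum>m\<in>Poly_Mapping.keys p. ?s p m) * poly_subst g (\<Sum>m\<in>Poly_Mapping.keys q. ?s q m)"
    by (simp add: poly_subst_sum sum_product del: poly_subst_single)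
  finally show ?thesis
    by (simp add: poly_mapping_eq_sum_single[symmetric])
qed

lemma comm_ring_hom_poly_subst: "comm_ring_hom (poly_subst g)"
  by unfold_locales (simp_all add: poly_subst_add poly_subst_mult)

section \<open>Weights and initial forms\<close>

lemma monom_weight_superset:
  assumes "finite A" "Poly_Mapping.keys m \<subseteq> A"
  shows "monom_weight w m = (\<Sum>v \<in> A. real (Poly_Mapping.lookup m v) * w v)"
  unfolding monom_weight_def
  by (rule sum.mono_neutral_left) (use assms in \<open>auto simp: in_keys_iff\<close>)

lemma monom_weight_zero [simp]: "monom_weight w 0 = 0"
  by (simp add: monom_weight_def)

lemma monom_weight_add: "monom_weight w (m + m') = monom_weight w m + monom_weight w m'"
proof -
  let ?A = "Poly_Mapping.keys m \<union> Poly_Mapping.keys m'"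
  have "Poly_Mapping.keys (m + m') \<subseteq> ?A" by (rule keys_add)
  then show ?thesis
    by (subst (1 2 3) monom_weight_superset[of ?A])
      (auto simp: lookup_add distrib_right sum.distrib)
qed

lemma monom_weight_single [simp]: "monom_weight w (Poly_Mapping.single v n) = real n * w v"
  by (cases "n = 0") (simp_all add: monom_weight_def)

lemma monom_weight_sum: "finite A \<Longrightarrow> monom_weight w (\<Sum>x\<in>A. m x) = (\<Sum>x\<in>A. monom_weight w (m x))"
  by (induction A rule: finite_induct) (simp_all add: monom_weight_add)

definition weight_part :: "('v \<Rightarrow> real) \<Rightarrow> real \<Rightarrow> ('v, 'a::comm_ring_1) mpoly \<Rightarrow> ('v, 'a) mpoly" where
  "weight_part w \<omega> f = (\<Sum>m \<in> {m \<in> Poly_Mapping.keys f. monom_weight w m = \<omega>}.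
     Poly_Mapping.single m (Poly_Mapping.lookup f m))"

lemma initial_form_eq_weight_part: "initial_form w f = weight_part w (poly_weight w f) f"
  by (simp add: initial_form_def weight_part_def)

lemma lookup_weight_part:
  "Poly_Mapping.lookup (weight_part w \<omega> f) m =
     (if monom_weight w m = \<omega> then Poly_Mapping.lookup f m else 0)"
  by (auto simp: weight_part_def lookup_sum lookup_single when_def in_keys_iff)

lemma weight_part_zero [simp]: "weight_part w \<omega> 0 = 0"
  by (simp add: weight_part_def)

lemma weight_part_add: "weight_part w \<omega> (f + g) = weight_part w \<omega> f + weight_part w \<omega> g"
  by (rule poly_mapping_eqI) (simp add: lookup_weight_part lookup_add)

lemma lookup_single_mult_add:
  "Poly_Mapping.lookup (Poly_Mapping.single m c * f) (m + m') = c * Poly_Mapping.lookup (f :: ('v, 'a::comm_ring_1) mpoly) m'"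
proof -
  have "Poly_Mapping.single m c * f =
      (\<Sum>a\<in>Poly_Mapping.keys f. Poly_Mapping.single (m + a) (c * Poly_Mapping.lookup f a))"
    by (subst (1) poly_mapping_eq_sum_single[of f]) (simp add: sum_distrib_left mult_single)
  then show ?thesis
    by (auto simp: lookup_sum lookup_single when_def in_keys_iff)
qed

lemma keys_single_mult:
  "Poly_Mapping.keys (Poly_Mapping.single m c * (f :: ('v, 'a::comm_ring_1) mpoly)) \<subseteq> (+) m ` Poly_Mapping.keys f"
  using keys_mult[of "Poly_Mapping.single m c" f] by (auto split: if_splits)

lemma weight_part_single_mult:
  "weight_part w \<omega> (Poly_Mapping.single m c * f) =
     Poly_Mapping.single m c * weight_part w (\<omega> - monom_weight w m) (f :: ('v, 'a::comm_ring_1) mpoly)"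
proof (rule poly_mapping_eqI)
  fix n
  show "Poly_Mapping.lookup (weight_part w \<omega> (Poly_Mapping.single m c * f)) n =
     Poly_Mapping.lookup (Poly_Mapping.single m c * weight_part w (\<omega> - monom_weight w m) f) n"
  proof (cases "\<exists>n'. n = m + n'")
    case True
    then show ?thesis
      by (auto simp: lookup_weight_part lookup_single_mult_add monom_weight_add)
  next
    case False
    then have "n \<notin> Poly_Mapping.keys (Poly_Mapping.single m c * p)" for p :: "('v, 'a) mpoly"
      using keys_single_mult[of m c p] by blast
    then show ?thesis
      by (simp add: lookup_weight_part in_keys_iff)
  qed
qed

lemma poly_eq_sum_weight_parts:
  "f = (\<Sum>\<omega> \<in> monom_weight w ` Poly_Mapping.keys f. weight_part w \<omega> f)"
proof (rule poly_mapping_eqI)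
  fix m
  show "Poly_Mapping.lookup f m =
      Poly_Mapping.lookup (\<Sum>\<omega> \<in> monom_weight w ` Poly_Mapping.keys f. weight_part w \<omega> f) m"
  proof (cases "m \<in> Poly_Mapping.keys f")
    case True
    then show ?thesis by (simp add: lookup_sum lookup_weight_part)
  next
    case False
    then show ?thesis by (simp add: lookup_sum lookup_weight_part in_keys_iff)
  qed
qed

text \<open>In contrast to \<^const>\<open>initial_form\<close>, this notion of lowest terms \<open>q\<close> of \<open>p\<close> admits \<open>q = 0\<close>, which
  makes it multiplicative over every coefficient ring.\<close>

definition leading :: "('v \<Rightarrow> real) \<Rightarrow> real \<Rightarrow> ('v, 'a::comm_ring_1) mpoly \<Rightarrow> ('v, 'a) mpoly \<Rightarrow> bool" where
  "leading w \<alpha> p q \<longleftrightarrow> (\<forall>m \<in> Poly_Mapping.keys q. monom_weight w m = \<alpha>) \<and>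
     (\<forall>m \<in> Poly_Mapping.keys (p - q). \<alpha> < monom_weight w m)"

lemma leading_initial_form:
  "leading w (poly_weight w p) p (initial_form w p)"
proof -
  have "poly_weight w p \<le> monom_weight w m" if "m \<in> Poly_Mapping.keys p" for m
    unfolding poly_weight_def by (rule Min_le) (use that in auto)
  then show ?thesis
    by (force simp: leading_def initial_form_eq_weight_part in_keys_iff lookup_weight_part
        lookup_minus split: if_splits)
qed

lemma leading_one: "leading w 0 1 1"
  by (simp add: leading_def)

lemma leading_mult:
  assumes "leading w \<alpha> p q" "leading w \<beta> p' q'"
  shows "leading w (\<alpha> + \<beta>) (p * p') (q * q')"
proof -
  have p': "\<beta> \<le> monom_weight w m" if "m \<in> Poly_Mapping.keys p'" for m
  proof -
    have "m \<in> Poly_Mapping.keys q' \<or> m \<in> Poly_Mapping.keys (p' - q')"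
      using that by (auto simp: in_keys_iff lookup_minus)
    then show ?thesis using assms(2) by (auto simp: leading_def)
  qed
  have split: "p * p' - q * q' = (p - q) * p' + q * (p' - q')"
    by (simp add: algebra_simps)
  have "\<alpha> + \<beta> < monom_weight w m" if m: "m \<in> Poly_Mapping.keys (p * p' - q * q')" for m
  proof -
    have "m \<in> Poly_Mapping.keys ((p - q) * p') \<or> m \<in> Poly_Mapping.keys (q * (p' - q'))"
      using m keys_add[of "(p - q) * p'" "q * (p' - q')"] unfolding split by blast
    then show ?thesis
    proof
      assume "m \<in> Poly_Mapping.keys ((p - q) * p')"
      then obtain a b where "a \<in> Poly_Mapping.keys (p - q)" "b \<in> Poly_Mapping.keys p'" "m = a + b"
        using keys_mult by blast
      then show ?thesis using assms(1) p'[of b] by (force simp: leading_def monom_weight_add)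
    next
      assume "m \<in> Poly_Mapping.keys (q * (p' - q'))"
      then obtain a b where "a \<in> Poly_Mapping.keys q" "b \<in> Poly_Mapping.keys (p' - q')" "m = a + b"
        using keys_mult by blast
      then show ?thesis using assms by (force simp: leading_def monom_weight_add)
    qed
  qed
  moreover have "monom_weight w m = \<alpha> + \<beta>" if "m \<in> Poly_Mapping.keys (q * q')" for m
    using keys_mult[of q q'] that assms by (force simp: leading_def monom_weight_add)
  ultimately show ?thesis by (simp add: leading_def)
qed

lemma leading_power:
  assumes "leading w \<alpha> p q"
  shows "leading w (real n * \<alpha>) (p ^ n) (q ^ n)"
proof (induction n)
  case (Suc n)
  then show ?case using leading_mult[OF assms Suc] by (simp add: algebra_simps)
qed (simp add: leading_one)

lemma leading_prod:
  assumes "finite A" "\<And>x. x \<in> A \<Longrightarrow> leading w (\<alpha> x) (p x) (q x)"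
  shows "leading w (\<Sum>x\<in>A. \<alpha> x) (\<Prod>x\<in>A. p x) (\<Prod>x\<in>A. q x)"
  using assms by (induction A rule: finite_induct) (auto simp: leading_one intro!: leading_mult)

lemma leading_subst_monom:
  assumes "\<And>v. v \<in> V \<Longrightarrow> leading w (w' v) (g v) (g0 v)" "Poly_Mapping.keys m \<subseteq> V"
  shows "leading w (monom_weight w' m) (subst_monom g m) (subst_monom g0 m)"
  unfolding subst_monom_def monom_weight_def
  using assms by (intro leading_prod leading_power) auto

text \<open>Passing to lowest terms turns a relation among the \<open>g v\<close> into a relation among their initial
  forms, because everything else that the relation contributes is strictly heavier.\<close>

lemma poly_subst_weight_part_eq_0:
  assumes lead: "\<And>v. v \<in> V \<Longrightarrow> leading w (w' v) (g v) (g0 v)"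
    and V: "\<And>m. m \<in> Poly_Mapping.keys f \<Longrightarrow> Poly_Mapping.keys m \<subseteq> V"
    and f0: "poly_subst g f = 0"
    and ge: "\<And>m. m \<in> Poly_Mapping.keys f \<Longrightarrow> \<omega> \<le> monom_weight w' m"
  shows "poly_subst g0 (weight_part w' \<omega> f) = 0"
proof -
  let ?X = "poly_subst g0 (weight_part w' \<omega> f)"
  let ?K = "Poly_Mapping.keys f"
  let ?c = "\<lambda>m. Const (Poly_Mapping.lookup f m)"
  have sub: "Poly_Mapping.keys (weight_part w' \<omega> f) \<subseteq> ?K"
    by (auto simp: in_keys_iff lookup_weight_part split: if_splits)
  have X: "?X = (\<Sum>m\<in>?K. ?c m * (if monom_weight w' m = \<omega> then subst_monom g0 m else 0))"
    by (subst poly_subst_superset[OF _ sub]) (auto simp: lookup_weight_part intro!: sum.cong)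
  have lead': "leading w (monom_weight w' m) (subst_monom g m) (subst_monom g0 m)" if "m \<in> ?K" for m
    using leading_subst_monom[of V, OF lead] V[OF that] by auto
  have f0': "(\<Sum>m\<in>?K. ?c m * subst_monom g m) = 0"
    using f0 by (simp add: poly_subst_def subst_monom_def)
  \<comment> \<open>Subtracting the relation leaves only terms heavier than \<open>\<omega>\<close>, whereas \<open>?X\<close> has weight \<open>\<omega>\<close>.\<close>
  have X': "?X = (\<Sum>m\<in>?K. ?c m * (if monom_weight w' m = \<omega> then subst_monom g0 m - subst_monom g m
      else - subst_monom g m))"
    (is "_ = ?Y")
  proof -
    have "?X = ?X - (\<Sum>m\<in>?K. ?c m * subst_monom g m)" by (simp add: f0')
    also have "\<dots> = ?Y"
      unfolding X by (simp add: sum_subtractf[symmetric] algebra_simps if_distrib cong: if_cong)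
        (auto intro!: sum.cong simp: algebra_simps)
    finally show ?thesis .
  qed
  have "monom_weight w n = \<omega>" if n: "n \<in> Poly_Mapping.keys ?X" for n
  proof -
    from n have "\<exists>m\<in>?K. Poly_Mapping.lookup (?c m * (if monom_weight w' m = \<omega> then subst_monom g0 m else 0)) n \<noteq> 0"
      unfolding X in_keys_iff lookup_sum by (meson sum.neutral)
    then obtain m where "m \<in> ?K" "monom_weight w' m = \<omega>" "n \<in> Poly_Mapping.keys (subst_monom g0 m)"
      by (force simp: lookup_Const_mult in_keys_iff split: if_splits)
    then show ?thesis using lead' by (auto simp: leading_def)
  qed
  moreover have "\<omega> < monom_weight w n" if n: "n \<in> Poly_Mapping.keys ?X" for n
  proof -
    let ?t = "\<lambda>m. if monom_weight w' m = \<omega> then subst_monom g0 m - subst_monom g m else - subst_monom g m"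
    from n have "\<exists>m\<in>?K. Poly_Mapping.lookup (?c m * ?t m) n \<noteq> 0"
      unfolding X' in_keys_iff lookup_sum by (meson sum.neutral)
    then obtain m where m: "m \<in> ?K" "Poly_Mapping.lookup (?t m) n \<noteq> 0"
      by (metis lookup_Const_mult mult_zero_right)
    show ?thesis
    proof (cases "monom_weight w' m = \<omega>")
      case True
      then have "n \<in> Poly_Mapping.keys (subst_monom g m - subst_monom g0 m)"
        using m by (auto simp: in_keys_iff lookup_minus)
      then show ?thesis using lead'[OF m(1)] True by (auto simp: leading_def)
    next
      case False
      then have "\<omega> < monom_weight w' m" using ge[OF m(1)] by simp
      moreover have "n \<in> Poly_Mapping.keys (subst_monom g m)"
        using m False by (auto simp: in_keys_iff)
      then have "n \<in> Poly_Mapping.keys (subst_monom g0 m) \<or>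
          n \<in> Poly_Mapping.keys (subst_monom g m - subst_monom g0 m)"
        by (auto simp: in_keys_iff lookup_minus)
      ultimately show ?thesis using lead'[OF m(1)] by (auto simp: leading_def)
    qed
  qed
  ultimately have "Poly_Mapping.keys ?X = {}" by fastforce
  then show ?thesis by simp
qed

section \<open>Lifting the elements of an initial ideal\<close>

lemma mpoly_ring_simps [simp]:
  "monoid.mult (mpoly_ring V) = (*)" "\<one>\<^bsub>mpoly_ring V\<^esub> = 1"
  "\<zero>\<^bsub>mpoly_ring V\<^esub> = 0" "ring.add (mpoly_ring V) = (+)"
  by (simp_all add: mpoly_ring_def)

lemma carrier_mpoly_ring:
  "p \<in> carrier (mpoly_ring V) \<longleftrightarrow> (\<forall>m \<in> Poly_Mapping.keys p. Poly_Mapping.keys m \<subseteq> V)"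
  by (simp add: mpoly_ring_def)

lemma single_in_carrier:
  "Poly_Mapping.keys m \<subseteq> V \<Longrightarrow> Poly_Mapping.single m c \<in> carrier (mpoly_ring V)"
  by (simp add: carrier_mpoly_ring)

lemma add_in_carrier:
  "p \<in> carrier (mpoly_ring V) \<Longrightarrow> q \<in> carrier (mpoly_ring V) \<Longrightarrow> p + q \<in> carrier (mpoly_ring V)"
  using keys_add[of p q] by (auto simp: carrier_mpoly_ring)

lemma mult_in_carrier:
  assumes "p \<in> carrier (mpoly_ring V)" "q \<in> carrier (mpoly_ring V)"
  shows "p * q \<in> carrier (mpoly_ring V)"
  unfolding carrier_mpoly_ring
proof
  fix m assume "m \<in> Poly_Mapping.keys (p * q)"
  then obtain a b where "a \<in> Poly_Mapping.keys p" "b \<in> Poly_Mapping.keys q" "m = a + b"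
    using keys_mult by blast
  then show "Poly_Mapping.keys m \<subseteq> V"
    using assms keys_add[of a b] by (force simp: carrier_mpoly_ring)
qed

text \<open>An element of an initial ideal need not be an initial form, since the terms of a combination of
  initial forms can cancel. It is liftable in the following sense, which is what survives in sums and
  multiples.\<close>

definition liftable ::
  "'v set \<Rightarrow> ('v \<Rightarrow> real) \<Rightarrow> ('v, 'a::comm_ring_1) mpoly set \<Rightarrow> ('v, 'a) mpoly set" where
  "liftable V w I = {g \<in> carrier (mpoly_ring V). \<forall>\<omega>. \<exists>f \<in> I.
     (\<forall>m \<in> Poly_Mapping.keys f. \<omega> \<le> monom_weight w m) \<and> weight_part w \<omega> f = weight_part w \<omega> g}"

text \<open>For a monomial multiple of \<open>g\<close>, the part of weight \<open>\<omega>\<close> comes from a single part of \<open>g\<close>, whose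
  lift is multiplied along. General multiples are sums of these.\<close>

lemma ideal_liftable:
  fixes I :: "('v, 'a::comm_ring_1) mpoly set"
  assumes ring: "ring (mpoly_ring V :: ('v, 'a) mpoly ring)"
    and zero: "0 \<in> I"
    and add: "\<And>f g. f \<in> I \<Longrightarrow> g \<in> I \<Longrightarrow> f + g \<in> I"
    and mult: "\<And>m c f. Poly_Mapping.keys m \<subseteq> V \<Longrightarrow> f \<in> I \<Longrightarrow> Poly_Mapping.single m c * f \<in> I"
  shows "ideal (liftable V w I) (mpoly_ring V)"
proof -
  let ?R = "mpoly_ring V :: ('v, 'a) mpoly ring"
  let ?L = "liftable V w I"
  have add_L: "f + g \<in> ?L" if f: "f \<in> ?L" and g: "g \<in> ?L" for f g
  proof -
    have "\<exists>h\<in>I. (\<forall>m \<in> Poly_Mapping.keys h. \<omega> \<le> monom_weight w m) \<and>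
        weight_part w \<omega> h = weight_part w \<omega> (f + g)" for \<omega>
    proof -
      obtain f' g' where *: "f' \<in> I" "\<forall>m \<in> Poly_Mapping.keys f'. \<omega> \<le> monom_weight w m"
          "weight_part w \<omega> f' = weight_part w \<omega> f"
          "g' \<in> I" "\<forall>m \<in> Poly_Mapping.keys g'. \<omega> \<le> monom_weight w m"
          "weight_part w \<omega> g' = weight_part w \<omega> g"
        using f g unfolding liftable_def by blast
      then show ?thesis
        using keys_add[of f' g']
        by (intro bexI[of _ "f' + g'"]) (auto simp: weight_part_add add)
    qed
    then show ?thesis using f g by (auto simp: liftable_def add_in_carrier)
  qed
  have sum_L: "(\<Sum>x\<in>A. f x) \<in> ?L" if "finite A" "\<And>x. x \<in> A \<Longrightarrow> f x \<in> ?L" for A f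
    using that
  proof (induction A rule: finite_induct)
    case empty
    show ?case using zero by (auto simp: liftable_def carrier_mpoly_ring intro!: bexI[of _ 0])
  next
    case (insert x A)
    then show ?case by (simp add: add_L)
  qed
  have mono_L: "Poly_Mapping.single m c * g \<in> ?L" if m: "Poly_Mapping.keys m \<subseteq> V" and g: "g \<in> ?L" for m c g
  proof -
    have "\<exists>h\<in>I. (\<forall>m \<in> Poly_Mapping.keys h. \<omega> \<le> monom_weight w m) \<and>
        weight_part w \<omega> h = weight_part w \<omega> (Poly_Mapping.single m c * g)" for \<omega>
    proof -
      obtain f where *: "f \<in> I" "\<forall>n \<in> Poly_Mapping.keys f. \<omega> - monom_weight w m \<le> monom_weight w n"
          "weight_part w (\<omega> - monom_weight w m) f = weight_part w (\<omega> - monom_weight w m) g"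
        using g unfolding liftable_def by blast
      show ?thesis
      proof (intro bexI[of _ "Poly_Mapping.single m c * f"] conjI ballI)
        show "Poly_Mapping.single m c * f \<in> I" using mult m * by simp
        show "weight_part w \<omega> (Poly_Mapping.single m c * f) = weight_part w \<omega> (Poly_Mapping.single m c * g)"
          by (simp add: weight_part_single_mult *)
      next
        fix n assume "n \<in> Poly_Mapping.keys (Poly_Mapping.single m c * f)"
        then show "\<omega> \<le> monom_weight w n"
          using keys_single_mult[of m c f] *(2) by (force simp: monom_weight_add)
      qed
    qed
    then show ?thesis using g single_in_carrier[OF m]
      by (auto simp: liftable_def intro!: mult_in_carrier)
  qed
  have mult_L: "h * g \<in> ?L" if h: "h \<in> carrier ?R" and g: "g \<in> ?L" for h g
  proof -
    have "h * g = (\<Sum>m\<in>Poly_Mapping.keys h. Poly_Mapping.single m (Poly_Mapping.lookup h m) * g)"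
      by (subst (1) poly_mapping_eq_sum_single[of h]) (simp add: sum_distrib_right)
    also have "\<dots> \<in> ?L"
      using h g by (intro sum_L mono_L) (auto simp: carrier_mpoly_ring)
    finally show ?thesis .
  qed
  interpret R: ring ?R by (rule ring)
  have sub: "?L \<subseteq> carrier ?R" by (auto simp: liftable_def)
  have uminus: "\<ominus>\<^bsub>?R\<^esub> x = - x" if "x \<in> carrier ?R" for x
    by (rule R.minus_equality) (use that in \<open>auto simp: carrier_mpoly_ring\<close>)
  show ?thesis
  proof (rule idealI[OF ring])
    show "subgroup ?L (add_monoid ?R)"
    proof (rule R.add.subgroupI)
      show "?L \<noteq> {}" using sum_L[of "{}"] by auto
    next
      fix x assume x: "x \<in> ?L"
      have "- x = Const (-1) * x" by (rule poly_mapping_eqI) (simp add: lookup_Const_mult)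
      also have "\<dots> \<in> ?L" using x by (intro mult_L) (auto simp: Const_def carrier_mpoly_ring)
      finally show "\<ominus>\<^bsub>?R\<^esub> x \<in> ?L" using uminus x sub by auto
    qed (use sub add_L in auto)
  next
    fix a x assume "a \<in> ?L" "x \<in> carrier ?R"
    then show "x \<otimes>\<^bsub>?R\<^esub> a \<in> ?L" "a \<otimes>\<^bsub>?R\<^esub> x \<in> ?L"
      using mult_L[of x a] by (simp_all add: mult.commute)
  qed
qed

lemma initial_form_liftable:
  assumes "f \<in> I" "I \<subseteq> carrier (mpoly_ring V)" "0 \<in> I"
  shows "initial_form w f \<in> liftable V w I"
proof -
  have sub: "Poly_Mapping.keys (initial_form w f) \<subseteq> Poly_Mapping.keys f"
    by (auto simp: initial_form_eq_weight_part in_keys_iff lookup_weight_part split: if_splits)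
  have "\<exists>h\<in>I. (\<forall>m \<in> Poly_Mapping.keys h. \<omega> \<le> monom_weight w m) \<and>
        weight_part w \<omega> h = weight_part w \<omega> (initial_form w f)" for \<omega>
  proof (cases "\<omega> = poly_weight w f")
    case True
    have "weight_part w \<omega> f = weight_part w \<omega> (initial_form w f)"
      by (rule poly_mapping_eqI) (simp add: True initial_form_eq_weight_part lookup_weight_part)
    moreover have "\<omega> \<le> monom_weight w m" if "m \<in> Poly_Mapping.keys f" for m
      unfolding True poly_weight_def by (rule Min_le) (use that in auto)
    ultimately show ?thesis using assms(1) by blast
  next
    case False
    have "weight_part w \<omega> 0 = weight_part w \<omega> (initial_form w f)"
      by (rule poly_mapping_eqI) (use False in \<open>simp add: initial_form_eq_weight_part lookup_weight_part\<close>)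
    then show ?thesis using assms(3) by (intro bexI[of _ 0]) auto
  qed
  moreover have "f \<in> carrier (mpoly_ring V)" using assms by blast
  then have "initial_form w f \<in> carrier (mpoly_ring V)"
    using sub by (auto simp only: carrier_mpoly_ring)
  ultimately show ?thesis by (simp add: liftable_def)
qed

section \<open>Minors\<close>

text \<open>The matrix is transposed: the columns \<open>cs\<close> of \<open>X\<close> are its rows, so that reordering the list
  permutes rows.\<close>

definition minor :: "(nat \<Rightarrow> 'c \<Rightarrow> 'r::comm_ring_1) \<Rightarrow> 'c list \<Rightarrow> 'r" where
  "minor X cs = Determinant.det (Matrix.mat (length cs) (length cs) (\<lambda>(a, i). X i (cs ! a)))"

lemma minor_eq_sum:
  "minor X cs = (\<Sum>p | p permutes {0..<length cs}. of_int (sign p) * (\<Prod>a = 0..<length cs. X (p a) (cs ! a)))"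
proof -
  have "p a < length cs" if "p permutes {0..<length cs}" "a < length cs" for p a
    using permutes_in_image[OF that(1), of a] that(2) by simp
  then show ?thesis
    unfolding minor_def by (subst det_def'[of _ "length cs"]) (auto intro!: sum.cong prod.cong)
qed

lemma minor_reorder:
  assumes "distinct cs" "distinct ds" "set cs = set ds"
  shows "\<exists>\<epsilon> \<in> {1, -1}. minor X cs = \<epsilon> * minor X ds"
proof -
  have "mset cs = mset ds" using assms by (simp add: set_eq_iff_mset_eq_distinct)
  then obtain p where p: "p permutes {..<length ds}" "permute_list p ds = cs"
    by (rule mset_eq_permutation)
  let ?n = "length ds"
  have len: "length cs = ?n" using p(2) by auto
  have nth: "cs ! a = ds ! (p a)" if "a < ?n" for a
    using p that by (metis permute_list_nth)
  have p': "p permutes {0..<?n}" using p(1) by (simp add: atLeast0LessThan)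
  have pl: "p a < ?n" if "a < ?n" for a using permutes_in_image[OF p', of a] that by simp
  let ?A = "Matrix.mat ?n ?n (\<lambda>(a, i). X i (ds ! a))"
  have eq: "Matrix.mat (length cs) (length cs) (\<lambda>(a, i). X i (cs ! a)) =
      Matrix.mat ?n ?n (\<lambda>(a, i). ?A $$ (p a, i))"
    by (rule eq_matI) (auto simp: len nth pl)
  have "minor X cs = signof p * minor X ds"
    unfolding minor_def eq by (rule det_permute_rows[OF _ p']) simp
  then show ?thesis by (cases "sign p = 1") (auto simp: sign_def split: if_splits)
qed

lemma minor_repeated:
  assumes "a < length cs" "b < length cs" "a \<noteq> b" "cs ! a = cs ! b"
  shows "minor X cs = 0"
  unfolding minor_def
  by (rule det_identical_rows[of _ "length cs" a b]) (use assms in \<open>auto intro!: eq_vecI\<close>)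

text \<open>The cofactors of the last column do not involve that column.\<close>

lemma minor_linear_last:
  "\<exists>C. \<forall>v. minor X (cs @ [v]) = (\<Sum>i<Suc (length cs). X i v * C i)"
proof -
  let ?n = "length cs"
  let ?A = "\<lambda>v. Matrix.mat (Suc ?n) (Suc ?n) (\<lambda>(a, i). X i ((cs @ [v]) ! a))"
  have "minor X (cs @ [v]) = (\<Sum>i<Suc ?n. X i v * cofactor (?A undefined) ?n i)" for v
  proof -
    have del: "mat_delete (?A v) ?n i = mat_delete (?A undefined) ?n i" for i
      by (rule eq_matI) (auto simp: mat_delete_def nth_append)
    have "minor X (cs @ [v]) = (\<Sum>i<Suc ?n. ?A v $$ (?n, i) * cofactor (?A v) ?n i)"
      unfolding minor_def length_append list.size One_nat_def add_Suc_right add_0_right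
      by (rule laplace_expansion_row) simp_all
    also have "\<dots> = (\<Sum>i<Suc ?n. X i v * cofactor (?A undefined) ?n i)"
      by (rule sum.cong) (simp_all add: cofactor_def del del: sum.lessThan_Suc)
    finally show ?thesis .
  qed
  then show ?thesis by blast
qed

text \<open>The columns \<open>s, q, r, t\<close> are one too many, so appending to them the row of the values of
  the linear form \<open>v \<mapsto> minor X (s @ [p, v])\<close> gives a singular matrix. Its
  Laplace expansion along that row is the claim, since the linear form vanishes on \<open>s\<close>.\<close>

lemma three_term_relation:
  "minor X (s @ [p, q]) * minor X (s @ [r, t]) - minor X (s @ [p, r]) * minor X (s @ [q, t])
     + minor X (s @ [p, t]) * minor X (s @ [q, r]) = 0"
proof -
  let ?n = "length s + 2"
  let ?cs = "s @ [q, r, t]"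
  let ?l = "\<lambda>v. minor X (s @ [p, v])"
  let ?N = "Matrix.mat (Suc ?n) (Suc ?n) (\<lambda>(a, i). if i < ?n then X i (?cs ! a) else ?l (?cs ! a))"
  have N: "?N \<in> carrier_mat (Suc ?n) (Suc ?n)" by simp
  obtain C where C: "?l v = (\<Sum>i<?n. X i v * C i)" for v
    using minor_linear_last[of X "s @ [p]"] by auto
  \<comment> \<open>The last column of \<open>?N\<close> against its other columns: off-diagonal entries of adjugate times matrix.\<close>
  have adj: "(\<Sum>a<Suc ?n. cofactor ?N a ?n * X i (?cs ! a)) = 0" if i: "i < ?n" for i
  proof -
    have "(adj_mat ?N * ?N) $$ (?n, i) = 0" using adj_mat(3)[OF N] i by simp
    moreover have "(adj_mat ?N * ?N) $$ (?n, i) = (\<Sum>a = 0..<Suc ?n. cofactor ?N a ?n * X i (?cs ! a))"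
      using i adj_mat(1)[OF N]
      by (auto simp: times_mat_def scalar_prod_def adj_mat_def simp del: sum.op_ivl_Suc intro!: sum.cong)
    ultimately show ?thesis by (simp add: atLeast0LessThan del: sum.lessThan_Suc)
  qed
  have "(\<Sum>a<Suc ?n. ?l (?cs ! a) * cofactor ?N a ?n) =
      (\<Sum>a<Suc ?n. \<Sum>i<?n. C i * (cofactor ?N a ?n * X i (?cs ! a)))"
    unfolding C sum_distrib_right by (simp add: algebra_simps del: sum.lessThan_Suc)
  also have "\<dots> = (\<Sum>i<?n. C i * (\<Sum>a<Suc ?n. cofactor ?N a ?n * X i (?cs ! a)))"
    unfolding sum_distrib_left by (rule sum.swap)
  also have "\<dots> = 0" using adj by (simp del: sum.lessThan_Suc)
  finally have "(\<Sum>a<Suc ?n. ?l (?cs ! a) * cofactor ?N a ?n) = 0" .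
  moreover have "?l (?cs ! a) = 0" if "a < length s" for a
    by (rule minor_repeated[of a _ "Suc (length s)"]) (use that in \<open>auto simp: nth_append\<close>)
  ultimately have *: "?l q * cofactor ?N (length s) ?n + ?l r * cofactor ?N (Suc (length s)) ?n
      + ?l t * cofactor ?N (Suc (Suc (length s))) ?n = 0"
    by (simp add: nth_append)
  have del: "Determinant.det (mat_delete ?N a ?n) = minor X ds"
    if "a < Suc ?n" "length ds = ?n" "\<And>b. b < ?n \<Longrightarrow> ds ! b = ?cs ! (if b < a then b else Suc b)" for a ds
  proof -
    have "mat_delete ?N a ?n = Matrix.mat (length ds) (length ds) (\<lambda>(a, i). X i (ds ! a))"
      by (rule eq_matI) (use that in \<open>auto simp: mat_delete_def\<close>)
    then show ?thesis by (simp add: minor_def)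
  qed
  have "Determinant.det (mat_delete ?N (length s) ?n) = minor X (s @ [r, t])"
    "Determinant.det (mat_delete ?N (Suc (length s)) ?n) = minor X (s @ [q, t])"
    "Determinant.det (mat_delete ?N (Suc (Suc (length s))) ?n) = minor X (s @ [q, r])"
    by (rule del; auto simp: nth_append nth_Cons less_Suc_eq split: nat.split)+
  then show ?thesis
    using * by (simp add: cofactor_def)
qed

text \<open>Each column of this matrix has a single nonzero entry, in row \<open>r c\<close>, so only one permutation can
  contribute to the determinant.\<close>

lemma minor_transversal:
  fixes y :: "'c \<Rightarrow> 'r::comm_ring_1"
  assumes d: "distinct cs"
  shows "\<exists>\<epsilon> \<in> {1, -1}. minor (\<lambda>i c. if r c = i then y c else 0) cs =
    (if bij_betw r (set cs) {0..<length cs} then of_int \<epsilon> * (\<Prod>c \<in> set cs. y c) else 0)"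
proof -
  let ?n = "length cs"
  let ?X = "\<lambda>i c. if r c = i then y c else 0"
  let ?p = "\<lambda>a. if a < ?n then r (cs ! a) else a"
  have nth: "bij_betw ((!) cs) {0..<?n} (set cs)"
    by (rule bij_betw_nth[OF d]) (simp_all only: atLeast0LessThan)
  have eq: "p = ?p" if p: "p permutes {0..<?n}" and nz: "(\<Prod>a = 0..<?n. ?X (p a) (cs ! a)) \<noteq> 0" for p
  proof
    fix a
    show "p a = ?p a"
    proof (cases "a < ?n")
      case True
      have "r (cs ! a) = p a"
      proof (rule ccontr)
        assume "r (cs ! a) \<noteq> p a"
        then have "\<exists>a\<in>{0..<?n}. ?X (p a) (cs ! a) = 0" using True by (intro bexI[of _ a]) auto
        then show False using nz by (simp add: prod_zero)
      qed
      then show ?thesis using True by simp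
    next
      case False
      then show ?thesis using p by (auto simp: permutes_def)
    qed
  qed
  have perm: "?p permutes {0..<?n} \<longleftrightarrow> bij_betw r (set cs) {0..<?n}"
  proof -
    have "?p permutes {0..<?n} \<longleftrightarrow> bij_betw ?p {0..<?n} {0..<?n}"
    proof
      assume "bij_betw ?p {0..<?n} {0..<?n}"
      then show "?p permutes {0..<?n}" by (rule bij_imp_permutes) simp
    qed (rule permutes_imp_bij)
    also have "\<dots> \<longleftrightarrow> bij_betw (r \<circ> (!) cs) {0..<?n} {0..<?n}"
      by (rule bij_betw_cong) auto
    also have "\<dots> \<longleftrightarrow> bij_betw r (set cs) {0..<?n}"
      using bij_betw_comp_iff[OF nth] by blast
    finally show ?thesis .
  qed
  show ?thesis
  proof (cases "bij_betw r (set cs) {0..<?n}")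
    case True
    then have p: "?p permutes {0..<?n}" using perm by simp
    have "minor ?X cs = (\<Sum>p \<in> {?p}. of_int (sign p) * (\<Prod>a = 0..<?n. ?X (p a) (cs ! a)))"
      unfolding minor_eq_sum
    proof (rule sum.mono_neutral_right)
      show "\<forall>q \<in> {p. p permutes {0..<?n}} - {?p}. of_int (sign q) * (\<Prod>a = 0..<?n. ?X (q a) (cs ! a)) = 0"
      proof
        fix q assume "q \<in> {p. p permutes {0..<?n}} - {?p}"
        then have "(\<Prod>a = 0..<?n. ?X (q a) (cs ! a)) = 0" using eq by blast
        then show "of_int (sign q) * (\<Prod>a = 0..<?n. ?X (q a) (cs ! a)) = 0" by simp
      qed
    qed (use p in \<open>auto simp: finite_permutations\<close>)
    also have "\<dots> = of_int (sign ?p) * (\<Prod>a = 0..<?n. ?X (?p a) (cs ! a))"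
      by simp
    also have "(\<Prod>a = 0..<?n. ?X (?p a) (cs ! a)) = (\<Prod>c \<in> set cs. y c)"
      by (subst prod.reindex_bij_betw[OF nth, symmetric]) (rule prod.cong, auto)
    finally show ?thesis using True by (auto simp: sign_def split: if_splits)
  next
    case False
    then have "minor ?X cs = 0"
      unfolding minor_eq_sum
    proof (intro sum.neutral ballI)
      fix p assume "p \<in> {p. p permutes {0..<?n}}"
      then have "p permutes {0..<?n}" by simp
      moreover have "p \<noteq> ?p" using calculation False perm by metis
      ultimately have "(\<Prod>a = 0..<?n. ?X (p a) (cs ! a)) = 0" using eq by blast
      then show "of_int (sign p) * (\<Prod>a = 0..<?n. ?X (p a) (cs ! a)) = 0" by simp
    qed
    then show ?thesis using False by auto
  qed
qed

section \<open>Pluecker forms\<close>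

lemma ksetsD:
  assumes "I \<in> ksets k n"
  shows "finite I" "card I = k" "I \<subseteq> {1..n}"
  using assms by (auto simp: ksets_def intro: finite_subset)

lemma nth_elem_bij: "finite I \<Longrightarrow> bij_betw (nth_elem I) {1..card I} I"
proof -
  assume I: "finite I"
  have "bij_betw (\<lambda>r. r - 1) {1..card I} {..<card I}"
    by (rule bij_betw_byWitness[of _ Suc]) auto
  moreover have "bij_betw ((!) (sorted_list_of_set I)) {..<card I} I"
    using I by (intro bij_betw_nth) auto
  ultimately show ?thesis
    unfolding nth_elem_def using bij_betw_trans[of "\<lambda>r. r - 1" _ _ "(!) (sorted_list_of_set I)"]
    by (simp add: comp_def)
qed

lemma position_nth_elem:
  assumes I: "finite I" and r: "r \<in> {1..card I}"
  shows "position I (nth_elem I r) = r"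
proof -
  let ?xs = "sorted_list_of_set I"
  have len: "length ?xs = card I" and s: "sorted_wrt (<) ?xs" by simp_all
  have le: "?xs ! a \<le> ?xs ! b \<longleftrightarrow> a \<le> b" if "a < card I" "b < card I" for a b
    using sorted_wrt_nth_less[OF s, of a b] sorted_wrt_nth_less[OF s, of b a] that len
    by (metis linorder_le_less_linear nat_less_le not_less_iff_gr_or_eq)
  have inj: "inj_on ((!) ?xs) {..<card I}"
    using bij_betw_nth[of ?xs "{..<card I}" I] I by (auto simp: bij_betw_def)
  have "{b \<in> I. b \<le> ?xs ! (r - 1)} = (!) ?xs ` {..<r}"
  proof -
    have "I = (!) ?xs ` {..<card I}"
      using bij_betw_nth[of ?xs "{..<card I}" I] I by (auto simp: bij_betw_def)
    then have "{b \<in> I. b \<le> ?xs ! (r - 1)} = {b \<in> (!) ?xs ` {..<card I}. b \<le> ?xs ! (r - 1)}"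
      by simp
    also have "\<dots> = (!) ?xs ` {..<r}" using le r by auto
    finally show ?thesis .
  qed
  moreover have "card ((!) ?xs ` {..<r}) = r"
    using inj r by (subst card_image) (auto intro: inj_on_subset)
  ultimately show ?thesis by (simp add: position_def nth_elem_def)
qed

lemma nth_elem_position:
  assumes "finite I" "j \<in> I"
  shows "nth_elem I (position I j) = j"
proof -
  have "j \<in> nth_elem I ` {1..card I}"
    using nth_elem_bij[OF assms(1)] assms(2) by (simp add: bij_betw_def)
  then obtain r where "r \<in> {1..card I}" "j = nth_elem I r" by blast
  then show ?thesis using position_nth_elem[OF assms(1)] by simp
qed

lemma position_bij:
  assumes "finite I"
  shows "bij_betw (position I) I {1..card I}"
proof (rule bij_betw_byWitness[of _ "nth_elem I"])
  have img: "nth_elem I ` {1..card I} = I"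
    using nth_elem_bij[OF assms] by (simp add: bij_betw_def)
  then show "nth_elem I ` {1..card I} \<subseteq> I" by simp
  show "position I ` I \<subseteq> {1..card I}"
    unfolding image_subset_iff using img position_nth_elem[OF assms] by (metis imageE)
  show "\<forall>a\<in>I. nth_elem I (position I a) = a"
    using nth_elem_position[OF assms] by blast
  show "\<forall>a\<in>{1..card I}. position I (nth_elem I a) = a"
    using position_nth_elem[OF assms] by blast
qed

text \<open>Rows are numbered from 0 here, as in \<^const>\<open>minor\<close>, but from 1 in the variables.\<close>

abbreviation generic :: "nat \<Rightarrow> nat \<Rightarrow> (nat \<times> nat, 'a::comm_ring_1) mpoly" where
  "generic i j \<equiv> Var (Suc i, j)"

lemma plucker_form_eq_minor:
  assumes "finite I" "card I = k"
  shows "plucker_form k I = minor generic (sorted_list_of_set I)"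
proof -
  let ?A = "Matrix.mat k k (\<lambda>(i, r). generic i (sorted_list_of_set I ! r))"
  have "plucker_form k I = Determinant.det ?A"
    by (simp add: plucker_form_def nth_elem_def)
  also have "\<dots> = Determinant.det (transpose_mat ?A)"
    by (subst det_transpose[of _ k]) auto
  also have "transpose_mat ?A = Matrix.mat k k (\<lambda>(r, i). generic i (sorted_list_of_set I ! r))"
    by (rule eq_matI) auto
  finally show ?thesis using assms by (simp add: minor_def)
qed

lemma plucker_form_eq_minor_list:
  assumes "distinct cs"
  shows "\<exists>\<epsilon> \<in> {1, -1}. minor generic cs = \<epsilon> * (plucker_form (length cs) (set cs) :: (nat \<times> nat, 'a::comm_ring_1) mpoly)"
  using minor_reorder[of cs "sorted_list_of_set (set cs)" "generic :: _ \<Rightarrow> _ \<Rightarrow> (nat \<times> nat, 'a) mpoly"] assms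
  by (simp add: plucker_form_eq_minor distinct_card)

text \<open>The exponent of the monomial that places each column \<open>j\<close> of \<open>I\<close> in row \<open>r j\<close>.\<close>

definition placement :: "(nat \<Rightarrow> nat) \<Rightarrow> nat set \<Rightarrow> (nat \<times> nat) \<Rightarrow>\<^sub>0 nat" where
  "placement r I = (\<Sum>j\<in>I. Poly_Mapping.single (r j, j) 1)"

lemma lookup_placement:
  "finite I \<Longrightarrow> Poly_Mapping.lookup (placement r I) (i, j) = (if j \<in> I \<and> r j = i then 1 else 0)"
proof -
  assume "finite I"
  moreover have "Poly_Mapping.lookup (placement r I) (i, j) =
      (\<Sum>j'\<in>I. if j' = j then (if r j = i then 1 else 0) else 0)"
    unfolding placement_def lookup_sum by (rule sum.cong) (auto simp: lookup_single when_def)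
  ultimately show ?thesis by simp
qed

lemma monom_weight_placement:
  "finite I \<Longrightarrow> monom_weight (\<lambda>(i, j). M i j) (placement r I) = (\<Sum>j\<in>I. M (r j) j)"
  by (simp add: placement_def monom_weight_sum)

lemma prod_single_one:
  "finite A \<Longrightarrow> (\<Prod>x\<in>A. Poly_Mapping.single (m x) (c x)) = Poly_Mapping.single (\<Sum>x\<in>A. m x) (\<Prod>x\<in>A. c x :: 'a::comm_ring_1)"
  by (induction A rule: finite_induct) (simp_all add: mult_single)

text \<open>Different permutations contribute different monomials to the determinant, so nothing cancels.\<close>

lemma placement_in_keys_plucker_form:
  assumes I: "finite I" "card I = k" and r: "bij_betw r I {1..k}"
  shows "placement r I \<in> Poly_Mapping.keys (plucker_form k I :: (nat \<times> nat, 'a::comm_ring_1) mpoly)"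
proof -
  let ?cs = "sorted_list_of_set I"
  define m where "m = (\<lambda>p. \<Sum>a = 0..<k. Poly_Mapping.single (Suc (p a), ?cs ! a) (1::nat))"
  define p0 where "p0 = (\<lambda>a. if a < k then r (?cs ! a) - 1 else a)"
  have len: "length ?cs = k" using I by simp
  have nth: "bij_betw ((!) ?cs) {0..<k} I"
    by (rule bij_betw_nth) (use I in \<open>auto simp: atLeast0LessThan\<close>)
  have sub: "bij_betw (\<lambda>r. r - 1) {1..k} {0..<k}"
    by (rule bij_betw_byWitness[of _ Suc]) auto
  have "bij_betw ((\<lambda>r. r - 1) \<circ> (r \<circ> (!) ?cs)) {0..<k} {0..<k}"
    by (intro bij_betw_trans[OF _ sub] bij_betw_trans[OF nth r])
  then have "bij_betw p0 {0..<k} {0..<k}"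
    by (rule bij_betw_cong[THEN iffD1, rotated]) (simp add: p0_def)
  then have p: "p0 permutes {0..<k}" by (rule bij_imp_permutes) (simp add: p0_def)
  have "placement r I = (\<Sum>a = 0..<k. Poly_Mapping.single (r (?cs ! a), ?cs ! a) 1)"
    unfolding placement_def by (rule sum.reindex_bij_betw[OF nth, symmetric])
  also have "\<dots> = m p0"
    unfolding m_def
  proof (rule sum.cong)
    fix a assume a: "a \<in> {0..<k}"
    then have "?cs ! a \<in> I" using nth by (auto simp: bij_betw_def)
    then have "r (?cs ! a) \<in> {1..k}" using r by (auto simp: bij_betw_def)
    then show "Poly_Mapping.single (r (?cs ! a), ?cs ! a) (1::nat) = Poly_Mapping.single (Suc (p0 a), ?cs ! a) 1"
      using a by (simp add: p0_def)
  qed simp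
  finally have pl: "placement r I = m p0" .
  have form: "plucker_form k I = (\<Sum>p | p permutes {0..<k}. Poly_Mapping.single (m p) (of_int (sign p) :: 'a))"
    using I by (simp add: m_def plucker_form_eq_minor minor_eq_sum len Var_def prod_single_one
        single_of_int[symmetric] mult_single del: single_of_int)
  have inj: "p = q" if pq: "p permutes {0..<k}" "q permutes {0..<k}" "m p = m q" for p q
  proof
    fix a
    show "p a = q a"
    proof (cases "a < k")
      case True
      have ne: "?cs ! b \<noteq> ?cs ! a" if "b < k" "b \<noteq> a" for b
        using that True len by (simp add: nth_eq_iff_index_eq)
      have L: "Poly_Mapping.lookup (m s) (Suc (p a), ?cs ! a) = (if s a = p a then 1 else 0)" for s
      proof -
        have L: "Poly_Mapping.lookup (m s) (Suc (p a), ?cs ! a) =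
            (\<Sum>b\<in>{0..<k}. if b = a then (if s a = p a then 1 else 0) else 0)"
          unfolding m_def lookup_sum by (rule sum.cong) (auto simp: lookup_single when_def ne)
        then show ?thesis using True by simp
      qed
      from L[of p] L[of q] pq(3) show ?thesis by (metis zero_neq_one)
    next
      case False
      then show ?thesis using pq by (auto simp: permutes_def)
    qed
  qed
  have "Poly_Mapping.lookup (plucker_form k I :: (nat \<times> nat, 'a) mpoly) (m p0) =
      (\<Sum>p | p permutes {0..<k}. if p = p0 then of_int (sign p) else 0)"
    unfolding form lookup_sum
  proof (rule sum.cong)
    fix q assume "q \<in> {q. q permutes {0..<k}}"
    then have "m q = m p0 \<longleftrightarrow> q = p0" using inj[of q p0] p by blast
    then show "Poly_Mapping.lookup (Poly_Mapping.single (m q) (of_int (sign q) :: 'a)) (m p0) =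
        (if q = p0 then of_int (sign q) else 0)"
      by (simp add: lookup_single when_def)
  qed simp
  also have "\<dots> = of_int (sign p0)"
    using p by (simp add: finite_permutations)
  finally show ?thesis unfolding pl in_keys_iff by (simp add: sign_def)
qed

lemma matching_monomial_eq:
  assumes I: "finite I" "card I = k"
  shows "matching_monomial k \<Lambda> I = Poly_Mapping.single (placement (row_of \<Lambda> I) I) 1"
proof -
  have "matching_monomial k \<Lambda> I = (\<Prod>r\<in>{1..k}. Var (row_of \<Lambda> I (nth_elem I r), nth_elem I r))"
    unfolding matching_monomial_def row_of_def using I position_nth_elem[OF I(1)]
    by (intro prod.cong) auto
  also have "\<dots> = (\<Prod>j\<in>I. Var (row_of \<Lambda> I j, j))"
    using nth_elem_bij[OF I(1)] I(2) by (intro prod.reindex_bij_betw) simp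
  finally show ?thesis
    by (simp add: Var_def prod_single_one I placement_def)
qed

lemma row_of_bij:
  assumes "matching_field k n \<Lambda>" "I \<in> ksets k n"
  shows "bij_betw (row_of \<Lambda> I) I {1..k}"
proof -
  have "bij_betw (position I) I {1..k}"
    using position_bij ksetsD(1,2)[OF assms(2)] by metis
  moreover have "bij_betw (\<Lambda> I) {1..k} {1..k}"
    using assms by (auto simp: matching_field_def intro: permutes_imp_bij)
  ultimately have "bij_betw (\<Lambda> I \<circ> position I) I {1..k}" by (rule bij_betw_trans)
  then show ?thesis by (simp add: row_of_def[abs_def] comp_def)
qed

lemma initial_form_plucker_form:
  assumes "induces TYPE('a::field) k n M \<Lambda>" "I \<in> ksets k n"
  shows "initial_form (\<lambda>(i, j). M i j) (plucker_form k I :: (nat \<times> nat, 'a) mpoly) =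
    Poly_Mapping.single (placement (row_of \<Lambda> I) I) (of_int (sign (\<Lambda> I)))"
proof -
  have "of_int (sign (\<Lambda> I)) * Poly_Mapping.single m (1::'a) = Poly_Mapping.single m (of_int (sign (\<Lambda> I)))"
    for m :: "(nat \<times> nat) \<Rightarrow>\<^sub>0 nat"
    by (subst single_of_int[symmetric]) (simp add: mult_single del: single_of_int)
  then show ?thesis
    using assms ksetsD(1,2)[OF assms(2)] by (simp add: induces_def matching_monomial_eq)
qed

text \<open>The lowest terms of a Pluecker form are a single monomial, so the matching is the unique
  cheapest one.\<close>

lemma matching_minimal:
  assumes ind: "induces TYPE('a::field) k n M \<Lambda>" and I: "I \<in> ksets k n"
    and r: "bij_betw r I {1..k}"
  shows "(\<Sum>j\<in>I. M (row_of \<Lambda> I j) j) \<le> (\<Sum>j\<in>I. M (r j) j)"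
    and "(\<Sum>j\<in>I. M (r j) j) = (\<Sum>j\<in>I. M (row_of \<Lambda> I j) j) \<Longrightarrow> j \<in> I \<Longrightarrow> r j = row_of \<Lambda> I j"
proof -
  let ?w = "\<lambda>(i, j). M i j"
  let ?P = "plucker_form k I :: (nat \<times> nat, 'a) mpoly"
  note fin = ksetsD(1)[OF I] and card = ksetsD(2)[OF I]
  have in0: "placement (row_of \<Lambda> I) I \<in> Poly_Mapping.keys (initial_form ?w ?P)"
    by (simp add: initial_form_plucker_form[OF ind I] sign_def)
  then have w0: "monom_weight ?w (placement (row_of \<Lambda> I) I) = poly_weight ?w ?P"
    by (auto simp: initial_form_eq_weight_part in_keys_iff lookup_weight_part split: if_splits)
  have key: "placement r I \<in> Poly_Mapping.keys ?P"
    by (rule placement_in_keys_plucker_form[OF fin card r])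
  then have "poly_weight ?w ?P \<le> monom_weight ?w (placement r I)"
    unfolding poly_weight_def by (intro Min_le) auto
  then show "(\<Sum>j\<in>I. M (row_of \<Lambda> I j) j) \<le> (\<Sum>j\<in>I. M (r j) j)"
    using w0 fin by (simp add: monom_weight_placement)
  assume eq: "(\<Sum>j\<in>I. M (r j) j) = (\<Sum>j\<in>I. M (row_of \<Lambda> I j) j)" and j: "j \<in> I"
  then have "placement r I \<in> Poly_Mapping.keys (initial_form ?w ?P)"
    using key w0 fin
    by (simp add: initial_form_eq_weight_part in_keys_iff lookup_weight_part monom_weight_placement)
  then have "placement r I = placement (row_of \<Lambda> I) I"
    by (simp add: initial_form_plucker_form[OF ind I] split: if_splits)
  from arg_cong[OF this, of "\<lambda>m. Poly_Mapping.lookup m (r j, j)"] show "r j = row_of \<Lambda> I j"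
    using j fin by (simp add: lookup_placement split: if_splits)
qed

section \<open>The hexagonal cell\<close>

text \<open>A constant, because proof search would split the explicit set into cases.\<close>

definition rows3 :: "nat set" where
  "rows3 = {1, 2, 3}"

lemma finite_rows3 [simp]: "finite rows3"
  by (simp add: rows3_def)

text \<open>A first coordinate 0 puts the three rows on an equal footing.\<close>

definition coord :: "real \<times> real \<Rightarrow> nat \<Rightarrow> real" where
  "coord x i = (if i = 1 then 0 else if i = 2 then fst x else snd x)"

definition dominates :: "(nat \<Rightarrow> nat \<Rightarrow> real) \<Rightarrow> nat \<Rightarrow> nat \<Rightarrow> real \<times> real \<Rightarrow> bool" where
  "dominates M i j x \<longleftrightarrow> (\<forall>l \<in> rows3. l \<noteq> i \<longrightarrow> coord x l - M l j < coord x i - M i j)"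

lemma continuous_on_coord [continuous_intros]: "continuous_on A (\<lambda>x. coord x i)"
  unfolding coord_def by (cases "i = 1"; cases "i = 2") (auto intro!: continuous_intros)

lemma coord_has_derivative: "((\<lambda>x. coord x i) has_derivative (\<lambda>h. coord h i)) (at x)"
  unfolding coord_def by (cases "i = 1"; cases "i = 2") (auto intro!: derivative_eq_intros)

definition edge_normal :: "nat \<Rightarrow> nat \<Rightarrow> real \<times> real" where
  "edge_normal i l = (coord (1, 0) l - coord (1, 0) i, coord (0, 1) l - coord (0, 1) i)"

lemma coord_inner: "coord x l - coord x i = edge_normal i l \<bullet> x"
  by (cases x) (auto simp: edge_normal_def coord_def)

lemma open_dominates: "open {x. dominates M i j x}"
proof -
  have "{x. dominates M i j x} =
      (\<Inter>l \<in> rows3 - {i}. {x. coord x l - M l j < coord x i - M i j})"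
    by (auto simp: dominates_def)
  moreover have "open {x. coord x l - M l j < coord x i - M i j}" for l
    by (intro open_Collect_less continuous_intros)
  ultimately show ?thesis by (simp only:) (intro open_INT ballI, simp_all add: rows3_def)
qed

lemma convex_dominates: "convex {x. dominates M i j x}"
proof -
  have eq: "{x. dominates M i j x} =
      (\<Inter>l \<in> rows3 - {i}. {x. coord x l - coord x i < M l j - M i j})"
    by (auto simp: dominates_def algebra_simps)
  have "convex {x. coord x l - coord x i < M l j - M i j}" for l
    unfolding coord_inner by (rule convex_halfspace_lt)
  then show ?thesis unfolding eq by (intro convex_INT)
qed

lemma dominates_unique:
  "dominates M i j x \<Longrightarrow> dominates M l j x \<Longrightarrow> i \<in> rows3 \<Longrightarrow> l \<in> rows3 \<Longrightarrow> i = l"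
  unfolding dominates_def by (metis order_less_asym)

text \<open>Where two of the three affine functions attain the maximum \<open>f\<close>, both lie below \<open>f\<close> and touch
  it, so differentiability of \<open>f\<close> would make their slopes equal.\<close>

lemma tropical_line_iff:
  assumes M1: "M 1 j = 0"
  shows "x \<in> tropical_line M j \<longleftrightarrow> \<not> (\<exists>i \<in> rows3. dominates M i j x)"
proof -
  define f where "f = (\<lambda>x. max 0 (max (coord x 2 - M 2 j) (coord x 3 - M 3 j)))"
  have f_eq: "(\<lambda>(x2, x3). max 0 (max (x2 - M 2 j) (x3 - M 3 j))) = f"
    by (auto simp: f_def coord_def)
  have f_ge: "coord y i - M i j \<le> f y" if "i \<in> rows3" for y i
    using that M1 by (auto simp: rows3_def f_def coord_def)
  have f_cases: "\<exists>i\<in>rows3. f y = coord y i - M i j" for y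
    using M1 by (auto simp: rows3_def f_def coord_def max_def)
  have "f differentiable (at x)" if i: "i \<in> rows3" and d: "dominates M i j x" for i
  proof -
    have eq: "coord y i - M i j = f y" if "dominates M i j y" for y
      using f_cases[of y] f_ge[OF i, of y] that unfolding dominates_def
      by (metis less_eq_real_def not_less_iff_gr_or_eq)
    have "((\<lambda>y. coord y i - M i j) has_derivative (\<lambda>h. coord h i - 0)) (at x)"
      by (intro has_derivative_diff coord_has_derivative has_derivative_const)
    then have "(f has_derivative (\<lambda>h. coord h i - 0)) (at x)"
      by (rule has_derivative_transform_within_open[OF _ open_dominates]) (use d eq in auto)
    then show ?thesis by (auto simp: differentiable_def)
  qed
  moreover have "\<exists>i \<in> rows3. dominates M i j x" if diff: "f differentiable (at x)"
  proof (rule ccontr)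
    assume no: "\<not> ?thesis"
    obtain D where D: "(f has_derivative D) (at x)" using diff by (auto simp: differentiable_def)
    have slope: "D h = coord h i" if i: "i \<in> rows3" and touch: "f x = coord x i - M i j" for i h
    proof -
      have "((\<lambda>y. f y - (coord y i - M i j)) has_derivative (\<lambda>h. D h - (coord h i - 0))) (at x)"
        by (intro has_derivative_diff D coord_has_derivative has_derivative_const)
      then have "(\<lambda>h. D h - (coord h i - 0)) = (\<lambda>h. 0)"
        by (rule has_derivative_local_min) (use f_ge[OF i] touch in auto)
      then show ?thesis by (metis diff_zero eq_iff_diff_eq_0)
    qed
    obtain i where i: "i \<in> rows3" "f x = coord x i - M i j" using f_cases by blast
    then obtain l where l: "l \<in> rows3" "l \<noteq> i" "coord x i - M i j \<le> coord x l - M l j"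
      using no unfolding dominates_def by (meson not_less)
    then have "f x = coord x l - M l j" using f_ge[of l x] i(2) by simp
    then have "coord (1, 2) i = coord (1, 2) l"
      using slope[of l "(1, 2)"] slope[of i "(1, 2)"] i l by simp
    then show False using i(1) l(1,2) by (auto simp: rows3_def coord_def)
  qed
  ultimately show ?thesis unfolding tropical_line_def f_eq by auto
qed

text \<open>The regions in which a given row dominates are open and disjoint, and off the tropical line they
  cover the plane, so a connected set lies in one of them. Conversely these regions are convex, so
  their intersection is connected.\<close>

lemma component_eq_dominates:
  assumes M1: "\<forall>j \<in> {1..6}. M 1 j = 0"
    and C: "C \<in> components (- (\<Union>j \<in> {1..6}. tropical_line M j))"
  obtains h where "\<forall>j \<in> {1..6}. h j \<in> rows3"
    and "C = {x. \<forall>j \<in> {1..6}. dominates M (h j) j x}"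
proof -
  let ?W = "- (\<Union>j \<in> {1..6}. tropical_line M j)"
  have W: "x \<in> ?W \<longleftrightarrow> (\<forall>j \<in> {1..6}. \<exists>i \<in> rows3. dominates M i j x)" for x
  proof -
    have "x \<in> ?W \<longleftrightarrow> (\<forall>j \<in> {1..6}. x \<notin> tropical_line M j)" by blast
    also have "\<dots> \<longleftrightarrow> (\<forall>j \<in> {1..6}. \<exists>i \<in> rows3. dominates M i j x)"
      using tropical_line_iff M1 by (intro ball_cong) blast+
    finally show ?thesis .
  qed
  obtain x0 where x0: "x0 \<in> C" using in_components_nonempty[OF C] by blast
  have CW: "C \<subseteq> ?W" by (rule in_components_subset[OF C])
  then have "x0 \<in> ?W" using x0 by (rule subsetD)
  then have "\<forall>j \<in> {1..6}. \<exists>i. i \<in> rows3 \<and> dominates M i j x0" unfolding W by blast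
  then obtain h where h: "\<forall>j \<in> {1..6}. h j \<in> rows3 \<and> dominates M (h j) j x0"
    by (rule bchoice[THEN exE])
  let ?U = "{x. \<forall>j \<in> {1..6}. dominates M (h j) j x}"
  have "C \<subseteq> {x. dominates M (h j) j x}" if j: "j \<in> {1..6}" for j
  proof (rule ccontr)
    assume nsub: "\<not> ?thesis"
    let ?A = "{x. dominates M (h j) j x}" and ?B = "\<Union>i \<in> rows3 - {h j}. {x. dominates M i j x}"
    have "open ?A" by (rule open_dominates)
    moreover have "open ?B" by (intro open_UN ballI open_dominates)
    moreover have "?A \<inter> ?B \<inter> C = {}" using dominates_unique h j by blast
    moreover have AB: "C \<subseteq> ?A \<union> ?B"
    proof
      fix x assume "x \<in> C"
      then have "x \<in> ?W" using CW by (rule subsetD[rotated])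
      then obtain i where "i \<in> rows3" "dominates M i j x" unfolding W using j by blast
      then show "x \<in> ?A \<union> ?B" by (cases "i = h j") auto
    qed
    moreover have "?A \<inter> C \<noteq> {}" using x0 h j by blast
    moreover have "?B \<inter> C \<noteq> {}" using nsub AB by blast
    ultimately show False using connectedD[OF in_components_connected[OF C]] by blast
  qed
  then have "C \<subseteq> ?U" by blast
  moreover have "?U \<subseteq> C"
  proof (rule components_maximal[OF C])
    have "?U = (\<Inter>j \<in> {1..6}. {x. dominates M (h j) j x})" by auto
    then show "connected ?U" by (simp only:) (intro convex_connected convex_INT convex_dominates)
    show "?U \<subseteq> ?W"
    proof
      fix x assume "x \<in> ?U"
      then show "x \<in> ?W" unfolding W using h by blast
    qed
    show "C \<inter> ?U \<noteq> {}" using x0 h by blast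
  qed
  ultimately show thesis using that h by blast
qed

lemma ray_keeps_dominating:
  assumes "dominates M l j x" "l \<noteq> i" "i \<in> rows3" "l \<in> rows3" "0 \<le> t"
  shows "dominates M l j (x + t *\<^sub>R ray_direction i)"
proof -
  let ?y = "x + t *\<^sub>R ray_direction i"
  have "coord ?y m - coord ?y l \<le> coord x m - coord x l" if "m \<in> rows3" for m
    using that assms(2-5) unfolding rows3_def
    by (elim insertE emptyE; simp add: ray_direction_def coord_def)
  then show ?thesis using assms(1) unfolding dominates_def by (smt (verit, best))
qed

text \<open>The six edges of a hexagon \<open>\<tau>\<close> can only lie on the six lines on which one of the inequalities
  \<open>coord x l - coord x i \<le> c i l\<close> is sharp. Hence every one of them carries an edge, and none of
  the inequalities is implied by two others.\<close>

lemma hexagon_strict_triangle: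
  fixes c :: "nat \<Rightarrow> nat \<Rightarrow> real"
  assumes hex: "hexagon \<tau>"
    and le: "\<And>x i l. x \<in> \<tau> \<Longrightarrow> i \<in> rows3 \<Longrightarrow> l \<in> rows3 \<Longrightarrow> i \<noteq> l \<Longrightarrow> coord x l - coord x i \<le> c i l"
    and int: "\<And>x. (\<And>i l. i \<in> rows3 \<Longrightarrow> l \<in> rows3 \<Longrightarrow> i \<noteq> l \<Longrightarrow> coord x l - coord x i < c i l)
        \<Longrightarrow> x \<in> interior \<tau>"
    and ex: "\<exists>x \<in> \<tau>. \<forall>i \<in> rows3. \<forall>l \<in> rows3. i \<noteq> l \<longrightarrow> coord x l - coord x i < c i l"
    and ilm: "i \<in> rows3" "l \<in> rows3" "m \<in> rows3" "i \<noteq> l" "l \<noteq> m" "i \<noteq> m"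
  shows "c i l < c i m + c m l"
proof (rule ccontr)
  assume neg: "\<not> ?thesis"
  define F where "F = (\<lambda>(i, l). \<tau> \<inter> {x. coord x l - coord x i = c i l})"
  let ?idx = "{(i, l). i \<in> rows3 \<and> l \<in> rows3 \<and> i \<noteq> l} :: (nat \<times> nat) set"
  let ?E = "{e. e edge_of \<tau>}"
  have conv: "convex \<tau>" using hex by (auto simp: hexagon_def intro: polytope_imp_convex)
  have face: "F (i, l) face_of \<tau>" if "(i, l) \<in> ?idx" for i l
    unfolding F_def prod.case coord_inner
  proof (rule face_of_Int_supporting_hyperplane_le[OF conv])
    fix x assume "x \<in> \<tau>"
    then show "edge_normal i l \<bullet> x \<le> c i l"
      using le[of x i l] that by (auto simp: coord_inner)
  qed
  \<comment> \<open>A point in the relative interior of an edge lies on the boundary of \<open>\<tau>\<close>, so one inequality is sharp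
    there, and then the edge is the whole face cut out by this inequality.\<close>
  have edge_F: "e \<in> F ` ?idx" if e: "e edge_of \<tau>" for e
  proof -
    have ef: "e face_of \<tau>" and dim1: "aff_dim e = 1" using e by (auto simp: edge_of_def)
    have dim2: "aff_dim \<tau> = 2" using hex by (simp add: hexagon_def)
    have "e \<noteq> {}" using dim1 by auto
    moreover have ce: "convex e" using ef by (rule face_of_imp_convex)
    ultimately obtain x where x: "x \<in> rel_interior e"
      using rel_interior_eq_empty by blast
    then have xe: "x \<in> e" using rel_interior_subset by blast
    have xt: "x \<in> \<tau>" using xe ef by (auto dest: face_of_imp_subset)
    have "e \<noteq> \<tau>" using dim1 dim2 by auto
    then have "x \<notin> interior \<tau>" using face_of_disjoint_interior[OF ef] xe by blast
    then obtain i l where il: "(i, l) \<in> ?idx" "\<not> coord x l - coord x i < c i l"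
      using int by blast
    then have "x \<in> F (i, l)" using le[OF xt, of i l] xt by (auto simp: F_def)
    then have sub: "e \<subseteq> F (i, l)"
      using subset_of_face_of[OF face[OF il(1)] face_of_imp_subset[OF ef]] x by blast
    then have "e face_of F (i, l)"
      using face_of_subset[OF ef sub] face_of_imp_subset[OF face[OF il(1)]] by blast
    moreover have "F (i, l) \<noteq> \<tau>"
    proof -
      obtain x where x: "x \<in> \<tau>" and lt: "\<forall>i \<in> rows3. \<forall>l \<in> rows3. i \<noteq> l \<longrightarrow> coord x l - coord x i < c i l"
        using ex by blast
      have "coord x l - coord x i < c i l" using lt il(1) by blast
      then have "x \<notin> F (i, l)" by (simp add: F_def)
      then show ?thesis using x by blast
    qed
    then have "aff_dim (F (i, l)) < 2"
      using face_of_aff_dim_lt[OF conv face[OF il(1)]] dim2 by simp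
    moreover have "convex (F (i, l))" using face[OF il(1)] by (rule face_of_imp_convex)
    ultimately have "e = F (i, l)"
      using face_of_aff_dim_lt[of "F (i, l)" e] dim1 by (cases "e = F (i, l)") simp_all
    then show ?thesis using il(1) by blast
  qed
  have idx: "?idx = {(1, 2), (1, 3), (2, 1), (2, 3), (3, 1), (3, 2)}" by (auto simp: rows3_def)
  have "card (F ` ?idx) \<le> card ?idx" by (rule card_image_le) (simp add: idx)
  also have "card ?idx = 6" by (simp add: idx)
  also have "6 = card ?E" using hex by (simp add: hexagon_def)
  finally have "?E = F ` ?idx"
    using edge_F by (intro card_seteq) (auto simp: idx)
  then have "F (i, l) edge_of \<tau>" using ilm by blast
  then have dim: "aff_dim (F (i, l)) = 1" by (simp add: edge_of_def)
  \<comment> \<open>If the inequality for \<open>(i, l)\<close> followed from the other two, both would be sharp on this face.\<close>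
  have eq: "x = y" if xy: "x \<in> F (i, l)" "y \<in> F (i, l)" for x y
  proof -
    have *: "coord z l - coord z i = c i l \<and> coord z m - coord z i = c i m" if "z \<in> F (i, l)" for z
      using that neg le[of z i m] le[of z m l] ilm by (auto simp: F_def)
    show ?thesis
      using *[OF xy(1)] *[OF xy(2)] ilm by (cases x; cases y) (auto simp: rows3_def coord_def)
  qed
  have "F (i, l) \<noteq> {}" using dim by auto
  then obtain x where "x \<in> F (i, l)" by blast
  then have "F (i, l) = {x}" using eq by blast
  then show False using dim by simp
qed

text \<open>\<open>h j\<close> is the row in which column \<open>j\<close> is cheapest as seen from a point \<open>\<xi>\<close> of the cell.
  The last clause compares the two ways of vacating row \<open>i\<close> in favour of row \<open>l\<close>: a column moves
  directly, or one column moves to row \<open>m\<close> and another one from there to row \<open>l\<close>. It holds because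
  the inequalities that bound the cell are \<open>coord x l - coord x i \<le> c i l\<close>, where \<open>c i l\<close> is the price
  of the cheapest direct move.\<close>

lemma hexagonal_cell_data:
  assumes M1: "\<forall>j \<in> {1..6}. M 1 j = 0" and cell: "\<tau> \<in> cells M"
    and cov: "coarse_covector M \<tau> = (2, 2, 2)" and hex: "hexagon \<tau>"
  obtains h \<xi> where "\<forall>j \<in> {1..6}. h j \<in> rows3"
    and "\<forall>i \<in> rows3. card {j \<in> {1..6}. h j = i} = 2"
    and "\<And>j l. j \<in> {1..6} \<Longrightarrow> l \<in> rows3 \<Longrightarrow> l \<noteq> h j \<Longrightarrow> M (h j) j - \<xi> (h j) < M l j - \<xi> l"
    and "\<And>i l m. {i, l, m} = rows3 \<Longrightarrow> \<exists>p \<in> {j \<in> {1..6}. h j = i}.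
      \<forall>q \<in> {j \<in> {1..6}. h j = i}. M l p - M i p \<le> M l q - M i q \<and>
        (\<forall>x \<in> {j \<in> {1..6}. h j = m}. M l p - M i p < (M m q - M i q) + (M l x - M m x))"
proof -
  obtain C where C: "C \<in> components (- (\<Union>j \<in> {1..6}. tropical_line M j))" and \<tau>: "\<tau> = closure C"
    using cell by (auto simp: cells_def)
  obtain h where h: "\<forall>j \<in> {1..6}. h j \<in> rows3"
    and C_eq: "C = {x. \<forall>j \<in> {1..6}. dominates M (h j) j x}"
    by (rule component_eq_dominates[OF M1 C])
  have C_INT: "C = (\<Inter>j \<in> {1..6}. {x. dominates M (h j) j x})" unfolding C_eq by auto
  have oC: "open C" unfolding C_INT by (intro open_INT) (auto intro: open_dominates)
  have cC: "convex C" unfolding C_INT by (intro convex_INT convex_dominates)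
  obtain x0 where x0: "x0 \<in> C" using in_components_nonempty[OF C] by blast
  have int: "interior \<tau> = C" using convex_interior_closure[OF cC] oC by (simp add: \<tau> interior_open)
  define S where "S = (\<lambda>i. {j \<in> {1..6::nat}. h j = i})"
  have finS: "finite (S i)" for i by (simp add: S_def)
  \<comment> \<open>The covector has two elements in each direction, and the three sets \<open>S i\<close> share six columns, so this
    inclusion determines the sizes of the \<open>S i\<close>.\<close>
  have "covector M \<tau> i \<subseteq> S i" if i: "i \<in> rows3" for i
  proof
    fix j assume j: "j \<in> covector M \<tau> i"
    then have j6: "j \<in> {1..6}" by (simp add: covector_def)
    obtain t where t: "0 \<le> t" "x0 + t *\<^sub>R ray_direction i \<in> tropical_line M j"
      using j x0 unfolding covector_def int by blast
    have dom: "dominates M (h j) j x0" using x0 j6 by (simp add: C_eq)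
    have "h j = i"
    proof (rule ccontr)
      assume "h j \<noteq> i"
      then have "dominates M (h j) j (x0 + t *\<^sub>R ray_direction i)"
        using ray_keeps_dominating[OF dom] i h j6 t(1) by blast
      then show False using t(2) tropical_line_iff[of M j] M1 j6 h by blast
    qed
    then show "j \<in> S i" using j6 by (simp add: S_def)
  qed
  then have "card (covector M \<tau> i) \<le> card (S i)" if "i \<in> rows3" for i
    using that card_mono[OF finS] by blast
  moreover have "card (covector M \<tau> i) = 2" if "i \<in> rows3" for i
    using cov that by (auto simp: coarse_covector_def rows3_def)
  ultimately have ge: "2 \<le> card (S i)" if "i \<in> rows3" for i
    using that by metis
  have "card (S 1) + card (S 2) + card (S 3) = 6"
  proof -
    have "S 1 \<union> S 2 \<union> S 3 = {1..6}" using h by (auto simp: S_def rows3_def)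
    moreover have "card (S 1 \<union> S 2 \<union> S 3) = card (S 1) + card (S 2) + card (S 3)"
      by (subst card_Un_disjoint; (subst card_Un_disjoint)?) (auto simp: S_def)
    ultimately show ?thesis by simp
  qed
  then have "card (S 1) = 2 \<and> card (S 2) = 2 \<and> card (S 3) = 2"
    using ge[of 1] ge[of 2] ge[of 3] by (simp add: rows3_def)
  then have card2: "\<forall>i \<in> rows3. card (S i) = 2" by (simp add: rows3_def)
  define c where "c = (\<lambda>i l. Min ((\<lambda>j. M l j - M i j) ` S i))"
  have Sne: "S i \<noteq> {}" if "i \<in> rows3" for i
  proof -
    have "card (S i) = 2" using card2 that by blast
    then show ?thesis by auto
  qed
  have c_le: "c i l \<le> M l j - M i j" if "j \<in> S i" for i l j
    unfolding c_def by (rule Min_le) (use that finS in auto)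
  have c_in: "\<exists>p \<in> S i. c i l = M l p - M i p" if "i \<in> rows3" for i l
  proof -
    have "c i l \<in> (\<lambda>j. M l j - M i j) ` S i"
      unfolding c_def by (rule Min_in) (use finS Sne[OF that] in auto)
    then show ?thesis by blast
  qed
  have C_iff: "x \<in> C \<longleftrightarrow> (\<forall>i \<in> rows3. \<forall>l \<in> rows3. i \<noteq> l \<longrightarrow> coord x l - coord x i < c i l)" for x
  proof
    assume x: "x \<in> C"
    show "\<forall>i \<in> rows3. \<forall>l \<in> rows3. i \<noteq> l \<longrightarrow> coord x l - coord x i < c i l"
    proof (intro ballI impI)
      fix i l :: nat assume il: "i \<in> rows3" "l \<in> rows3" "i \<noteq> l"
      obtain p where "p \<in> S i" "c i l = M l p - M i p" using c_in[OF il(1)] by blast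
      moreover have "dominates M (h p) p x" "h p = i"
        using x \<open>p \<in> S i\<close> by (auto simp: C_eq S_def)
      ultimately show "coord x l - coord x i < c i l"
        using il by (auto simp: dominates_def)
    qed
  next
    assume *: "\<forall>i \<in> rows3. \<forall>l \<in> rows3. i \<noteq> l \<longrightarrow> coord x l - coord x i < c i l"
    have "dominates M (h j) j x" if j: "j \<in> {1..6}" for j
      unfolding dominates_def
    proof (intro ballI impI)
      fix l :: nat assume l: "l \<in> rows3" "l \<noteq> h j"
      moreover have "h j \<in> rows3" using h j by blast
      ultimately have "coord x l - coord x (h j) < c (h j) l" using * by metis
      also have "\<dots> \<le> M l j - M (h j) j" using c_le j by (simp add: S_def)
      finally show "coord x l - M l j < coord x (h j) - M (h j) j" by simp
    qed
    then show "x \<in> C" by (simp add: C_eq)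
  qed
  have le: "coord x l - coord x i \<le> c i l" if "x \<in> \<tau>" "i \<in> rows3" "l \<in> rows3" "i \<noteq> l" for x i l
  proof -
    have "closed {x. coord x l - coord x i \<le> c i l}"
      by (intro closed_Collect_le continuous_intros)
    moreover have "C \<subseteq> {x. coord x l - coord x i \<le> c i l}"
    proof
      fix y assume "y \<in> C"
      then have "coord y l - coord y i < c i l" using C_iff that(2-4) by blast
      then show "y \<in> {x. coord x l - coord x i \<le> c i l}" by simp
    qed
    ultimately have "\<tau> \<subseteq> {x. coord x l - coord x i \<le> c i l}" unfolding \<tau> by (intro closure_minimal)
    then show ?thesis using that(1) by blast
  qed
  have strict: "c i l < c i m + c m l" if "{i, l, m} = rows3" for i l m
  proof (rule hexagon_strict_triangle[OF hex le])
    show "\<exists>x\<in>\<tau>. \<forall>i\<in>rows3. \<forall>l\<in>rows3. i \<noteq> l \<longrightarrow> coord x l - coord x i < c i l"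
      using x0 C_iff closure_subset[of C] unfolding \<tau> by blast
    show "x \<in> interior \<tau>" if "\<And>i l. i \<in> rows3 \<Longrightarrow> l \<in> rows3 \<Longrightarrow> i \<noteq> l \<Longrightarrow> coord x l - coord x i < c i l" for x
      unfolding int C_iff using that by blast
    have "card {i, l, m} = 3" unfolding that by (simp add: rows3_def)
    then show "i \<noteq> l" "l \<noteq> m" "i \<noteq> m" by (auto simp: card_insert_if split: if_splits)
    show "i \<in> rows3" "l \<in> rows3" "m \<in> rows3" unfolding that[symmetric] by simp_all
  qed
  show thesis
  proof (rule that[OF h])
    show "\<forall>i\<in>rows3. card {j \<in> {1..6}. h j = i} = 2" using card2 by (simp add: S_def)
    show "M (h j) j - coord x0 (h j) < M l j - coord x0 l"
      if "j \<in> {1..6}" "l \<in> rows3" "l \<noteq> h j" for j l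
    proof -
      have "dominates M (h j) j x0" using x0 that(1) by (simp add: C_eq)
      then have "coord x0 l - M l j < coord x0 (h j) - M (h j) j"
        using that(2,3) by (simp add: dominates_def)
      then show ?thesis by simp
    qed
    fix i l m :: nat assume ilm: "{i, l, m} = rows3"
    then have "i \<in> rows3" by (simp flip: ilm)
    then obtain p where p: "p \<in> S i" "c i l = M l p - M i p" using c_in by blast
    have "M l p - M i p \<le> M l q - M i q \<and>
        (\<forall>x \<in> S m. M l p - M i p < (M m q - M i q) + (M l x - M m x))" if "q \<in> S i" for q
    proof (intro conjI ballI)
      show "M l p - M i p \<le> M l q - M i q" using c_le[OF that, of l] p(2) by simp
      fix x assume "x \<in> S m"
      then show "M l p - M i p < (M m q - M i q) + (M l x - M m x)"
        using c_le[OF that, of m] c_le[of x m l] strict[OF ilm] p(2) by simp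
    qed
    then show "\<exists>p \<in> {j \<in> {1..6}. h j = i}.
      \<forall>q \<in> {j \<in> {1..6}. h j = i}. M l p - M i p \<le> M l q - M i q \<and>
        (\<forall>x \<in> {j \<in> {1..6}. h j = m}. M l p - M i p < (M m q - M i q) + (M l x - M m x))"
      using p(1) unfolding S_def by (intro bexI[of _ p] ballI) auto
  qed
qed

section \<open>Binomials in a prime initial ideal\<close>

lemma single_power:
  "\<exists>E. Poly_Mapping.single m c ^ n = Poly_Mapping.single E (c ^ n :: 'a::comm_ring_1) \<and>
     (\<forall>x. Poly_Mapping.lookup E x = n * Poly_Mapping.lookup (m :: 'v \<Rightarrow>\<^sub>0 nat) x)"
proof (induction n)
  case 0
  show ?case by (intro exI[of _ 0]) simp
next
  case (Suc n)
  then obtain E where E: "Poly_Mapping.single m c ^ n = Poly_Mapping.single E (c ^ n)"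
    "\<forall>x. Poly_Mapping.lookup E x = n * Poly_Mapping.lookup m x" by blast
  then show ?case by (intro exI[of _ "m + E"]) (simp add: mult_single lookup_add)
qed

lemma subst_monom_singles:
  "\<exists>E. subst_monom (\<lambda>v. Poly_Mapping.single (m v) (c v)) u =
       Poly_Mapping.single E (\<Prod>v\<in>Poly_Mapping.keys u. c v ^ Poly_Mapping.lookup u v :: 'a::comm_ring_1) \<and>
     (\<forall>x. Poly_Mapping.lookup E x =
       (\<Sum>v\<in>Poly_Mapping.keys u. Poly_Mapping.lookup u v * Poly_Mapping.lookup (m v :: 'x \<Rightarrow>\<^sub>0 nat) x))"
proof -
  have "\<forall>v. \<exists>E. Poly_Mapping.single (m v) (c v) ^ Poly_Mapping.lookup u v =
      Poly_Mapping.single E (c v ^ Poly_Mapping.lookup u v) \<and>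
      (\<forall>x. Poly_Mapping.lookup E x = Poly_Mapping.lookup u v * Poly_Mapping.lookup (m v) x)"
    by (intro allI single_power)
  then obtain E where E: "\<And>v. Poly_Mapping.single (m v) (c v) ^ Poly_Mapping.lookup u v =
      Poly_Mapping.single (E v) (c v ^ Poly_Mapping.lookup u v)"
      "\<And>v x. Poly_Mapping.lookup (E v) x = Poly_Mapping.lookup u v * Poly_Mapping.lookup (m v) x"
    by metis
  show ?thesis
    by (intro exI[of _ "\<Sum>v\<in>Poly_Mapping.keys u. E v"])
      (simp add: subst_monom_def E(1) prod_single_one lookup_sum E(2))
qed

lemma weight_part_single:
  "weight_part w \<omega> (Poly_Mapping.single m c) = (if monom_weight w m = \<omega> then Poly_Mapping.single m c else 0)"
  by (rule poly_mapping_eqI) (auto simp: lookup_weight_part lookup_single when_def)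

locale prime_initial_ideal =
  fixes k n :: nat
    and \<Lambda> :: "nat set \<Rightarrow> nat \<Rightarrow> nat"
    and M :: "nat \<Rightarrow> nat \<Rightarrow> real"
    and J :: "(nat set, 'a::field) mpoly set"
    and w :: "nat set \<Rightarrow> real"
  assumes k3: "3 \<le> k"
    and matching: "matching_field k n \<Lambda>"
    and ind: "induces TYPE('a) k n M \<Lambda>"
    and w_def: "w = plucker_weight TYPE('a) k M"
    and J_def: "J = initial_plucker_ideal k n M"
    and prime: "primeideal J (mpoly_ring (ksets k n))"
begin

abbreviation "V \<equiv> ksets k n"
abbreviation "R \<equiv> mpoly_ring V :: (nat set, 'a) mpoly ring"
abbreviation "I \<equiv> plucker_ideal k n :: (nat set, 'a) mpoly set"
abbreviation "W \<equiv> \<lambda>(i, j). M i j"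
abbreviation "P \<equiv> plucker_form k :: nat set \<Rightarrow> (nat \<times> nat, 'a) mpoly"

definition expo :: "nat set \<Rightarrow> (nat \<times> nat) \<Rightarrow>\<^sub>0 nat" where
  "expo A = placement (row_of \<Lambda> A) A"

text \<open>The image of \<open>P\<^sub>A\<close> under the monomial map: the initial form of the minor.\<close>

definition in_P :: "nat set \<Rightarrow> (nat \<times> nat, 'a) mpoly" where
  "in_P A = Poly_Mapping.single (expo A) (of_int (sign (\<Lambda> A)))"

lemma in_P: "A \<in> V \<Longrightarrow> initial_form W (P A) = in_P A"
  using initial_form_plucker_form[OF ind] by (simp add: in_P_def expo_def)

lemma leading_P:
  assumes A: "A \<in> V"
  shows "w A = monom_weight W (expo A)" "leading W (w A) (P A) (in_P A)"
proof -
  have "poly_weight W (in_P A) = monom_weight W (expo A)"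
    by (simp add: poly_weight_def in_P_def sign_def)
  then show w: "w A = monom_weight W (expo A)"
    by (simp add: w_def plucker_weight_def in_P[OF A])
  have lead: "leading W (poly_weight W (P A)) (P A) (in_P A)"
    using leading_initial_form[of W "P A"] by (simp add: in_P[OF A])
  then have "monom_weight W (expo A) = poly_weight W (P A)"
    by (auto simp: leading_def in_P_def sign_def split: if_splits)
  then show "leading W (w A) (P A) (in_P A)" using lead w by simp
qed

lemma plucker_ideal_closed:
  "0 \<in> I" "f \<in> I \<Longrightarrow> g \<in> I \<Longrightarrow> f + g \<in> I"
  "Poly_Mapping.keys m \<subseteq> V \<Longrightarrow> f \<in> I \<Longrightarrow> Poly_Mapping.single m c * f \<in> I"
  unfolding plucker_ideal_def
  by (auto simp: poly_subst_add poly_subst_mult add_in_carrier mult_in_carrier single_in_carrier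
      simp del: poly_subst_single) (simp add: carrier_mpoly_ring)

lemma plucker_ideal_carrier: "I \<subseteq> carrier R"
  by (auto simp: plucker_ideal_def)

lemma cring_R: "cring R" and ideal_J: "ideal J R"
  using prime by (auto simp: primeideal_def)

lemma J_subset_liftable: "J \<subseteq> liftable V w I"
proof -
  have "ideal (liftable V w I) R"
    by (rule ideal_liftable) (use cring.axioms(1)[OF cring_R] plucker_ideal_closed in auto)
  moreover have "initial_form w ` I \<subseteq> liftable V w I"
    using initial_form_liftable[OF _ plucker_ideal_carrier plucker_ideal_closed(1)] by blast
  ultimately show ?thesis
    unfolding J_def initial_plucker_ideal_def w_def[symmetric]
    by (intro ring.genideal_minimal[OF cring.axioms(1)[OF cring_R]])
qed

lemma initial_form_in_J: "f \<in> I \<Longrightarrow> initial_form w f \<in> J"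
proof -
  assume f: "f \<in> I"
  have "initial_form w ` I \<subseteq> carrier R"
    using initial_form_liftable[OF _ plucker_ideal_carrier plucker_ideal_closed(1)]
    by (auto simp: liftable_def)
  then show ?thesis
    unfolding J_def initial_plucker_ideal_def w_def[symmetric]
    using ring.genideal_self[OF cring.axioms(1)[OF cring_R]] f by blast
qed

lemma J_add: "f \<in> J \<Longrightarrow> g \<in> J \<Longrightarrow> f + g \<in> J"
  using additive_subgroup.a_closed[OF ideal.axioms(1)[OF ideal_J]] by simp

lemma J_mult: "f \<in> J \<Longrightarrow> g \<in> carrier R \<Longrightarrow> g * f \<in> J"
  using ideal.I_l_closed[OF ideal_J] by simp

lemma J_prime: "f \<in> carrier R \<Longrightarrow> g \<in> carrier R \<Longrightarrow> f * g \<in> J \<Longrightarrow> f \<in> J \<or> g \<in> J"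
  using primeideal.I_prime[OF prime] by simp

text \<open>Each homogeneous part of \<open>g\<close> is the lowest part of a relation among the minors, so its image is a
  relation among the initial forms of the minors.\<close>

lemma J_in_kernel:
  assumes g: "g \<in> J"
  shows "poly_subst in_P g = 0"
proof -
  have "poly_subst in_P (weight_part w \<omega> g) = 0" for \<omega>
  proof -
    obtain f where f: "f \<in> I" "\<forall>m \<in> Poly_Mapping.keys f. \<omega> \<le> monom_weight w m"
        "weight_part w \<omega> f = weight_part w \<omega> g"
      using g J_subset_liftable unfolding liftable_def by blast
    have "poly_subst in_P (weight_part w \<omega> f) = 0"
      by (rule poly_subst_weight_part_eq_0[of V W w P])
        (use f leading_P(2) in \<open>auto simp: plucker_ideal_def carrier_mpoly_ring\<close>)
    then show ?thesis by (simp add: f(3))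
  qed
  then show ?thesis
    by (subst poly_eq_sum_weight_parts[of g w]) (simp add: poly_subst_sum)
qed

lemma sign_neq_0: "of_int (sign p) \<noteq> (0 :: 'a)"
  by (simp add: sign_def)

lemma subst_monom_in_P_neq_0: "subst_monom in_P u \<noteq> 0"
proof -
  have "(\<Prod>v\<in>Poly_Mapping.keys u. of_int (sign (\<Lambda> v)) ^ Poly_Mapping.lookup u v) \<noteq> (0 :: 'a)"
    by (simp add: sign_neq_0)
  moreover obtain E where "subst_monom in_P u = Poly_Mapping.single E
      (\<Prod>v\<in>Poly_Mapping.keys u. of_int (sign (\<Lambda> v)) ^ Poly_Mapping.lookup u v)"
    using subst_monom_singles[of expo "\<lambda>A. of_int (sign (\<Lambda> A)) :: 'a" u]
    unfolding in_P_def[abs_def] by blast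
  ultimately have "Poly_Mapping.lookup (subst_monom in_P u) E \<noteq> 0" by simp
  then show ?thesis by auto
qed

lemma monomial_not_in_J:
  assumes "c \<noteq> 0"
  shows "Poly_Mapping.single u c \<notin> J"
proof
  assume "Poly_Mapping.single u c \<in> J"
  then have "Const c * subst_monom in_P u = 0" using J_in_kernel by fastforce
  moreover have "Const (1 / c) * (Const c * subst_monom in_P u) = subst_monom in_P u"
    using assms by (simp add: mult.assoc[symmetric] Const_mult[symmetric])
  ultimately show False using subst_monom_in_P_neq_0 by simp
qed

text \<open>Proportionality of monomials modulo \<open>J\<close>. The factor is nonzero because \<open>J\<close> contains no monomial,
  which gives symmetry; cancellation holds because \<open>J\<close> is moreover prime.\<close>

definition prop_mod :: "(nat set \<Rightarrow>\<^sub>0 nat) \<Rightarrow> (nat set \<Rightarrow>\<^sub>0 nat) \<Rightarrow> bool" (infix \<open>\<simeq>\<close> 50) where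
  "u \<simeq> v \<longleftrightarrow> Poly_Mapping.keys u \<subseteq> V \<and> Poly_Mapping.keys v \<subseteq> V \<and>
     (\<exists>c. Poly_Mapping.single u 1 - Poly_Mapping.single v c \<in> J)"

lemma rel_refl: "Poly_Mapping.keys u \<subseteq> V \<Longrightarrow> u \<simeq> u"
proof -
  have "0 * initial_form w 0 \<in> J"
    by (rule J_mult) (simp_all add: initial_form_in_J plucker_ideal_closed(1) carrier_mpoly_ring)
  then show "Poly_Mapping.keys u \<subseteq> V \<Longrightarrow> u \<simeq> u"
    by (auto simp: prop_mod_def intro!: exI[of _ 1])
qed

lemma rel_sym:
  assumes "u \<simeq> v"
  shows "v \<simeq> u"
proof -
  obtain c where c: "Poly_Mapping.single u 1 - Poly_Mapping.single v c \<in> J"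
    using assms by (auto simp: prop_mod_def)
  have c0: "c \<noteq> 0" using c monomial_not_in_J[of 1 u] by auto
  have "Poly_Mapping.single 0 (- 1 / c) * (Poly_Mapping.single u 1 - Poly_Mapping.single v c) =
      Poly_Mapping.single v 1 - Poly_Mapping.single u (1 / c)"
    using c0 by (simp add: right_diff_distrib mult_single single_uminus)
  moreover have "Poly_Mapping.single 0 (- 1 / c) * (Poly_Mapping.single u 1 - Poly_Mapping.single v c) \<in> J"
    by (rule J_mult[OF c]) (simp add: single_in_carrier)
  ultimately show ?thesis using assms by (auto simp: prop_mod_def)
qed

lemma rel_add:
  assumes "u \<simeq> v" "u' \<simeq> v'"
  shows "u + u' \<simeq> v + v'"
proof -
  obtain c c' where c: "Poly_Mapping.single u 1 - Poly_Mapping.single v c \<in> J"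
      "Poly_Mapping.single u' 1 - Poly_Mapping.single v' c' \<in> J"
    using assms by (auto simp: prop_mod_def)
  have "Poly_Mapping.single u' 1 * (Poly_Mapping.single u 1 - Poly_Mapping.single v c)
      + Poly_Mapping.single v c * (Poly_Mapping.single u' 1 - Poly_Mapping.single v' c') \<in> J"
    using assms c by (intro J_add J_mult) (auto simp: prop_mod_def single_in_carrier)
  moreover have "Poly_Mapping.single u' 1 * (Poly_Mapping.single u 1 - Poly_Mapping.single v c)
      + Poly_Mapping.single v c * (Poly_Mapping.single u' 1 - Poly_Mapping.single v' c') =
      Poly_Mapping.single (u + u') 1 - Poly_Mapping.single (v + v') (c * c')"
    by (simp add: algebra_simps mult_single)
  ultimately show ?thesis
    using assms keys_add[of u u'] keys_add[of v v'] by (auto simp: prop_mod_def)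
qed

lemma rel_cancel:
  assumes uv: "u + z \<simeq> v + z" and keys: "Poly_Mapping.keys u \<subseteq> V" "Poly_Mapping.keys v \<subseteq> V" "Poly_Mapping.keys z \<subseteq> V"
  shows "u \<simeq> v"
proof -
  obtain c where c: "Poly_Mapping.single (u + z) 1 - Poly_Mapping.single (v + z) c \<in> J"
    using uv by (auto simp: prop_mod_def)
  have "Poly_Mapping.single z 1 * (Poly_Mapping.single u 1 - Poly_Mapping.single v c) \<in> J"
    using c by (simp add: right_diff_distrib mult_single add.commute)
  moreover have "Poly_Mapping.single u 1 - Poly_Mapping.single v c = Poly_Mapping.single u 1 + Poly_Mapping.single v (- c)"
    by (simp add: single_uminus)
  then have "Poly_Mapping.single u 1 - Poly_Mapping.single v c \<in> carrier R"
    using keys by (simp only:) (intro add_in_carrier single_in_carrier)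
  ultimately have "Poly_Mapping.single z 1 \<in> J \<or> Poly_Mapping.single u 1 - Poly_Mapping.single v c \<in> J"
    using keys by (intro J_prime single_in_carrier)
  then show ?thesis using monomial_not_in_J[of 1 z] keys by (auto simp: prop_mod_def)
qed

text \<open>The exponent of the product of two variables \<open>P\<^sub>A P\<^sub>B\<close>.\<close>

abbreviation pair :: "nat set \<Rightarrow> nat set \<Rightarrow> (nat set \<Rightarrow>\<^sub>0 nat)" where
  "pair A B \<equiv> Poly_Mapping.single A 1 + Poly_Mapping.single B 1"

lemma keys_pair: "A \<in> V \<Longrightarrow> B \<in> V \<Longrightarrow> Poly_Mapping.keys (pair A B) \<subseteq> V"
  using keys_add[of "Poly_Mapping.single A (1::nat)" "Poly_Mapping.single B 1"] by auto

lemma monom_weight_pair: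
  "A \<in> V \<Longrightarrow> B \<in> V \<Longrightarrow> monom_weight w (pair A B) = monom_weight W (expo A + expo B)"
  by (simp add: monom_weight_add leading_P(1))

lemma subst_monom_pair:
  "\<exists>s. s \<noteq> 0 \<and> subst_monom in_P (pair A B) = Poly_Mapping.single (expo A + expo B) s"
  by (intro exI[of _ "of_int (sign (\<Lambda> A)) * of_int (sign (\<Lambda> B))"])
    (simp add: subst_monom_add in_P_def mult_single sign_neq_0)

text \<open>The signs that arise from sorting the columns are absorbed into the coefficients.\<close>

lemma three_term_in_plucker_ideal:
  assumes U: "finite U" "card U = k - 2" "U \<subseteq> {1..n}"
    and d: "distinct [p, q, r, t]" and pq: "{p, q, r, t} \<subseteq> {1..n} - U"
  shows "\<exists>e1 e2 e3. e1 \<noteq> 0 \<and> e2 \<noteq> 0 \<and> e3 \<noteq> 0 \<and>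
    Poly_Mapping.single (pair (U \<union> {p, q}) (U \<union> {r, t})) e1
    + Poly_Mapping.single (pair (U \<union> {p, r}) (U \<union> {q, t})) e2
    + Poly_Mapping.single (pair (U \<union> {p, t}) (U \<union> {q, r})) e3 \<in> I"
proof -
  let ?s = "sorted_list_of_set U"
  have len: "length ?s = k - 2" and set: "set ?s = U" using U by simp_all
  have *: "U \<union> {x, y} \<in> V \<and> (\<exists>\<epsilon>. \<epsilon> \<noteq> 0 \<and> minor generic (?s @ [x, y]) = Const \<epsilon> * P (U \<union> {x, y}))"
    if xy: "x \<noteq> y" "x \<in> {p, q, r, t}" "y \<in> {p, q, r, t}" for x y
  proof
    have xU: "x \<notin> U" "y \<notin> U" using xy pq by auto
    have xn: "x \<in> {1..n}" "y \<in> {1..n}" using xy pq by auto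
    have card: "card (U \<union> {x, y}) = k" using xU xy(1) U k3 by simp
    then show "U \<union> {x, y} \<in> V" using U(3) xn by (simp add: ksets_def)
    have "distinct (?s @ [x, y])" using U xU xy(1) by simp
    note signed = plucker_form_eq_minor_list[OF this]
    have lset: "length (?s @ [x, y]) = k" "set (?s @ [x, y]) = U \<union> {x, y}"
      using set len k3 by auto
    obtain \<epsilon> :: "(nat \<times> nat, 'a) mpoly"
      where \<epsilon>: "\<epsilon> \<in> {1, - 1}" "minor generic (?s @ [x, y]) = \<epsilon> * P (U \<union> {x, y})"
      using signed unfolding lset by blast
    have "\<exists>c :: 'a. c \<noteq> 0 \<and> \<epsilon> = Const c"
    proof (cases "\<epsilon> = 1")
      case True
      then show ?thesis by (intro exI[of _ 1]) simp
    next
      case False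
      then show ?thesis using \<epsilon>(1) by (intro exI[of _ "- 1"]) (simp add: Const_def single_uminus)
    qed
    then obtain c :: 'a where "c \<noteq> 0" "\<epsilon> = Const c" by (elim exE conjE)
    then show "\<exists>\<epsilon>. \<epsilon> \<noteq> 0 \<and> minor generic (?s @ [x, y]) = Const \<epsilon> * P (U \<union> {x, y})"
      using \<epsilon>(2) by (intro exI[of _ c]) simp
  qed
  have dd: "p \<noteq> q" "p \<noteq> r" "p \<noteq> t" "q \<noteq> r" "q \<noteq> t" "r \<noteq> t" using d by auto
  obtain a1 where a1: "a1 \<noteq> 0" "minor generic (?s @ [p, q]) = Const a1 * P (U \<union> {p, q})" using *[of p q] dd by auto
  obtain a2 where a2: "a2 \<noteq> 0" "minor generic (?s @ [r, t]) = Const a2 * P (U \<union> {r, t})" using *[of r t] dd by auto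
  obtain a3 where a3: "a3 \<noteq> 0" "minor generic (?s @ [p, r]) = Const a3 * P (U \<union> {p, r})" using *[of p r] dd by auto
  obtain a4 where a4: "a4 \<noteq> 0" "minor generic (?s @ [q, t]) = Const a4 * P (U \<union> {q, t})" using *[of q t] dd by auto
  obtain a5 where a5: "a5 \<noteq> 0" "minor generic (?s @ [p, t]) = Const a5 * P (U \<union> {p, t})" using *[of p t] dd by auto
  obtain a6 where a6: "a6 \<noteq> 0" "minor generic (?s @ [q, r]) = Const a6 * P (U \<union> {q, r})" using *[of q r] dd by auto
  have V: "U \<union> {p, q} \<in> V" "U \<union> {r, t} \<in> V" "U \<union> {p, r} \<in> V" "U \<union> {q, t} \<in> V" "U \<union> {p, t} \<in> V" "U \<union> {q, r} \<in> V"
    using *[of p q] *[of r t] *[of p r] *[of q t] *[of p t] *[of q r] dd by simp_all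
  let ?T = "Poly_Mapping.single (pair (U \<union> {p, q}) (U \<union> {r, t})) (a1 * a2)
    + Poly_Mapping.single (pair (U \<union> {p, r}) (U \<union> {q, t})) (- (a3 * a4))
    + Poly_Mapping.single (pair (U \<union> {p, t}) (U \<union> {q, r})) (a5 * a6)"
  have neg: "Const (- c) = - Const c" for c :: 'a by (simp add: Const_def single_uminus)
  have "poly_subst P ?T = 0"
    using three_term_relation[of "generic :: _ \<Rightarrow> _ \<Rightarrow> (nat \<times> nat, 'a) mpoly" ?s p q r t]
    unfolding a1 a2 a3 a4 a5 a6
    by (simp add: poly_subst_add subst_monom_add neg Const_mult algebra_simps)
  moreover have "?T \<in> carrier R"
    by (intro add_in_carrier single_in_carrier keys_pair V)
  ultimately have "?T \<in> I" by (simp add: plucker_ideal_def)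
  moreover have "a1 * a2 \<noteq> 0" "- (a3 * a4) \<noteq> 0" "a5 * a6 \<noteq> 0" using a1 a2 a3 a4 a5 a6 by auto
  ultimately show ?thesis by blast
qed

text \<open>If two of the three terms have the same image under the monomial map, they are the initial
  form: otherwise the third one occurs in the initial form, and there nothing could cancel its image.\<close>

lemma three_term_rel:
  assumes U: "finite U" "card U = k - 2" "U \<subseteq> {1..n}"
    and d: "distinct [p, q, r, t]" and pq: "{p, q, r, t} \<subseteq> {1..n} - U"
    and eq: "expo (U \<union> {p, q}) + expo (U \<union> {r, t}) = expo (U \<union> {p, r}) + expo (U \<union> {q, t})"
    and neq: "expo (U \<union> {p, q}) + expo (U \<union> {r, t}) \<noteq> expo (U \<union> {p, t}) + expo (U \<union> {q, r})"
  shows "pair (U \<union> {p, q}) (U \<union> {r, t}) \<simeq> pair (U \<union> {p, r}) (U \<union> {q, t})"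
proof -
  have V: "U \<union> {x, y} \<in> V" if "x \<noteq> y" "x \<in> {p, q, r, t}" "y \<in> {p, q, r, t}" for x y
  proof -
    have "x \<notin> U" "y \<notin> U" "x \<in> {1..n}" "y \<in> {1..n}" using that pq by auto
    then show ?thesis using U k3 that(1) by (simp add: ksets_def)
  qed
  define m1 where "m1 = pair (U \<union> {p, q}) (U \<union> {r, t})"
  define m2 where "m2 = pair (U \<union> {p, r}) (U \<union> {q, t})"
  define m3 where "m3 = pair (U \<union> {p, t}) (U \<union> {q, r})"
  define x1 where "x1 = expo (U \<union> {p, q}) + expo (U \<union> {r, t})"
  define x3 where "x3 = expo (U \<union> {p, t}) + expo (U \<union> {q, r})"
  have keys: "Poly_Mapping.keys m1 \<subseteq> V" "Poly_Mapping.keys m2 \<subseteq> V"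
    unfolding m1_def m2_def using d by (intro keys_pair V; simp)+
  obtain e1 e2 e3 where e: "e1 \<noteq> 0" "e2 \<noteq> 0" "e3 \<noteq> 0"
    and T: "Poly_Mapping.single m1 e1 + Poly_Mapping.single m2 e2 + Poly_Mapping.single m3 e3 \<in> I" (is "?T \<in> I")
    using three_term_in_plucker_ideal[OF U d pq] unfolding m1_def m2_def m3_def by blast
  have w1: "monom_weight w m1 = monom_weight W x1"
    unfolding m1_def x1_def using d by (intro monom_weight_pair V) simp_all
  have w2: "monom_weight w m2 = monom_weight W x1"
    unfolding m2_def x1_def eq using d by (intro monom_weight_pair V) simp_all
  obtain s1 where s1: "subst_monom in_P m1 = Poly_Mapping.single x1 s1"
    using subst_monom_pair unfolding m1_def x1_def by blast
  obtain s2 where s2: "subst_monom in_P m2 = Poly_Mapping.single x1 s2"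
    using subst_monom_pair unfolding m2_def x1_def eq by blast
  obtain s3 where s3: "s3 \<noteq> 0" "subst_monom in_P m3 = Poly_Mapping.single x3 s3"
    using subst_monom_pair unfolding m3_def x3_def by blast
  have x13: "x1 \<noteq> x3" using neq by (simp add: x1_def x3_def)
  have m13: "m1 \<noteq> m3" "m2 \<noteq> m3"
    using s1 s2 s3 x13 by (metis lookup_single_eq lookup_single_not_eq)+
  show ?thesis
  proof (cases "m1 = m2")
    case True
    then show ?thesis using rel_refl keys unfolding m1_def m2_def by metis
  next
    case False
    have keysT: "Poly_Mapping.keys ?T = {m1, m2, m3}"
      using m13 False e by (auto simp: in_keys_iff lookup_add lookup_single when_def split: if_splits)
    have Min: "poly_weight w ?T = min (monom_weight W x1) (monom_weight w m3)"
      unfolding poly_weight_def keysT by (simp add: w1 w2)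
    have inJ: "initial_form w ?T \<in> J" by (rule initial_form_in_J[OF T])
    have "monom_weight W x1 < monom_weight w m3"
    proof (rule ccontr)
      assume "\<not> ?thesis"
      then have "poly_weight w ?T = monom_weight w m3" by (simp add: Min)
      then have "initial_form w ?T = (if monom_weight W x1 = monom_weight w m3
          then Poly_Mapping.single m1 e1 + Poly_Mapping.single m2 e2 else 0) + Poly_Mapping.single m3 e3"
        by (simp add: initial_form_eq_weight_part weight_part_add weight_part_single w1 w2)
      then have "poly_subst in_P (initial_form w ?T) = (if monom_weight W x1 = monom_weight w m3
          then Poly_Mapping.single x1 (e1 * s1) + Poly_Mapping.single x1 (e2 * s2) else 0)
          + Poly_Mapping.single x3 (e3 * s3)"
        by (simp add: poly_subst_add s1 s2 s3 Const_mult_single)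
      then have "Poly_Mapping.lookup (poly_subst in_P (initial_form w ?T)) x3 = e3 * s3"
        using x13 by (simp add: lookup_add lookup_single)
      then show False using J_in_kernel[OF inJ] e s3 by simp
    qed
    then have "initial_form w ?T = Poly_Mapping.single m1 e1 + Poly_Mapping.single m2 e2"
      by (simp add: initial_form_eq_weight_part weight_part_add weight_part_single w1 w2 Min)
    then have "Poly_Mapping.single 0 (1 / e1) * (Poly_Mapping.single m1 e1 + Poly_Mapping.single m2 e2) \<in> J"
      using inJ by (intro J_mult) (simp_all add: single_in_carrier)
    moreover have "Poly_Mapping.single 0 (1 / e1) * (Poly_Mapping.single m1 e1 + Poly_Mapping.single m2 e2)
        = Poly_Mapping.single m1 1 - Poly_Mapping.single m2 (- (e2 / e1))"
      using e by (simp add: distrib_left mult_single single_uminus)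
    ultimately show ?thesis using keys unfolding m1_def m2_def by (auto simp: prop_mod_def)
  qed
qed

end

section \<open>Ten products of variables and five evaluations\<close>

text \<open>A zero equation makes the system square and its determinant zero.\<close>

lemma homogeneous_system:
  fixes f :: "nat \<Rightarrow> nat \<Rightarrow> 'a::field"
  shows "\<exists>v. (\<exists>j<Suc m. v j \<noteq> 0) \<and> (\<forall>i<m. (\<Sum>j<Suc m. f i j * v j) = 0)"
proof -
  let ?A = "Matrix.mat (Suc m) (Suc m) (\<lambda>(i, j). if i < m then f i j else 0)"
  have A: "?A \<in> carrier_mat (Suc m) (Suc m)" by simp
  have "Determinant.det ?A = (\<Sum>j<Suc m. ?A $$ (m, j) * cofactor ?A m j)"
    by (rule laplace_expansion_row[OF A]) simp
  also have "\<dots> = 0" by (simp del: sum.lessThan_Suc)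
  finally obtain v where v: "v \<in> carrier_vec (Suc m)" "v \<noteq> 0\<^sub>v (Suc m)" "?A *\<^sub>v v = 0\<^sub>v (Suc m)"
    using det_0_iff_vec_prod_zero_field[OF A] by blast
  have "(\<Sum>j<Suc m. f i j * (v $ j)) = 0" if i: "i < m" for i
  proof -
    have "(?A *\<^sub>v v) $ i = (\<Sum>j = 0..<Suc m. f i j * (v $ j))"
      using i v(1) by (auto simp: scalar_prod_def simp del: sum.op_ivl_Suc intro!: sum.cong)
    then show ?thesis using v(3) i by (simp add: atLeast0LessThan del: sum.lessThan_Suc sum.op_ivl_Suc)
  qed
  moreover have "\<exists>j<Suc m. v $ j \<noteq> 0"
    using v(1,2) by (metis carrier_vecD eq_vecI index_zero_vec(1) index_zero_vec(2))
  ultimately show ?thesis by blast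
qed

text \<open>The matrix whose column \<open>j\<close> is \<open>t\<^sub>j\<close> times the unit vector of row \<open>r j\<close>, rows numbered from 0. The
  variables \<open>t\<^sub>j\<close> keep track of the multidegree.\<close>

definition unit_columns :: "(nat \<Rightarrow> nat) \<Rightarrow> nat \<times> nat \<Rightarrow> (nat, 'a::comm_ring_1) mpoly" where
  "unit_columns r = (\<lambda>(i, j). if Suc (r j) = i then Var j else 0)"

definition indicator_expo :: "nat set \<Rightarrow> nat \<Rightarrow>\<^sub>0 nat" where
  "indicator_expo A = (\<Sum>j\<in>A. Poly_Mapping.single j 1)"

lemma lookup_indicator_expo: "finite A \<Longrightarrow> Poly_Mapping.lookup (indicator_expo A) j = of_bool (j \<in> A)"
proof -
  assume "finite A"
  moreover have "Poly_Mapping.lookup (indicator_expo A) j = (\<Sum>i\<in>A. if i = j then 1 else 0)"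
    unfolding indicator_expo_def lookup_sum by (rule sum.cong) (auto simp: lookup_single when_def)
  ultimately show ?thesis by simp
qed

lemma eval_plucker_form:
  assumes A: "A \<in> ksets k n"
  shows "\<exists>\<epsilon>. poly_subst (unit_columns r) (plucker_form k A) = Poly_Mapping.single (indicator_expo A) (\<epsilon> :: 'a::field)
    \<and> (\<epsilon> \<noteq> 0 \<longleftrightarrow> bij_betw r A {0..<k})"
proof -
  note fin = ksetsD(1)[OF A] and card = ksetsD(2)[OF A]
  let ?cs = "sorted_list_of_set A"
  interpret comm_ring_hom "poly_subst (unit_columns r) :: (nat \<times> nat, 'a) mpoly \<Rightarrow> _"
    by (rule comm_ring_hom_poly_subst)
  have "poly_subst (unit_columns r) (plucker_form k A) =
      (minor (\<lambda>i c. poly_subst (unit_columns r) (generic i c)) ?cs :: (nat, 'a) mpoly)"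
    unfolding plucker_form_eq_minor[OF fin card] minor_def hom_det[symmetric]
    by (intro arg_cong[of _ _ Determinant.det] eq_matI) auto
  also have "\<dots> = minor (\<lambda>i c. if r c = i then Var c else 0) ?cs"
    by (simp add: unit_columns_def)
  finally have eq: "poly_subst (unit_columns r) (plucker_form k A) =
      (minor (\<lambda>i c. if r c = i then Var c else 0) ?cs :: (nat, 'a) mpoly)" .
  have cs: "distinct ?cs" "set ?cs = A" "length ?cs = k" using fin card by simp_all
  obtain e where e: "e \<in> {1, - 1}" "poly_subst (unit_columns r) (plucker_form k A) =
      (if bij_betw r A {0..<k} then of_int e * (\<Prod>c\<in>A. Var c) else 0 :: (nat, 'a) mpoly)"
    using minor_transversal[OF cs(1), of r "Var :: nat \<Rightarrow> (nat, 'a) mpoly"] unfolding cs eq by blast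
  have prod: "(\<Prod>c\<in>A. Var c :: (nat, 'a) mpoly) = Poly_Mapping.single (indicator_expo A) 1"
    using fin by (simp add: Var_def prod_single_one indicator_expo_def)
  show ?thesis
  proof (cases "bij_betw r A {0..<k}")
    case True
    have "of_int e * Poly_Mapping.single (indicator_expo A) 1 = Poly_Mapping.single (indicator_expo A) (of_int e :: 'a)"
      by (subst single_of_int[symmetric]) (simp add: mult_single del: single_of_int)
    moreover have "(of_int e :: 'a) \<noteq> 0" using e(1) by auto
    ultimately show ?thesis using e(2) True unfolding prod by auto
  next
    case False
    then show ?thesis using e(2) by (intro exI[of _ 0]) simp
  qed
qed

lemma sum_keys_eq_2:
  fixes u :: "'v \<Rightarrow>\<^sub>0 nat"
  assumes "(\<Sum>v\<in>Poly_Mapping.keys u. Poly_Mapping.lookup u v) = 2"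
  obtains x y where "u = Poly_Mapping.single x 1 + Poly_Mapping.single y 1"
    "x \<in> Poly_Mapping.keys u" "y \<in> Poly_Mapping.keys u"
proof -
  let ?K = "Poly_Mapping.keys u" and ?l = "Poly_Mapping.lookup u"
  have pos: "1 \<le> ?l v" if "v \<in> ?K" for v using that by (simp add: in_keys_iff)
  have "?K \<noteq> {}" using assms by auto
  then obtain x where x: "x \<in> ?K" by blast
  have sum: "?l x + (\<Sum>v\<in>?K - {x}. ?l v) = 2"
    using assms sum.remove[OF finite_keys x, of ?l] by simp
  show thesis
  proof (cases "?K = {x}")
    case True
    then have lx: "?l x = 2" using sum by simp
    have "u = Poly_Mapping.single x 1 + Poly_Mapping.single x 1"
    proof (rule poly_mapping_eqI)
      fix v show "?l v = Poly_Mapping.lookup (Poly_Mapping.single x 1 + Poly_Mapping.single x 1) v"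
        using lx True not_in_keys_iff_lookup_eq_zero[of v u]
        by (cases "v = x") (simp_all add: lookup_add lookup_single when_def)
    qed
    then show thesis using that x by blast
  next
    case False
    then obtain y where y: "y \<in> ?K" "y \<noteq> x" using x by blast
    then have sum2: "?l x + (?l y + (\<Sum>v\<in>?K - {x} - {y}. ?l v)) = 2"
      using sum sum.remove[of "?K - {x}" y ?l] by simp
    then have l: "?l x = 1" "?l y = 1" "(\<Sum>v\<in>?K - {x} - {y}. ?l v) = 0"
      using pos[OF x] pos[OF y(1)] by linarith+
    have rest: "v \<notin> ?K" if "v \<noteq> x" "v \<noteq> y" for v
      using l(3) that by (auto simp: in_keys_iff)
    have "u = Poly_Mapping.single x 1 + Poly_Mapping.single y 1"
    proof (rule poly_mapping_eqI)
      fix v show "?l v = Poly_Mapping.lookup (Poly_Mapping.single x 1 + Poly_Mapping.single y 1) v"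
        using l y(2) rest[of v] not_in_keys_iff_lookup_eq_zero[of v u]
        by (cases "v = x"; cases "v = y") (simp_all add: lookup_add lookup_single when_def)
    qed
    then show thesis using that x y(1) by blast
  qed
qed

text \<open>Comparing total degrees gives two factors. Both contain \<open>S\<close>, and what remains of them partitions
  \<open>X\<close>. Naming the factor with \<open>a\<close> first removes the symmetry between the two.\<close>

lemma products_of_multidegree:
  assumes k: "3 \<le> k" and S: "finite S" "card S = k - 3"
    and X: "X = {a, b, c, d, e, f}" "distinct [a, b, c, d, e, f]" "S \<inter> X = {}"
    and u: "Poly_Mapping.keys u \<subseteq> ksets k n"
    and deg: "\<And>j. (\<Sum>A\<in>Poly_Mapping.keys u. Poly_Mapping.lookup u A * of_bool (j \<in> A)) =
      (if j \<in> S then 2 else if j \<in> X then 1 else 0 :: nat)"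
  obtains x y where "{x, y} \<subseteq> {b, c, d, e, f}" "x \<noteq> y"
    "u = Poly_Mapping.single (S \<union> {a, x, y}) 1 + Poly_Mapping.single (S \<union> (X - {a, x, y})) 1"
proof -
  let ?K = "Poly_Mapping.keys u" and ?l = "Poly_Mapping.lookup u"
  have finX: "finite X" and cardX: "card X = 6" using X(1,2) by simp_all
  have supp: "A \<subseteq> S \<union> X" if A: "A \<in> ?K" for A
  proof
    fix j assume j: "j \<in> A"
    have "0 < ?l A * of_bool (j \<in> A)" using A j by (simp add: in_keys_iff)
    also have "\<dots> \<le> (\<Sum>A\<in>?K. ?l A * of_bool (j \<in> A))" by (rule member_le_sum) (use A in auto)
    finally show "j \<in> S \<union> X" unfolding deg by (auto split: if_splits)
  qed
  have "(\<Sum>A\<in>?K. ?l A * k) = (\<Sum>A\<in>?K. \<Sum>j\<in>S \<union> X. ?l A * of_bool (j \<in> A))"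
  proof (rule sum.cong)
    fix A assume A: "A \<in> ?K"
    have "(\<Sum>j\<in>S \<union> X. of_bool (j \<in> A)) = card A"
      using supp[OF A] S(1) finX by (simp add: Int_absorb1 flip: of_bool_def)
    also have "\<dots> = k" using u A by (auto simp: ksets_def)
    finally show "?l A * k = (\<Sum>j\<in>S \<union> X. ?l A * of_bool (j \<in> A))" by (simp flip: sum_distrib_left)
  qed simp
  also have "\<dots> = (\<Sum>j\<in>S \<union> X. if j \<in> S then 2 else 1)"
    by (subst sum.swap) (auto simp: deg intro!: sum.cong)
  also have "\<dots> = (\<Sum>j\<in>S. 2) + (\<Sum>j\<in>X. 1)"
  proof -
    have "(\<Sum>j\<in>X. if j \<in> S then 2 else 1 :: nat) = (\<Sum>j\<in>X. 1)"
      by (rule sum.cong) (use X(3) in auto)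
    then show ?thesis using S(1) finX X(3) by (simp add: sum.union_disjoint)
  qed
  also have "\<dots> = 2 * k" using S(2) cardX k by simp
  finally have "(\<Sum>A\<in>?K. ?l A) * k = 2 * k" by (simp add: sum_distrib_right)
  then have "(\<Sum>A\<in>?K. ?l A) = 2" using k by simp
  then obtain A0 B0 where AB0: "u = Poly_Mapping.single A0 1 + Poly_Mapping.single B0 1" "A0 \<in> ?K" "B0 \<in> ?K"
    by (rule sum_keys_eq_2)
  have deg2: "of_bool (j \<in> A0) + of_bool (j \<in> B0) = (if j \<in> S then 2 else if j \<in> X then 1 else 0 :: nat)" for j
  proof -
    have "(\<Sum>A\<in>?K. ?l A * of_bool (j \<in> A)) =
        (\<Sum>A\<in>?K. (if A = A0 then of_bool (j \<in> A0) else 0) + (if A = B0 then of_bool (j \<in> B0) else 0))"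
      by (rule sum.cong) (simp_all add: AB0(1) lookup_add lookup_single when_def)
    also have "\<dots> = of_bool (j \<in> A0) + of_bool (j \<in> B0)"
      using AB0(2,3) by (simp add: sum.distrib)
    finally show ?thesis using deg[of j] by simp
  qed
  have aX: "a \<in> X" "a \<notin> S" using X by auto
  obtain A B where AB: "u = Poly_Mapping.single A 1 + Poly_Mapping.single B 1" "A \<in> ?K" "a \<in> A"
    "\<And>j. of_bool (j \<in> A) + of_bool (j \<in> B) = (if j \<in> S then 2 else if j \<in> X then 1 else 0 :: nat)"
  proof (cases "a \<in> A0")
    case True
    then show thesis using that[of A0 B0] AB0 deg2 by blast
  next
    case False
    then have "a \<in> B0" using deg2[of a] aX by (cases "a \<in> B0") simp_all
    then show thesis using that[of B0 A0] AB0 deg2 by (simp add: add.commute)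
  qed
  have "j \<in> A \<and> j \<in> B" if "j \<in> S" for j
    using AB(4)[of j] that by (cases "j \<in> A"; cases "j \<in> B") simp_all
  then have SA: "S \<subseteq> A" "S \<subseteq> B" by blast+
  have AX: "A - S \<subseteq> X" using supp[OF AB(2)] by blast
  have B: "B = S \<union> (X - (A - S))"
  proof (rule Set.set_eqI)
    fix j show "j \<in> B \<longleftrightarrow> j \<in> S \<union> (X - (A - S))"
      using AB(4)[of j] SA AX by (cases "j \<in> A"; cases "j \<in> B"; cases "j \<in> S"; cases "j \<in> X") auto
  qed
  have "card A = k" using u AB(2) by (auto simp: ksets_def)
  then have "card (A - S) = 3" using SA(1) S k by (simp add: card_Diff_subset)
  moreover have aA: "a \<in> A - S" using AB(3) aX by blast
  ultimately have "card (A - S - {a}) = 2" by simp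
  then obtain x y where xy: "A - S - {a} = {x, y}" "x \<noteq> y" by (auto simp: card_2_iff)
  then have AS: "A - S = {a, x, y}" using aA by blast
  have "{x, y} \<subseteq> X - {a}" using xy(1) AX by blast
  then have "{x, y} \<subseteq> {b, c, d, e, f}" using X(1) by blast
  moreover have "A = S \<union> {a, x, y}" using AS SA(1) by blast
  ultimately show thesis using that xy(2) AB(1) B AS by metis
qed

context prime_initial_ideal
begin

text \<open>Here \<open>Y\<close> is a linear functional on polynomials in the \<open>P\<^sub>A\<close>, given on monomials, that vanishes on the
  Pluecker ideal. If it vanished at \<open>r\<close> and not at \<open>s\<close>, with \<open>s\<close> as heavy as possible, then lifting
  the relation between \<open>s\<close> and \<open>r\<close> to the Pluecker ideal would add only heavier terms, at which
  \<open>Y\<close> is zero.\<close>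

lemma vanishing_by_descent:
  assumes Y_rel: "\<And>g. g \<in> I \<Longrightarrow> (\<Sum>u\<in>Poly_Mapping.keys g. Poly_Mapping.lookup g u * Y u) = (0 :: 'a)"
    and fin: "finite Z" and supp: "\<And>u. Poly_Mapping.keys u \<subseteq> V \<Longrightarrow> Y u \<noteq> 0 \<Longrightarrow> u \<in> Z"
    and reps: "\<And>t. t \<in> Z \<Longrightarrow> \<exists>r. t \<simeq> r \<and> Y r = 0"
    and t: "t \<in> Z"
  shows "Y t = 0"
proof (rule ccontr)
  assume "Y t \<noteq> 0"
  let ?Z = "{t \<in> Z. Y t \<noteq> 0}"
  have "finite (monom_weight w ` ?Z)" "monom_weight w ` ?Z \<noteq> {}"
    using fin t \<open>Y t \<noteq> 0\<close> by auto
  note Max = Max_in[OF this] Max_ge[OF this(1)]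
  obtain s where s: "s \<in> ?Z" "monom_weight w s = Max (monom_weight w ` ?Z)"
    using Max(1) by (metis (no_types, lifting) imageE)
  then have s_max: "monom_weight w z \<le> monom_weight w s" if "z \<in> ?Z" for z
    using Max(2)[of "monom_weight w z"] that by simp
  obtain r where r: "s \<simeq> r" "Y r = 0" using reps s(1) by blast
  have sr: "s \<noteq> r" using s r by auto
  obtain c where "Poly_Mapping.single s 1 - Poly_Mapping.single r c \<in> J" (is "?g \<in> J")
    using r(1) by (auto simp: prop_mod_def)
  then obtain g where g: "g \<in> I" "\<forall>m\<in>Poly_Mapping.keys g. monom_weight w s \<le> monom_weight w m"
      "weight_part w (monom_weight w s) g = weight_part w (monom_weight w s) ?g"
    using J_subset_liftable unfolding liftable_def by blast
  have coeff: "Poly_Mapping.lookup g u = Poly_Mapping.lookup ?g u" if "monom_weight w u = monom_weight w s" for u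
    using arg_cong[OF g(3), of "\<lambda>p. Poly_Mapping.lookup p u"] that by (simp add: lookup_weight_part)
  have gs: "Poly_Mapping.lookup g s = 1"
    using coeff[of s] sr by (simp add: lookup_minus lookup_single)
  have "Poly_Mapping.lookup g u * Y u = 0" if u: "u \<in> Poly_Mapping.keys g - {s}" for u
  proof (rule ccontr)
    assume nz: "Poly_Mapping.lookup g u * Y u \<noteq> 0"
    have "g \<in> carrier R" using g(1) plucker_ideal_carrier by blast
    then have "Poly_Mapping.keys u \<subseteq> V" using u unfolding carrier_mpoly_ring by blast
    then have "u \<in> ?Z" using nz supp by auto
    then have "monom_weight w u = monom_weight w s" using s_max[of u] g(2) u by (intro antisym) auto
    then have "Poly_Mapping.lookup ?g u \<noteq> 0" using coeff nz by auto
    then have "u = r" using u by (auto simp: lookup_minus lookup_single when_def split: if_splits)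
    then show False using nz r(2) by simp
  qed
  then have "(\<Sum>u\<in>Poly_Mapping.keys g. Poly_Mapping.lookup g u * Y u) = (\<Sum>u\<in>{s}. Poly_Mapping.lookup g u * Y u)"
    using gs by (intro sum.mono_neutral_right) (auto simp: in_keys_iff)
  then show False using Y_rel[OF g(1)] gs s(1) by simp
qed

text \<open>A linear functional that vanishes on the Pluecker ideal, given by its values on monomials.\<close>

definition eval_at :: "(nat \<Rightarrow> nat) \<Rightarrow> (nat \<Rightarrow>\<^sub>0 nat) \<Rightarrow> (nat set \<Rightarrow>\<^sub>0 nat) \<Rightarrow> 'a" where
  "eval_at r d u = Poly_Mapping.lookup (poly_subst (unit_columns r) (subst_monom P u)) d"

lemma eval_at_relation:
  assumes g: "g \<in> I"
  shows "(\<Sum>u\<in>Poly_Mapping.keys g. Poly_Mapping.lookup g u * eval_at r d u) = 0"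
proof -
  have "0 = poly_subst (unit_columns r) (\<Sum>u\<in>Poly_Mapping.keys g. Const (Poly_Mapping.lookup g u) * subst_monom P u)"
    using g by (simp add: plucker_ideal_def poly_subst_def subst_monom_def)
  also have "\<dots> = (\<Sum>u\<in>Poly_Mapping.keys g. Const (Poly_Mapping.lookup g u) * poly_subst (unit_columns r) (subst_monom P u))"
    by (simp add: poly_subst_sum poly_subst_mult) (simp add: Const_def)
  finally have "Poly_Mapping.lookup \<dots> d = 0" by simp
  then show ?thesis by (simp add: lookup_sum lookup_Const_mult eval_at_def)
qed

lemma eval_monomial:
  "\<exists>\<epsilon> :: nat set \<Rightarrow> 'a. (\<forall>A \<in> V. \<epsilon> A \<noteq> 0 \<longleftrightarrow> bij_betw r A {0..<k}) \<and>
     (\<forall>u. Poly_Mapping.keys u \<subseteq> V \<longrightarrow> poly_subst (unit_columns r) (subst_monom P u) =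
        subst_monom (\<lambda>A. Poly_Mapping.single (indicator_expo A) (\<epsilon> A)) u)"
proof -
  have "\<forall>A \<in> V. \<exists>\<epsilon> :: 'a. poly_subst (unit_columns r) (P A) = Poly_Mapping.single (indicator_expo A) \<epsilon>
      \<and> (\<epsilon> \<noteq> 0 \<longleftrightarrow> bij_betw r A {0..<k})"
    using eval_plucker_form by blast
  then obtain \<epsilon> where \<epsilon>: "\<forall>A \<in> V. poly_subst (unit_columns r) (P A) = Poly_Mapping.single (indicator_expo A) (\<epsilon> A :: 'a)
      \<and> (\<epsilon> A \<noteq> 0 \<longleftrightarrow> bij_betw r A {0..<k})"
    by (rule bchoice[THEN exE])
  interpret comm_ring_hom "poly_subst (unit_columns r) :: (nat \<times> nat, 'a) mpoly \<Rightarrow> (nat, 'a) mpoly"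
    by (rule comm_ring_hom_poly_subst)
  have "poly_subst (unit_columns r) (subst_monom P u) =
      subst_monom (\<lambda>A. Poly_Mapping.single (indicator_expo A) (\<epsilon> A)) u" if "Poly_Mapping.keys u \<subseteq> V" for u
    unfolding subst_monom_def hom_prod hom_power
    by (rule prod.cong) (use \<epsilon> that in auto)
  then show ?thesis using \<epsilon> by (intro exI[of _ \<epsilon>]) blast
qed

lemma eval_at_pair_neq_0:
  assumes AB: "A \<in> V" "B \<in> V" and d: "indicator_expo A + indicator_expo B = d"
  shows "eval_at r d (pair A B) \<noteq> 0 \<longleftrightarrow> bij_betw r A {0..<k} \<and> bij_betw r B {0..<k}"
proof -
  obtain \<epsilon> :: "nat set \<Rightarrow> 'a" where \<epsilon>: "\<forall>A \<in> V. \<epsilon> A \<noteq> 0 \<longleftrightarrow> bij_betw r A {0..<k}"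
    "\<forall>u. Poly_Mapping.keys u \<subseteq> V \<longrightarrow> poly_subst (unit_columns r) (subst_monom P u) =
      subst_monom (\<lambda>A. Poly_Mapping.single (indicator_expo A) (\<epsilon> A)) u"
    using eval_monomial[of r] by (elim exE conjE)
  have "eval_at r d (pair A B) = \<epsilon> A * \<epsilon> B"
    unfolding eval_at_def \<epsilon>(2)[rule_format, OF keys_pair[OF AB]]
    using d by (simp add: subst_monom_add mult_single)
  then show ?thesis using \<epsilon>(1) AB by simp
qed

lemma eval_at_support:
  assumes u: "Poly_Mapping.keys u \<subseteq> V" and nz: "eval_at r d u \<noteq> 0"
  shows "Poly_Mapping.lookup d j = (\<Sum>A\<in>Poly_Mapping.keys u. Poly_Mapping.lookup u A * of_bool (j \<in> A))"
proof -
  obtain \<epsilon> :: "nat set \<Rightarrow> 'a" where \<epsilon>: "\<forall>A \<in> V. \<epsilon> A \<noteq> 0 \<longleftrightarrow> bij_betw r A {0..<k}"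
    "\<forall>u. Poly_Mapping.keys u \<subseteq> V \<longrightarrow> poly_subst (unit_columns r) (subst_monom P u) =
      subst_monom (\<lambda>A. Poly_Mapping.single (indicator_expo A) (\<epsilon> A)) u"
    using eval_monomial[of r] by (elim exE conjE)
  obtain E where E: "subst_monom (\<lambda>A. Poly_Mapping.single (indicator_expo A) (\<epsilon> A)) u =
      Poly_Mapping.single E (\<Prod>v\<in>Poly_Mapping.keys u. \<epsilon> v ^ Poly_Mapping.lookup u v)"
    "\<And>x. Poly_Mapping.lookup E x = (\<Sum>v\<in>Poly_Mapping.keys u. Poly_Mapping.lookup u v * Poly_Mapping.lookup (indicator_expo v) x)"
    using subst_monom_singles[of indicator_expo \<epsilon> u] by blast
  have "E = d" using nz by (simp add: eval_at_def \<epsilon>(2) u E(1) lookup_single when_def split: if_splits)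
  moreover have "Poly_Mapping.lookup (indicator_expo v) j = of_bool (j \<in> v)" if "v \<in> Poly_Mapping.keys u" for v
    by (rule lookup_indicator_expo) (use u that ksetsD(1) in blast)
  ultimately show ?thesis using E(2)[of j] by simp
qed

lemma triple_eq_012:
  "{x, y, z} = {0, 1, 2 :: nat} \<longleftrightarrow> x \<noteq> y \<and> x \<noteq> z \<and> y \<noteq> z \<and> x \<le> 2 \<and> y \<le> 2 \<and> z \<le> 2"
proof
  assume eq: "{x, y, z} = {0, 1, 2}"
  have "card {x, y, z} = 3" by (simp add: eq)
  then have "x \<noteq> y \<and> x \<noteq> z \<and> y \<noteq> z" by (auto simp: card_insert_if split: if_splits)
  moreover have "\<forall>t \<in> {x, y, z}. t \<le> 2" unfolding eq by simp
  ultimately show "x \<noteq> y \<and> x \<noteq> z \<and> y \<noteq> z \<and> x \<le> 2 \<and> y \<le> 2 \<and> z \<le> 2" by simp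
next
  assume *: "x \<noteq> y \<and> x \<noteq> z \<and> y \<noteq> z \<and> x \<le> 2 \<and> y \<le> 2 \<and> z \<le> 2"
  have le: "t \<in> {0, 1, 2}" if "t \<le> 2" for t :: nat using that by auto
  show "{x, y, z} = {0, 1, 2}"
    by (rule card_subset_eq) (use * le in simp_all)
qed

text \<open>Five evaluations admit a nonzero combination \<open>Y\<close> that vanishes at the four representatives, hence at
  all ten products. The assignments of \<open>X\<close> to three rows are taken from the standard tableaux with
  three rows and two columns, with entries \<open>a, b, c, d, e, f\<close> in this order: their rows are the pairs
  placed together, their columns are the triples of a product. With respect to these five products
  the evaluations are triangular, so \<open>Y\<close> has only zero coefficients.\<close>

lemma four_classes_impossible:
  fixes rep :: "nat \<Rightarrow> nat set \<Rightarrow>\<^sub>0 nat"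
  assumes S: "S \<subseteq> {1..n}" "card S = k - 3"
    and X: "X = {a, b, c, d, e, f}" "distinct [a, b, c, d, e, f]" "S \<inter> X = {}" "X \<subseteq> {1..n}"
    and reps: "\<And>x y. {x, y} \<subseteq> {b, c, d, e, f} \<Longrightarrow> x \<noteq> y \<Longrightarrow>
      \<exists>i<4. pair (S \<union> {a, x, y}) (S \<union> (X - {a, x, y})) \<simeq> rep i"
  shows False
proof -
  define sp where "sp = (\<lambda>x y. pair (S \<union> {a, x, y}) (S \<union> (X - {a, x, y})))"
  define \<delta> where "\<delta> = indicator_expo S + indicator_expo S + indicator_expo X"
  have fS: "finite S" using S(1) finite_subset by blast
  have fX: "finite X" and cX: "card X = 6" using X(1,2) by simp_all
  have V: "S \<union> Y \<in> V" if "Y \<subseteq> X" "card Y = 3" for Y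
  proof -
    have "card (S \<union> Y) = card S + card Y"
      using that fS fX X(3) by (intro card_Un_disjoint) (auto intro: finite_subset)
    then show ?thesis using S X(4) k3 that by (auto simp: ksets_def)
  qed
  have \<delta>: "indicator_expo (S \<union> Y) + indicator_expo (S \<union> (X - Y)) = \<delta>" if "Y \<subseteq> X" for Y
  proof (rule poly_mapping_eqI)
    fix j
    have "finite Y" using that fX by (rule finite_subset)
    then show "Poly_Mapping.lookup (indicator_expo (S \<union> Y) + indicator_expo (S \<union> (X - Y))) j = Poly_Mapping.lookup \<delta> j"
      using that X(3) fS fX unfolding \<delta>_def
      by (cases "j \<in> S"; cases "j \<in> Y"; cases "j \<in> X") (auto simp: lookup_add lookup_indicator_expo)
  qed
  have \<delta>_lookup: "Poly_Mapping.lookup \<delta> j = (if j \<in> S then 2 else if j \<in> X then 1 else 0)" for j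
    unfolding \<delta>_def lookup_add lookup_indicator_expo[OF fS] lookup_indicator_expo[OF fX]
    using X(3) by (cases "j \<in> S"; cases "j \<in> X") auto
  have "card {3..<k} = card S" using S(2) by simp
  then obtain \<sigma> where \<sigma>: "bij_betw \<sigma> S {3..<k}"
    using finite_same_card_bij[OF fS] by (metis finite_atLeastLessThan)
  \<comment> \<open>The pairs \<open>p, q\<close> and \<open>s, t\<close> form two rows of the tableau, the remaining pair the third.\<close>
  define cl where "cl = (\<lambda>p q s t j :: nat. if j = p \<or> j = q then 0 else if j = s \<or> j = t then 1 else 2 :: nat)"
  define cs where "cs = (\<lambda>i. [cl a d b e, cl a c b e, cl a c b d, cl a b c e, cl a b c d] ! i)"
  \<comment> \<open>The columns in \<open>S\<close> fill the rows from 3 on, so the rows 0, 1, 2 are left for the triples.\<close>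
  define r where "r = (\<lambda>i j. if j \<in> S then \<sigma> j else cs i j)"
  have bij: "bij_betw (r i) (S \<union> Y) {0..<k} \<longleftrightarrow> cs i ` Y = {0, 1, 2}"
    if Y: "Y \<subseteq> X" "card Y = 3" for i Y
  proof -
    have disj: "S \<inter> Y = {}" using Y X(3) by blast
    have rS: "bij_betw (r i) S {3..<k}"
      using \<sigma> by (rule bij_betw_cong[THEN iffD1, rotated]) (simp add: r_def)
    have rY: "r i ` Y = cs i ` Y" using disj by (auto simp: r_def)
    have split: "{0..<k} = {3..<k} \<union> {0, 1, 2}" "{3..<k} \<inter> {0, 1, 2} = {}" using k3 by auto
    show ?thesis
    proof
      assume "bij_betw (r i) (S \<union> Y) {0..<k}"
      then have "inj_on (r i) (S \<union> Y)" "r i ` S \<union> r i ` Y = {0..<k}"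
        by (auto simp: bij_betw_def image_Un)
      moreover have "r i ` S = {3..<k}" using rS by (simp add: bij_betw_def)
      moreover have "r i ` S \<inter> r i ` Y = {}"
        using calculation(1) disj by (simp add: inj_on_image_Int[symmetric, of _ "S \<union> Y"])
      ultimately have "r i ` Y = {0..<k} - {3..<k}" by blast
      also have "\<dots> = {0, 1, 2}" using k3 by auto
      finally have "r i ` Y = {0, 1, 2}" .
      then show "cs i ` Y = {0, 1, 2}" using rY by simp
    next
      assume "cs i ` Y = {0, 1, 2}"
      then have img: "r i ` Y = {0, 1, 2}" using rY by simp
      have "finite Y" using Y(1) fX by (rule finite_subset)
      moreover have "card (r i ` Y) = card Y" using img Y(2) by simp
      ultimately have "bij_betw (r i) Y {0, 1, 2}"
        using img by (simp add: bij_betw_def eq_card_imp_inj_on)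
      then show "bij_betw (r i) (S \<union> Y) {0..<k}"
        unfolding split(1) by (rule bij_betw_combine[OF rS _ split(2)])
    qed
  qed
  have eval_at_eq_0: "eval_at (r i) \<delta> (sp x y) = 0 \<longleftrightarrow> \<not> (cs i ` {a, x, y} = {0, 1, 2} \<and> cs i ` (X - {a, x, y}) = {0, 1, 2})"
    if xy: "{x, y} \<subseteq> {b, c, d, e, f}" "x \<noteq> y" for i x y
  proof -
    have Y: "{a, x, y} \<subseteq> X" "card {a, x, y} = 3" using xy X(1,2) by auto
    then have Y': "X - {a, x, y} \<subseteq> X" "card (X - {a, x, y}) = 3" using cX fX by (simp_all add: card_Diff_subset)
    show ?thesis
      using arg_cong[OF eval_at_pair_neq_0[OF V[OF Y] V[OF Y'] \<delta>[OF Y(1)], of "r i"], of Not]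
      unfolding sp_def bij[OF Y] bij[OF Y'] by (simp only: not_not)
  qed
  obtain v where v: "\<exists>i<Suc 4. v i \<noteq> 0" "\<forall>j<4. (\<Sum>i<Suc 4. eval_at (r i) \<delta> (rep j) * v i) = 0"
    using homogeneous_system[of 4 "\<lambda>j i. eval_at (r i) \<delta> (rep j)"] by blast
  define Y where "Y = (\<lambda>u. \<Sum>i<Suc 4. eval_at (r i) \<delta> u * v i)"
  define Z where "Z = (\<lambda>(x, y). sp x y) ` {(x, y). {x, y} \<subseteq> {b, c, d, e, f} \<and> x \<noteq> y}"
  have zero: "Y (sp x y) = 0" if xy: "{x, y} \<subseteq> {b, c, d, e, f}" "x \<noteq> y" for x y
  proof (rule vanishing_by_descent[of Y Z])
    fix g assume "g \<in> I"
    have "(\<Sum>u\<in>Poly_Mapping.keys g. Poly_Mapping.lookup g u * Y u) =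
        (\<Sum>i<Suc 4. (\<Sum>u\<in>Poly_Mapping.keys g. Poly_Mapping.lookup g u * eval_at (r i) \<delta> u) * v i)"
      unfolding Y_def sum_distrib_left sum_distrib_right
      by (subst sum.swap) (simp add: mult.assoc del: sum.lessThan_Suc)
    also have "\<dots> = 0" using eval_at_relation[OF \<open>g \<in> I\<close>] by simp
    finally show "(\<Sum>u\<in>Poly_Mapping.keys g. Poly_Mapping.lookup g u * Y u) = 0" .
  next
    have "{(x, y). {x, y} \<subseteq> {b, c, d, e, f} \<and> x \<noteq> y} \<subseteq> {b, c, d, e, f} \<times> {b, c, d, e, f}" by blast
    then show "finite Z" unfolding Z_def by (intro finite_imageI) (rule finite_subset, auto)
  next
    fix u assume u: "Poly_Mapping.keys u \<subseteq> V" "Y u \<noteq> 0"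
    then obtain i where "eval_at (r i) \<delta> u * v i \<noteq> 0"
      unfolding Y_def by (elim sum.not_neutral_contains_not_neutral)
    then have "eval_at (r i) \<delta> u \<noteq> 0" by auto
    then have "(\<Sum>A\<in>Poly_Mapping.keys u. Poly_Mapping.lookup u A * of_bool (j \<in> A)) =
        (if j \<in> S then 2 else if j \<in> X then 1 else 0)" for j
      using eval_at_support[OF u(1), of "r i" \<delta> j] \<delta>_lookup[of j] by simp
    then obtain x y where "{x, y} \<subseteq> {b, c, d, e, f}" "x \<noteq> y" "u = sp x y"
      unfolding sp_def by (rule products_of_multidegree[OF k3 fS S(2) X(1-3) u(1)])
    then show "u \<in> Z" by (auto simp: Z_def)
  next
    fix t assume "t \<in> Z"
    then obtain x y where xy: "{x, y} \<subseteq> {b, c, d, e, f}" "x \<noteq> y" "t = sp x y" by (auto simp: Z_def)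
    then obtain i where "i < 4" "t \<simeq> rep i" using reps[of x y] by (auto simp: sp_def)
    moreover have "Y (rep i) = 0" using v(2) \<open>i < 4\<close> by (simp add: Y_def)
    ultimately show "\<exists>r. t \<simeq> r \<and> Y r = 0" by blast
  next
    show "sp x y \<in> Z" using xy by (auto simp: Z_def)
  qed
  have rest: "X - {a, b, c} = {d, e, f}" "X - {a, b, d} = {c, e, f}" "X - {a, b, e} = {c, d, f}"
    "X - {a, c, d} = {b, e, f}" "X - {a, c, e} = {b, d, f}"
    using X(1,2) by auto
  have ne: "a \<noteq> b" "a \<noteq> c" "a \<noteq> d" "a \<noteq> e" "a \<noteq> f" "b \<noteq> c" "b \<noteq> d" "b \<noteq> e" "b \<noteq> f"
    "c \<noteq> d" "c \<noteq> e" "c \<noteq> f" "d \<noteq> e" "d \<noteq> f" "e \<noteq> f" using X(2) by auto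
  note neqs = ne ne[symmetric]
  have Y_expand: "Y u = eval_at (r 0) \<delta> u * v 0 + eval_at (r 1) \<delta> u * v 1 + eval_at (r 2) \<delta> u * v 2
      + eval_at (r 3) \<delta> u * v 3 + eval_at (r 4) \<delta> u * v 4" for u
    unfolding Y_def by (simp add: eval_nat_numeral)
  have cs: "cs 0 = cl a d b e" "cs 1 = cl a c b e" "cs 2 = cl a c b d" "cs 3 = cl a b c e" "cs 4 = cl a b c d"
    by (simp_all add: cs_def)
  have v0: "eval_at (r 0) \<delta> (sp b c) \<noteq> 0" "eval_at (r 1) \<delta> (sp b c) = 0" "eval_at (r 2) \<delta> (sp b c) = 0"
    "eval_at (r 3) \<delta> (sp b c) = 0" "eval_at (r 4) \<delta> (sp b c) = 0"
    using eval_at_eq_0[of b c] neqs unfolding rest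
    by (simp_all add: cs cl_def triple_eq_012 del: One_nat_def)
  have v1: "eval_at (r 0) \<delta> (sp b d) = 0" "eval_at (r 1) \<delta> (sp b d) \<noteq> 0" "eval_at (r 2) \<delta> (sp b d) = 0"
    "eval_at (r 3) \<delta> (sp b d) = 0" "eval_at (r 4) \<delta> (sp b d) = 0"
    using eval_at_eq_0[of b d] neqs unfolding rest
    by (simp_all add: cs cl_def triple_eq_012 del: One_nat_def)
  have v2: "eval_at (r 0) \<delta> (sp b e) = 0" "eval_at (r 1) \<delta> (sp b e) = 0" "eval_at (r 2) \<delta> (sp b e) \<noteq> 0"
    "eval_at (r 3) \<delta> (sp b e) = 0" "eval_at (r 4) \<delta> (sp b e) = 0"
    using eval_at_eq_0[of b e] neqs unfolding rest
    by (simp_all add: cs cl_def triple_eq_012 del: One_nat_def)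
  have v3: "eval_at (r 0) \<delta> (sp c d) = 0" "eval_at (r 1) \<delta> (sp c d) = 0" "eval_at (r 2) \<delta> (sp c d) = 0"
    "eval_at (r 3) \<delta> (sp c d) \<noteq> 0" "eval_at (r 4) \<delta> (sp c d) = 0"
    using eval_at_eq_0[of c d] neqs unfolding rest
    by (simp_all add: cs cl_def triple_eq_012 del: One_nat_def)
  \<comment> \<open>The first evaluation is nonzero here as well, which is harmless once its coefficient is known to be 0.\<close>
  have v4: "eval_at (r 1) \<delta> (sp c e) = 0" "eval_at (r 2) \<delta> (sp c e) = 0" "eval_at (r 3) \<delta> (sp c e) = 0"
    "eval_at (r 4) \<delta> (sp c e) \<noteq> 0"
    using eval_at_eq_0[of c e] neqs unfolding rest
    by (simp_all add: cs cl_def triple_eq_012 del: One_nat_def)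
  have "v 0 = 0" using zero[of b c] v0 neqs by (simp add: Y_expand)
  moreover have "v 1 = 0" using zero[of b d] v1 neqs by (simp add: Y_expand)
  moreover have "v 2 = 0" using zero[of b e] v2 neqs by (simp add: Y_expand)
  moreover have "v 3 = 0" using zero[of c d] v3 neqs by (simp add: Y_expand)
  moreover have "v 4 = 0" using zero[of c e] v4 neqs calculation by (simp add: Y_expand)
  moreover obtain i where "i < Suc 4" "v i \<noteq> 0" using v(1) by blast
  moreover have "i = 0 \<or> i = 1 \<or> i = 2 \<or> i = 3 \<or> i = 4" using \<open>i < Suc 4\<close> by auto
  ultimately show False by auto
qed

end

section \<open>The matchings of a hexagonal matching field\<close>

lemma rows3_triple:
  assumes "{i, l, m} = rows3"
  shows "i \<in> rows3" "l \<in> rows3" "m \<in> rows3" "i \<noteq> l" "i \<noteq> m" "l \<noteq> m"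
proof -
  show "i \<in> rows3" "l \<in> rows3" "m \<in> rows3" unfolding assms[symmetric] by simp_all
  have "card {i, l, m} = 3" unfolding assms by (simp add: rows3_def)
  then show "i \<noteq> l" "i \<noteq> m" "l \<noteq> m" by (auto simp: card_insert_if split: if_splits)
qed

lemma rows3_cases:
  assumes "{a, b, c} = rows3" "{i, l, m} = rows3"
  shows "(a, b, c) \<in> {(i, l, m), (i, m, l), (l, i, m), (l, m, i), (m, i, l), (m, l, i)}"
proof -
  have "a \<in> {i, l, m}" "b \<in> {i, l, m}" "c \<in> {i, l, m}"
    unfolding assms(2) using rows3_triple(1-3)[OF assms(1)] by simp_all
  then show ?thesis using rows3_triple(4-6)[OF assms(1)] by auto
qed

lemma sum_rows3: "{i, l, m} = rows3 \<Longrightarrow> f i + f l + f m = f 1 + f 2 + (f 3 :: real)"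
proof -
  assume *: "{i, l, m} = rows3"
  have "f i + f l + f m = sum f {i, l, m}" using rows3_triple(4-6)[OF *] by simp
  also have "\<dots> = f 1 + f 2 + f 3" unfolding * by (simp add: rows3_def)
  finally show ?thesis .
qed

lemma cheapest_triple:
  assumes mf: "matching_field 3 n \<Lambda>" and ind: "induces TYPE('a::field) 3 n M \<Lambda>"
    and d: "x \<noteq> y" "x \<noteq> z" "y \<noteq> z" and n: "{x, y, z} \<subseteq> {1..n}"
    and p: "{p, q, s} = rows3"
  defines "r \<equiv> row_of \<Lambda> {x, y, z}"
  shows "{r x, r y, r z} = rows3"
    and "M (r x) x + M (r y) y + M (r z) z \<le> M p x + M q y + M s z"
    and "M (r x) x + M (r y) y + M (r z) z = M p x + M q y + M s z \<Longrightarrow> r x = p \<and> r y = q \<and> r z = s"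
proof -
  have rows: "{1..3} = rows3" by (auto simp: rows3_def)
  have I: "{x, y, z} \<in> ksets 3 n" using d n by (simp add: ksets_def)
  define f where "f = (\<lambda>j. if j = x then p else if j = y then q else s)"
  have f: "f x = p" "f y = q" "f z = s" using d by (simp_all add: f_def)
  have bij: "bij_betw f {x, y, z} {1..3}"
    unfolding rows using rows3_triple(4-6)[OF p] d f p by (auto simp: bij_betw_def inj_on_def)
  show "{r x, r y, r z} = rows3"
    using row_of_bij[OF mf I] unfolding r_def rows by (simp add: bij_betw_def)
  show "M (r x) x + M (r y) y + M (r z) z \<le> M p x + M q y + M s z"
    using matching_minimal(1)[OF ind I bij] d f by (simp add: r_def)
  show "M (r x) x + M (r y) y + M (r z) z = M p x + M q y + M s z \<Longrightarrow> r x = p \<and> r y = q \<and> r z = s"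
    using matching_minimal(2)[OF ind I bij] d f by (simp add: r_def)
qed

text \<open>Here \<open>el i True\<close> and \<open>el i False\<close> are the two columns whose cheapest row is \<open>i\<close>. If all three rows are
  represented, each column attains its own minimum. Otherwise row \<open>l\<close> has to be filled from row
  \<open>i\<close>; let \<open>p\<close> be the column that moves there at the lowest price. Every other placement either moves
  the other column of row \<open>i\<close>, or goes through row \<open>m\<close> and costs more by the hexagon inequality, or
  in addition exchanges columns between rows \<open>i\<close> and \<open>m\<close>, which only adds to the price. Since the
  matching is the unique cheapest placement, a tie cannot occur.\<close>

lemma hexagonal_rows:
  assumes hex: "hexagonal_matching_field TYPE('a::field) \<Lambda>"
  obtains el :: "nat \<Rightarrow> bool \<Rightarrow> nat"
  where "\<And>i b. i \<in> rows3 \<Longrightarrow> el i b \<in> {1..6}"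
    and "\<And>i j b c. i \<in> rows3 \<Longrightarrow> j \<in> rows3 \<Longrightarrow> el i b = el j c \<Longrightarrow> i = j \<and> b = c"
    and "\<And>i l m b b' b''. {i, l, m} = rows3 \<Longrightarrow> row_of \<Lambda> {el i b, el l b', el m b''} (el i b) = i"
    and "\<And>i l m. {i, l, m} = rows3 \<Longrightarrow> \<exists>b. \<forall>c.
      row_of \<Lambda> {el i b, el i (\<not> b), el m c} (el i b) = l \<and>
      row_of \<Lambda> {el i b, el i (\<not> b), el m c} (el i (\<not> b)) = i \<and>
      row_of \<Lambda> {el i b, el i (\<not> b), el m c} (el m c) = m"
proof -
  have mf: "matching_field 3 6 \<Lambda>"
    using hex by (auto simp: hexagonal_matching_field_def coherent_matching_field_def)
  obtain M \<tau> where M: "\<forall>j \<in> {1..6}. M 1 j = 0" "induces TYPE('a) 3 6 M \<Lambda>"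
    and \<tau>: "\<tau> \<in> cells M" "coarse_covector M \<tau> = (2, 2, 2)" "hexagon \<tau>"
    using hex by (auto simp: hexagonal_matching_field_def)
  obtain h \<xi> where h: "\<forall>j \<in> {1..6}. h j \<in> rows3" "\<forall>i \<in> rows3. card {j \<in> {1..6}. h j = i} = 2"
    and home: "\<And>j l. j \<in> {1..6} \<Longrightarrow> l \<in> rows3 \<Longrightarrow> l \<noteq> h j \<Longrightarrow> M (h j) j - \<xi> (h j) < M l j - \<xi> l"
    and hexa: "\<And>i l m. {i, l, m} = rows3 \<Longrightarrow> \<exists>p \<in> {j \<in> {1..6}. h j = i}.
      \<forall>q \<in> {j \<in> {1..6}. h j = i}. M l p - M i p \<le> M l q - M i q \<and>
        (\<forall>x \<in> {j \<in> {1..6}. h j = m}. M l p - M i p < (M m q - M i q) + (M l x - M m x))"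
    by (rule hexagonal_cell_data[OF M(1) \<tau>]) (rule that)
  define S where "S = (\<lambda>i. {j \<in> {1..6::nat}. h j = i})"
  have "\<forall>i. \<exists>f :: bool \<Rightarrow> nat. i \<in> rows3 \<longrightarrow> S i = {f True, f False} \<and> f True \<noteq> f False"
  proof
    fix i
    show "\<exists>f :: bool \<Rightarrow> nat. i \<in> rows3 \<longrightarrow> S i = {f True, f False} \<and> f True \<noteq> f False"
    proof (cases "i \<in> rows3")
      case True
      then have "card (S i) = 2" using h(2) by (simp add: S_def)
      then obtain u v where "S i = {u, v}" "u \<noteq> v" by (auto simp: card_2_iff)
      then show ?thesis by (intro exI[of _ "\<lambda>b. if b then u else v"]) simp
    qed simp
  qed
  then obtain el where el: "\<And>i. i \<in> rows3 \<Longrightarrow> S i = {el i True, el i False} \<and> el i True \<noteq> el i False"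
    by metis
  have elS: "el i b \<in> S i" if "i \<in> rows3" for i b using el[OF that] by (cases b) auto
  then have el6: "el i b \<in> {1..6}" and hel: "h (el i b) = i" if "i \<in> rows3" for i b
    using that by (auto simp: S_def)
  have inj: "i = j \<and> b = c" if "i \<in> rows3" "j \<in> rows3" "el i b = el j c" for i j b c
  proof -
    have "i = j" using hel[of i b] hel[of j c] that by simp
    then show ?thesis using el[OF that(1)] that(3) by (cases b; cases c) auto
  qed
  have trans: "row_of \<Lambda> {el i b, el l b', el m b''} (el i b) = i"
    if ilm: "{i, l, m} = rows3" for i l m b b' b''
  proof -
    let ?x = "el i b" and ?y = "el l b'" and ?z = "el m b''"
    note rows = rows3_triple[OF ilm]
    have d: "?x \<noteq> ?y" "?x \<noteq> ?z" "?y \<noteq> ?z" using inj rows by blast+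
    have n: "{?x, ?y, ?z} \<subseteq> {1..6}" using el6 rows by simp
    let ?r = "row_of \<Lambda> {?x, ?y, ?z}"
    note best = cheapest_triple[OF mf M(2) d n ilm]
    note rr = rows3_triple(1-3)[OF best(1)]
    have "M i ?x - \<xi> i \<le> M (?r ?x) ?x - \<xi> (?r ?x)"
      using home[OF el6[OF rows(1), of b] rr(1)] unfolding hel[OF rows(1)] by (cases "?r ?x = i") auto
    moreover have "M l ?y - \<xi> l \<le> M (?r ?y) ?y - \<xi> (?r ?y)"
      using home[OF el6[OF rows(2), of b'] rr(2)] unfolding hel[OF rows(2)] by (cases "?r ?y = l") auto
    moreover have "M m ?z - \<xi> m \<le> M (?r ?z) ?z - \<xi> (?r ?z)"
      using home[OF el6[OF rows(3), of b''] rr(3)] unfolding hel[OF rows(3)] by (cases "?r ?z = m") auto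
    \<comment> \<open>The correction \<open>\<xi>\<close> is the same for all placements, as each row is used once.\<close>
    moreover have "\<xi> (?r ?x) + \<xi> (?r ?y) + \<xi> (?r ?z) = \<xi> i + \<xi> l + \<xi> m"
      using sum_rows3[OF best(1), of \<xi>] sum_rows3[OF ilm, of \<xi>] by simp
    ultimately have "M (?r ?x) ?x + M (?r ?y) ?y + M (?r ?z) ?z = M i ?x + M l ?y + M m ?z"
      using best(2) by linarith
    then show ?thesis using best(3) by blast
  qed
  have pairs: "\<exists>b. \<forall>c.
      row_of \<Lambda> {el i b, el i (\<not> b), el m c} (el i b) = l \<and>
      row_of \<Lambda> {el i b, el i (\<not> b), el m c} (el i (\<not> b)) = i \<and>
      row_of \<Lambda> {el i b, el i (\<not> b), el m c} (el m c) = m" if ilm: "{i, l, m} = rows3" for i l m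
  proof -
    note rows = rows3_triple[OF ilm]
    obtain p where p: "p \<in> S i" "\<And>q. q \<in> S i \<Longrightarrow> M l p - M i p \<le> M l q - M i q"
      "\<And>q x. q \<in> S i \<Longrightarrow> x \<in> S m \<Longrightarrow> M l p - M i p < (M m q - M i q) + (M l x - M m x)"
      using hexa[OF ilm] unfolding S_def by blast
    obtain b where b: "p = el i b" using p(1) el[OF rows(1)] by auto
    define q where "q = el i (\<not> b)"
    have q: "q \<in> S i" using elS[OF rows(1)] by (simp add: q_def)
    have "row_of \<Lambda> {p, q, x} p = l \<and> row_of \<Lambda> {p, q, x} q = i \<and> row_of \<Lambda> {p, q, x} x = m"
      if x: "x = el m c" for x c
    proof -
      have xS: "x \<in> S m" using elS[OF rows(3)] x by simp
      have d: "p \<noteq> q" "p \<noteq> x" "q \<noteq> x"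
        using inj rows unfolding b q_def x by blast+
      have n: "{p, q, x} \<subseteq> {1..6}" using p(1) q xS by (simp add: S_def)
      let ?r = "row_of \<Lambda> {p, q, x}"
      have lim: "{l, i, m} = rows3" using ilm by (simp add: insert_commute)
      note best = cheapest_triple[OF mf M(2) d n lim]
      have hq: "M i q - \<xi> i < M m q - \<xi> m" using home[of q m] q rows by (simp add: S_def)
      have hp: "M i p - \<xi> i < M m p - \<xi> m" using home[of p m] p(1) rows by (simp add: S_def)
      have hx: "M m x - \<xi> m < M i x - \<xi> i" using home[of x i] xS rows by (simp add: S_def)
      have "M (?r p) p + M (?r q) q + M (?r x) x = M l p + M i q + M m x"
        using rows3_cases[OF best(1) lim] best(2) p(2)[OF q] p(3)[OF q xS] p(3)[OF p(1) xS] hq hp hx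
        by auto
      then show ?thesis using best(3) by blast
    qed
    then show ?thesis unfolding b q_def by blast
  qed
  show thesis by (rule that[OF el6 inj trans pairs])
qed

section \<open>Relations from the hexagon\<close>

context prime_initial_ideal
begin

text \<open>The three-term relation on \<open>y, c, d, z\<close> over \<open>S \<union> {x}\<close>. Exchanging \<open>c\<close> and \<open>d\<close>, which are both placed
  in row \<open>\<mu>\<close>, does not change the monomial of a product. The third term has the set
  \<open>S \<union> {x, c, d}\<close> as a factor, in which \<open>c\<close> and \<open>d\<close> cannot both be in row \<open>\<mu>\<close>.\<close>

lemma exchange:
  assumes S: "S \<subseteq> {1..n}" "card S = k - 3"
    and pointed: "\<And>s A. s \<in> S \<Longrightarrow> A \<in> V \<Longrightarrow> s \<in> A \<Longrightarrow> row_of \<Lambda> A s = \<rho> s"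
    and d: "distinct [x, y, z, c, d]" and n: "{x, y, z, c, d} \<subseteq> {1..n} - S"
    and rows: "\<And>w. w \<in> {c, d} \<Longrightarrow> row_of \<Lambda> (S \<union> {x, y, w}) x = \<alpha> \<and>
        row_of \<Lambda> (S \<union> {x, y, w}) y = \<beta> \<and> row_of \<Lambda> (S \<union> {x, y, w}) w = \<mu>"
      "\<And>w. w \<in> {c, d} \<Longrightarrow> row_of \<Lambda> (S \<union> {x, z, w}) x = \<alpha>' \<and>
        row_of \<Lambda> (S \<union> {x, z, w}) z = \<gamma> \<and> row_of \<Lambda> (S \<union> {x, z, w}) w = \<mu>"
  shows "pair (S \<union> {x, y, c}) (S \<union> {x, z, d}) \<simeq> pair (S \<union> {x, y, d}) (S \<union> {x, z, c})"
proof -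
  have fS: "finite S" using S(1) finite_subset by blast
  have V: "S \<union> {u, v, w} \<in> V" if "u \<noteq> v" "u \<noteq> w" "v \<noteq> w" "{u, v, w} \<subseteq> {1..n} - S" for u v w
  proof -
    have "card (S \<union> {u, v, w}) = k" using that S fS k3 by simp
    then show ?thesis using that S by (auto simp: ksets_def)
  qed
  have expo: "expo (S \<union> {u, v, w}) = placement \<rho> S + Poly_Mapping.single (row_of \<Lambda> (S \<union> {u, v, w}) u, u) 1
      + Poly_Mapping.single (row_of \<Lambda> (S \<union> {u, v, w}) v, v) 1 + Poly_Mapping.single (row_of \<Lambda> (S \<union> {u, v, w}) w, w) 1"
    if "u \<noteq> v" "u \<noteq> w" "v \<noteq> w" "{u, v, w} \<subseteq> {1..n} - S" for u v w
  proof -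
    let ?A = "S \<union> {u, v, w}"
    have "placement (row_of \<Lambda> ?A) S = placement \<rho> S"
      unfolding placement_def using pointed[OF _ V[OF that]] by (intro sum.cong) auto
    moreover have "placement (row_of \<Lambda> ?A) ?A = placement (row_of \<Lambda> ?A) S + placement (row_of \<Lambda> ?A) {u, v, w}"
      unfolding placement_def using that fS by (intro sum.union_disjoint) auto
    ultimately show ?thesis using that by (simp add: expo_def placement_def add.assoc)
  qed
  let ?U = "insert x S"
  have U: "finite ?U" "card ?U = k - 2" "?U \<subseteq> {1..n}" using fS S n k3 by auto
  have dd: "distinct [y, c, d, z]" using d by auto
  have nn: "{y, c, d, z} \<subseteq> {1..n} - ?U" using n d by auto
  have sets: "?U \<union> {y, c} = S \<union> {x, y, c}" "?U \<union> {d, z} = S \<union> {x, z, d}" "?U \<union> {y, d} = S \<union> {x, y, d}"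
    "?U \<union> {c, z} = S \<union> {x, z, c}" "?U \<union> {y, z} = S \<union> {x, y, z}" "?U \<union> {c, d} = S \<union> {x, c, d}" by auto
  have ne: "x \<noteq> y" "x \<noteq> z" "x \<noteq> c" "x \<noteq> d" "y \<noteq> z" "y \<noteq> c" "y \<noteq> d" "z \<noteq> c" "z \<noteq> d" "c \<noteq> d"
    using d by auto
  have eq: "expo (S \<union> {x, y, c}) + expo (S \<union> {x, z, d}) = expo (S \<union> {x, y, d}) + expo (S \<union> {x, z, c})"
  proof -
    have E: "expo (S \<union> {x, y, w}) = placement \<rho> S + Poly_Mapping.single (\<alpha>, x) 1 + Poly_Mapping.single (\<beta>, y) 1
        + Poly_Mapping.single (\<mu>, w) 1"
      "expo (S \<union> {x, z, w}) = placement \<rho> S + Poly_Mapping.single (\<alpha>', x) 1 + Poly_Mapping.single (\<gamma>, z) 1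
        + Poly_Mapping.single (\<mu>, w) 1" if w: "w \<in> {c, d}" for w
      using expo[of x y w] expo[of x z w] rows(1)[OF w] rows(2)[OF w] w n ne by (simp_all only:) auto
    show ?thesis by (simp only: E insert_iff simp_thms) (simp only: ac_simps)
  qed
  have neq: "expo (S \<union> {x, y, c}) + expo (S \<union> {x, z, d}) \<noteq> expo (S \<union> {x, y, z}) + expo (S \<union> {x, c, d})"
  proof
    assume *: "expo (S \<union> {x, y, c}) + expo (S \<union> {x, z, d}) = expo (S \<union> {x, y, z}) + expo (S \<union> {x, c, d})"
    have L: "Poly_Mapping.lookup (expo (S \<union> {u, v, t})) (\<mu>, w) =
        (if w \<in> S \<union> {u, v, t} \<and> row_of \<Lambda> (S \<union> {u, v, t}) w = \<mu> then 1 else 0)" for u v t w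
      unfolding expo_def by (rule lookup_placement) (simp add: fS)
    note at = arg_cong[OF *, of "\<lambda>m. Poly_Mapping.lookup m (\<mu>, w)" for w, unfolded lookup_add L]
    have cS: "c \<in> S \<union> {x, y, c}" "c \<notin> S \<union> {x, z, d}" "c \<notin> S \<union> {x, y, z}"
      "d \<notin> S \<union> {x, y, c}" "d \<in> S \<union> {x, z, d}" "d \<notin> S \<union> {x, y, z}"
      using n ne by simp_all
    have \<mu>: "row_of \<Lambda> (S \<union> {x, y, c}) c = \<mu>" "row_of \<Lambda> (S \<union> {x, z, d}) d = \<mu>"
      using rows(1)[of c] rows(2)[of d] by simp_all
    have "row_of \<Lambda> (S \<union> {x, c, d}) c = \<mu>"
    proof (rule ccontr)
      assume "row_of \<Lambda> (S \<union> {x, c, d}) c \<noteq> \<mu>"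
      then show False
        using at[of c] by (simp only: cS \<mu> simp_thms if_True if_False add_0_left add_0_right one_neq_zero)
    qed
    moreover have "row_of \<Lambda> (S \<union> {x, c, d}) d = \<mu>"
    proof (rule ccontr)
      assume "row_of \<Lambda> (S \<union> {x, c, d}) d \<noteq> \<mu>"
      then show False
        using at[of d] by (simp only: cS \<mu> simp_thms if_True if_False add_0_left add_0_right one_neq_zero)
    qed
    ultimately have "row_of \<Lambda> (S \<union> {x, c, d}) c = row_of \<Lambda> (S \<union> {x, c, d}) d" by (simp only:)
    moreover have "inj_on (row_of \<Lambda> (S \<union> {x, c, d})) (S \<union> {x, c, d})"
      using row_of_bij[OF matching V[of x c d]] n ne by (auto simp: bij_betw_def)
    ultimately show False using ne by (auto dest: inj_onD)
  qed
  show ?thesis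
    using three_term_rel[OF U dd nn] eq neq unfolding sets by blast
qed

text \<open>Write \<open>[xyz]\<close> for the variable of \<open>S \<union> {x, y, z}\<close>. An exchange relates products whose two sets
  share a column \<open>x\<close> outside \<open>S\<close>, but the two sets of the ten products have only \<open>S\<close> in common.
  So two exchanges are multiplied and common factors cancelled.\<close>

lemma hexagon_impossible:
  assumes S: "S \<subseteq> {1..n}" "card S = k - 3"
    and pointed: "\<And>s A. s \<in> S \<Longrightarrow> A \<in> V \<Longrightarrow> s \<in> A \<Longrightarrow> row_of \<Lambda> A s = \<rho> s"
    and el: "\<And>i b. i \<in> rows3 \<Longrightarrow> el i b \<in> {1..n} - S"
      "\<And>i j b c. i \<in> rows3 \<Longrightarrow> j \<in> rows3 \<Longrightarrow> el i b = el j c \<Longrightarrow> i = j \<and> b = c"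
    and trans: "\<And>i l m b b' b''. {i, l, m} = rows3 \<Longrightarrow>
      row_of \<Lambda> (S \<union> {el i b, el l b', el m b''}) (el i b) = hr i"
    and pairs: "\<And>i l m. {i, l, m} = rows3 \<Longrightarrow> \<exists>b. \<forall>c.
      row_of \<Lambda> (S \<union> {el i b, el i (\<not> b), el m c}) (el i b) = hr l \<and>
      row_of \<Lambda> (S \<union> {el i b, el i (\<not> b), el m c}) (el i (\<not> b)) = hr i \<and>
      row_of \<Lambda> (S \<union> {el i b, el i (\<not> b), el m c}) (el m c) = hr m"
  shows False
proof -
  define br where "br = (\<lambda>x y z. S \<union> {x, y, z})"
  have br_comm: "br x y z = br y x z" "br x y z = br x z y" for x y z by (auto simp: br_def)
  define pr where "pr = (\<lambda>A B. pair A B)"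
  have pr_comm: "pr A B = pr B A" for A B by (simp add: pr_def add.commute)
  have fS: "finite S" using S(1) finite_subset by blast
  have brV: "br u v w \<in> V" if "u \<noteq> v" "u \<noteq> w" "v \<noteq> w" "{u, v, w} \<subseteq> {1..n} - S" for u v w
  proof -
    have "card (S \<union> {u, v, w}) = k" using that S fS k3 by simp
    then show ?thesis using that S by (auto simp: ksets_def br_def)
  qed
  have keys_pr: "A \<in> V \<Longrightarrow> B \<in> V \<Longrightarrow> Poly_Mapping.keys (pr A B) \<subseteq> V" for A B
    unfolding pr_def by (rule keys_pair)
  have el_ne: "el i b \<noteq> el j c" if "i \<in> rows3" "j \<in> rows3" "i \<noteq> j" for i j b c
    using el(2)[OF that(1,2)] that(3) by blast
  have el_not: "el i b \<noteq> el i (\<not> b)" "el i (\<not> b) \<noteq> el i b" if "i \<in> rows3" for i b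
    using el(2)[OF that that] by blast+
  have exch: "pr (br x y c) (br x z d) \<simeq> pr (br x y d) (br x z c)"
    if "distinct [x, y, z, c, d]" "{x, y, z, c, d} \<subseteq> {1..n} - S"
      "\<And>w. w \<in> {c, d} \<Longrightarrow> row_of \<Lambda> (br x y w) x = \<alpha> \<and> row_of \<Lambda> (br x y w) y = \<beta> \<and> row_of \<Lambda> (br x y w) w = \<mu>"
      "\<And>w. w \<in> {c, d} \<Longrightarrow> row_of \<Lambda> (br x z w) x = \<alpha>' \<and> row_of \<Lambda> (br x z w) z = \<gamma> \<and> row_of \<Lambda> (br x z w) w = \<mu>"
    for x y z c d \<alpha> \<beta> \<mu> \<alpha>' \<gamma>
    using exchange[OF S pointed that(1,2) that(3,4)[unfolded br_def]] unfolding br_def pr_def by blast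
  have trans': "row_of \<Lambda> (br (el i b) (el l b') (el m b'')) (el i b) = hr i"
      "row_of \<Lambda> (br (el i b) (el l b') (el m b'')) (el l b') = hr l"
      "row_of \<Lambda> (br (el i b) (el l b') (el m b'')) (el m b'') = hr m"
    if ilm: "{i, l, m} = rows3" for i l m b b' b''
  proof -
    have "{l, i, m} = rows3" "{m, i, l} = rows3" using ilm by (simp_all add: insert_commute)
    from trans[OF ilm, of b b' b''] trans[OF this(1), of b' b b''] trans[OF this(2), of b'' b b']
    show "row_of \<Lambda> (br (el i b) (el l b') (el m b'')) (el i b) = hr i"
      "row_of \<Lambda> (br (el i b) (el l b') (el m b'')) (el l b') = hr l"
      "row_of \<Lambda> (br (el i b) (el l b') (el m b'')) (el m b'') = hr m"
      by (simp_all add: br_def insert_commute)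
  qed
  have transversal_swap: "pr (br (el i b) (el m b') (el l c)) (br (el i (\<not> b)) (el m (\<not> b')) (el l (\<not> c))) \<simeq>
      pr (br (el i b) (el m b') (el l (\<not> c))) (br (el i (\<not> b)) (el m (\<not> b')) (el l c))"
    if ilm: "{i, l, m} = rows3" for i l m b b' c
  proof -
    note rows = rows3_triple[OF ilm]
    have mil: "{m, i, l} = rows3" and iml: "{i, m, l} = rows3" using ilm by (simp_all add: insert_commute)
    let ?a = "el i b" and ?a' = "el i (\<not> b)" and ?c = "el m b'" and ?c' = "el m (\<not> b')"
      and ?e = "el l c" and ?f = "el l (\<not> c)"
    note ne = el_ne[OF rows(1) rows(2) rows(4)] el_ne[OF rows(1) rows(3) rows(5)] el_ne[OF rows(2) rows(3) rows(6)]
      el_not[OF rows(1)] el_not[OF rows(2)] el_not[OF rows(3)]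
    note ne' = ne ne[symmetric]
    have sub: "{el i x, el m y, el l z} \<subseteq> {1..n} - S" for x y z using el(1) rows by simp
    have V: "br (el i x) (el m y) (el l z) \<in> V" for x y z
      using ne' sub by (intro brV) simp_all
    have 1: "pr (br ?c ?a ?e) (br ?c ?a' ?f) \<simeq> pr (br ?c ?a ?f) (br ?c ?a' ?e)"
      by (rule exch[where \<alpha> = "hr m" and \<beta> = "hr i" and \<mu> = "hr l" and \<alpha>' = "hr m" and \<gamma> = "hr i"])
        (use ne' sub trans'[OF mil] in auto)
    have 2: "pr (br ?a' ?c ?e) (br ?a' ?c' ?f) \<simeq> pr (br ?a' ?c ?f) (br ?a' ?c' ?e)"
      by (rule exch[where \<alpha> = "hr i" and \<beta> = "hr m" and \<mu> = "hr l" and \<alpha>' = "hr i" and \<gamma> = "hr m"])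
        (use ne' sub trans'[OF iml] in auto)
    \<comment> \<open>In the product of the two relations the factors \<open>[a'ce]\<close> and \<open>[a'cf]\<close> occur on both sides.\<close>
    have "pr (br ?a ?c ?e) (br ?a' ?c' ?f) + pr (br ?a' ?c ?f) (br ?a' ?c ?e) \<simeq>
        pr (br ?a ?c ?f) (br ?a' ?c' ?e) + pr (br ?a' ?c ?f) (br ?a' ?c ?e)"
      using rel_add[OF 1 2] by (simp add: pr_def br_comm(1)[of ?c] ac_simps)
    then show ?thesis by (rule rel_cancel) (intro keys_pr V)+
  qed
  have pair_swap: "pr (br (el i False) (el i True) (el m False)) (br (el l False) (el l True) (el m True)) \<simeq>
      pr (br (el i False) (el i True) (el m True)) (br (el l False) (el l True) (el m False))"
    if ilm: "{i, l, m} = rows3" for i l m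
  proof -
    note rows = rows3_triple[OF ilm]
    have lim: "{l, i, m} = rows3" using ilm by (simp_all add: insert_commute)
    obtain b where b: "\<And>c. row_of \<Lambda> (br (el i b) (el i (\<not> b)) (el m c)) (el i b) = hr l \<and>
      row_of \<Lambda> (br (el i b) (el i (\<not> b)) (el m c)) (el i (\<not> b)) = hr i \<and>
      row_of \<Lambda> (br (el i b) (el i (\<not> b)) (el m c)) (el m c) = hr m"
      using pairs[OF ilm] unfolding br_def by blast
    obtain b' where b': "\<And>c. row_of \<Lambda> (br (el l b') (el l (\<not> b')) (el m c)) (el l b') = hr i \<and>
      row_of \<Lambda> (br (el l b') (el l (\<not> b')) (el m c)) (el l (\<not> b')) = hr l \<and>
      row_of \<Lambda> (br (el l b') (el l (\<not> b')) (el m c)) (el m c) = hr m"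
      using pairs[OF lim] unfolding br_def by blast
    let ?p = "el i b" and ?q = "el i (\<not> b)" and ?p' = "el l b'" and ?q' = "el l (\<not> b')"
      and ?c = "el m False" and ?d = "el m True"
    note ne = el_ne[OF rows(1) rows(2) rows(4)] el_ne[OF rows(1) rows(3) rows(5)] el_ne[OF rows(2) rows(3) rows(6)]
      el_not[OF rows(1)] el_not[OF rows(2)] el_not[OF rows(3), of False, simplified]
    note ne' = ne ne[symmetric]
    have sub: "{el i x, el i x', el l y, el l y', el m z, el m z'} \<subseteq> {1..n} - S" for x x' y y' z z'
      using el(1) rows by simp
    have V: "br ?p ?q (el m z) \<in> V" "br ?p' ?q' (el m z) \<in> V" "br ?p ?p' (el m z) \<in> V" for z
      using ne' sub by (intro brV; simp)+
    have 1: "pr (br ?p ?q ?c) (br ?p ?p' ?d) \<simeq> pr (br ?p ?q ?d) (br ?p ?p' ?c)"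
      by (rule exch[where \<alpha> = "hr l" and \<beta> = "hr i" and \<mu> = "hr m" and \<alpha>' = "hr i" and \<gamma> = "hr l"])
        (use ne' sub b trans'[OF ilm] in auto)
    have 2: "pr (br ?p' ?q' ?d) (br ?p' ?p ?c) \<simeq> pr (br ?p' ?q' ?c) (br ?p' ?p ?d)"
      by (rule exch[where \<alpha> = "hr i" and \<beta> = "hr l" and \<mu> = "hr m" and \<alpha>' = "hr l" and \<gamma> = "hr i"])
        (use ne' sub b' trans'[OF lim] in auto)
    \<comment> \<open>The auxiliary columns \<open>p'\<close> and \<open>p\<close> in the two relations are chosen such that the factors \<open>[pp'c]\<close> and
      \<open>[pp'd]\<close> occur on both sides of the product.\<close>
    have "pr (br ?p ?q ?c) (br ?p' ?q' ?d) + pr (br ?p ?p' ?c) (br ?p ?p' ?d) \<simeq>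
        pr (br ?p ?q ?d) (br ?p' ?q' ?c) + pr (br ?p ?p' ?c) (br ?p ?p' ?d)"
      using rel_add[OF 1 2] by (simp add: pr_def br_comm(1)[of ?p' ?p] ac_simps)
    then have "pr (br ?p ?q ?c) (br ?p' ?q' ?d) \<simeq> pr (br ?p ?q ?d) (br ?p' ?q' ?c)"
      by (rule rel_cancel) (intro keys_pr V)+
    moreover have "br ?p ?q z = br (el i False) (el i True) z" for z
      by (cases b) (simp_all add: br_comm(1)[of "el i True"])
    moreover have "br ?p' ?q' z = br (el l False) (el l True) z" for z
      by (cases b') (simp_all add: br_comm(1)[of "el l True"])
    ultimately show ?thesis by simp
  qed
  have r123: "{1, 3, 2} = rows3" "{1, 2, 3} = rows3" "{2, 3, 1} = rows3" "{2, 1, 3} = rows3"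
    by (auto simp: rows3_def)
  define a b c d e f where abc: "a = el 1 False" "b = el 1 True" "c = el 2 False" "d = el 2 True" "e = el 3 False" "f = el 3 True"
  define X where "X = {a, b, c, d, e, f}"
  have in3: "1 \<in> rows3" "2 \<in> rows3" "3 \<in> rows3" by (auto simp: rows3_def)
  have ne: "distinct [a, b, c, d, e, f]"
    unfolding abc using el_not(1)[OF in3(1), of False] el_not(1)[OF in3(2), of False] el_not(1)[OF in3(3), of False]
      el_ne[OF in3(1) in3(2)] el_ne[OF in3(1) in3(3)] el_ne[OF in3(2) in3(3)] by simp
  have Xn: "X \<subseteq> {1..n} - S" unfolding X_def abc using el(1) in3 by simp
  have V3: "br x y z \<in> V" if "{x, y, z} \<subseteq> X" "x \<noteq> y" "x \<noteq> z" "y \<noteq> z" for x y z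
    using that Xn by (intro brV) auto
  define rep where "rep = (\<lambda>i. [pr (br a c e) (br b d f), pr (br a b c) (br d e f),
    pr (br a b e) (br c d f), pr (br a c d) (br b e f)] ! i)"
  have rep: "rep 0 = pr (br a c e) (br b d f)" "rep 1 = pr (br a b c) (br d e f)"
    "rep 2 = pr (br a b e) (br c d f)" "rep 3 = pr (br a c d) (br b e f)"
    by (simp_all add: rep_def)
  have rel: "rep 0 \<simeq> rep 0" "rep 1 \<simeq> rep 1" "rep 2 \<simeq> rep 2" "rep 3 \<simeq> rep 3"
    unfolding rep using ne by (intro rel_refl keys_pr V3; simp add: X_def)+
  have rel0: "pr (br a c f) (br b d e) \<simeq> rep 0" "pr (br a d e) (br b c f) \<simeq> rep 0" "pr (br a d f) (br b c e) \<simeq> rep 0"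
  proof -
    show "pr (br a c f) (br b d e) \<simeq> rep 0"
      using transversal_swap[OF r123(1), of False False True] by (simp add: rep abc)
    show "pr (br a d e) (br b c f) \<simeq> rep 0"
      using transversal_swap[OF r123(2), of False False True] by (simp add: rep abc br_comm)
    show "pr (br a d f) (br b c e) \<simeq> rep 0"
      using transversal_swap[OF r123(4), of False False True] by (simp add: rep abc br_comm pr_comm)
  qed
  have rel1: "pr (br a b d) (br c e f) \<simeq> rep 1"
    using rel_sym[OF pair_swap[OF r123(1)]] unfolding rep by (simp add: abc br_comm)
  have rel2: "pr (br a b f) (br c d e) \<simeq> rep 2"
    using rel_sym[OF pair_swap[OF r123(2)]] unfolding rep by (simp add: abc br_comm)
  have rel3: "pr (br a e f) (br b c d) \<simeq> rep 3"
    using rel_sym[OF pair_swap[OF r123(3)]] unfolding rep by (simp add: abc br_comm pr_comm)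
  show False
  proof (rule four_classes_impossible[OF S X_def ne _ _ , of rep])
    show "S \<inter> X = {}" "X \<subseteq> {1..n}" using Xn by blast+
    fix x y assume xy: "{x, y} \<subseteq> {b, c, d, e, f}" "x \<noteq> y"
    have compl: "X - {a, b, c} = {d, e, f}" "X - {a, b, d} = {c, e, f}" "X - {a, b, e} = {c, d, f}" "X - {a, b, f} = {c, d, e}"
      "X - {a, c, d} = {b, e, f}" "X - {a, c, e} = {b, d, f}" "X - {a, c, f} = {b, d, e}"
      "X - {a, d, e} = {b, c, f}" "X - {a, d, f} = {b, c, e}" "X - {a, e, f} = {b, c, d}"
      using ne by (auto simp: X_def)
    define G where "G = (\<lambda>Y. \<exists>i<4. pair (S \<union> Y) (S \<union> (X - Y)) \<simeq> rep i)"
    have G: "G {x, y, z}" if "i < 4" "pr (br x y z) (br u v t) \<simeq> rep i" "X - {x, y, z} = {u, v, t}" for i x y z u v t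
      using that(1,2) unfolding G_def that(3) pr_def br_def by blast
    have rels: "pr (br a c e) (br b d f) \<simeq> rep 0" "pr (br a b c) (br d e f) \<simeq> rep 1"
      "pr (br a b e) (br c d f) \<simeq> rep 2" "pr (br a c d) (br b e f) \<simeq> rep 3"
      using rel by (simp_all only: rep)
    have "G {a, b, c}" by (rule G[OF _ rels(2) compl(1)]) simp
    moreover have "G {a, b, d}" by (rule G[OF _ rel1 compl(2)]) simp
    moreover have "G {a, b, e}" by (rule G[OF _ rels(3) compl(3)]) simp
    moreover have "G {a, b, f}" by (rule G[OF _ rel2 compl(4)]) simp
    moreover have "G {a, c, d}" by (rule G[OF _ rels(4) compl(5)]) simp
    moreover have "G {a, c, e}" by (rule G[OF _ rels(1) compl(6)]) simp
    moreover have "G {a, c, f}" by (rule G[OF _ rel0(1) compl(7)]) simp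
    moreover have "G {a, d, e}" by (rule G[OF _ rel0(2) compl(8)]) simp
    moreover have "G {a, d, f}" by (rule G[OF _ rel0(3) compl(9)]) simp
    moreover have "G {a, e, f}" by (rule G[OF _ rel3 compl(10)]) simp
    ultimately have "G {a, x, y}" using xy by (auto simp: insert_commute)
    then show "\<exists>i<4. pair (S \<union> {a, x, y}) (S \<union> (X - {a, x, y})) \<simeq> rep i" by (simp add: G_def)
  qed
qed

end

section \<open>Submatching fields\<close>

text \<open>A column outside \<open>S\<close> is not placed in a row of \<open>\<rho> ` S\<close>, because these rows are taken by the columns in
  \<open>S\<close>. Hence its row lies in \<open>R\<close>, where renumbering can be undone.\<close>

lemma submatching_rows:
  assumes mf: "matching_field k n \<Lambda>"
    and ST: "S \<subset> T" "T \<subseteq> {1..n}" "card S = k - 3" "card T = k + 3" and k: "3 \<le> k"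
    and pointed: "pointed_via k n \<Lambda> S \<rho>"
    and J: "J \<in> ksets 3 6" "j \<in> J"
  defines "R \<equiv> {1..k} - \<rho> ` S"
  shows "row_of \<Lambda> (S \<union> nth_elem (T - S) ` J) (nth_elem (T - S) j) =
    nth_elem R (row_of (submatching_field \<Lambda> S T R) J j)"
proof -
  let ?g = "nth_elem (T - S)"
  let ?A = "S \<union> ?g ` J"
  have fT: "finite T" using ST(2) finite_subset by blast
  then have fS: "finite S" using ST(1) finite_subset by blast
  have cTS: "card (T - S) = 6" using ST k fS by (subst card_Diff_subset) auto
  have g: "bij_betw ?g {1..6} (T - S)" using nth_elem_bij[of "T - S"] fT cTS by simp
  note Jfin = ksetsD(1)[OF J(1)] and Jcard = ksetsD(2)[OF J(1)] and Jsub = ksetsD(3)[OF J(1)]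
  have gJ: "?g ` J \<subseteq> T - S" using g Jsub by (auto simp: bij_betw_def)
  have "card (?g ` J) = 3"
    using g Jsub Jcard by (subst card_image) (auto simp: bij_betw_def intro: inj_on_subset)
  then have "card ?A = k" using gJ fS Jfin ST(3) k by (subst card_Un_disjoint) auto
  then have A: "?A \<in> ksets k n" using gJ ST by (auto simp: ksets_def)
  have bij: "bij_betw (row_of \<Lambda> ?A) ?A {1..k}" by (rule row_of_bij[OF mf A])
  have rowS: "row_of \<Lambda> ?A s = \<rho> s" if "s \<in> S" for s
    using pointed A that by (auto simp: pointed_via_def)
  have "inj_on (row_of \<Lambda> ?A) S" using bij by (auto simp: bij_betw_def intro: inj_on_subset)
  then have "inj_on \<rho> S" using rowS by (auto simp: inj_on_def)
  then have "card (\<rho> ` S) = k - 3" using ST(3) by (simp add: card_image)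
  moreover have "\<rho> ` S \<subseteq> {1..k}" using pointed by (auto simp: pointed_via_def)
  ultimately have R: "finite R" "card R = 3" using k fS by (simp_all add: R_def card_Diff_subset)
  have "row_of \<Lambda> ?A (?g j) \<in> {1..k}" using bij J(2) by (auto simp: bij_betw_def)
  moreover have "row_of \<Lambda> ?A (?g j) \<notin> \<rho> ` S"
  proof
    assume "row_of \<Lambda> ?A (?g j) \<in> \<rho> ` S"
    then obtain s where s: "s \<in> S" "row_of \<Lambda> ?A (?g j) = row_of \<Lambda> ?A s" using rowS by auto
    then have "?g j = s" using bij J(2) by (auto simp: bij_betw_def inj_on_def)
    then show False using s gJ J(2) by auto
  qed
  ultimately have inR: "row_of \<Lambda> ?A (?g j) \<in> R" by (simp add: R_def)
  have "position J j \<in> {1..3}" using position_bij[OF Jfin] Jcard J(2) by (auto simp: bij_betw_def)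
  then have "row_of (submatching_field \<Lambda> S T R) J j = position R (row_of \<Lambda> ?A (?g j))"
    using nth_elem_position[OF Jfin J(2)] by (simp add: row_of_def submatching_field_def R(2))
  then show ?thesis using nth_elem_position[OF R(1) inR] by simp
qed

theorem theorem1p2:
  fixes k n :: nat
    and \<Lambda> :: "nat set \<Rightarrow> nat \<Rightarrow> nat"
    and M :: "nat \<Rightarrow> nat \<Rightarrow> real"
  assumes "3 \<le> k" and "k \<le> n"
    and "coherent_matching_field TYPE('a::field) k n \<Lambda>"
    and "induces TYPE('a) k n M \<Lambda>"
    and "has_hexagonal_submatching_field TYPE('a) k n \<Lambda>"
  shows "\<not> (primeideal (initial_plucker_ideal k n M :: (nat set, 'a) mpoly set)
               (mpoly_ring (ksets k n)) \<and>
            binomial_ideal (ksets k n) (initial_plucker_ideal k n M :: (nat set, 'a) mpoly set))"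
proof
  assume prime: "primeideal (initial_plucker_ideal k n M :: (nat set, 'a) mpoly set)
               (mpoly_ring (ksets k n)) \<and>
            binomial_ideal (ksets k n) (initial_plucker_ideal k n M :: (nat set, 'a) mpoly set)"
  have mf: "matching_field k n \<Lambda>" using assms(3) by (simp add: coherent_matching_field_def)
  interpret prime_initial_ideal k n \<Lambda> M "initial_plucker_ideal k n M :: (nat set, 'a) mpoly set" "plucker_weight TYPE('a) k M"
    by (rule prime_initial_ideal.intro[OF assms(1) mf assms(4) refl refl conjunct1[OF prime]])
  obtain S T \<rho> where ST: "S \<subset> T" "T \<subseteq> {1..n}" "card S = k - 3" "card T = k + 3"
    and pointed: "pointed_via k n \<Lambda> S \<rho>"
    and hex: "hexagonal_matching_field TYPE('a) (submatching_field \<Lambda> S T ({1..k} - \<rho> ` S))"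
    using assms(5) by (auto simp: has_hexagonal_submatching_field_def)
  let ?R = "{1..k} - \<rho> ` S"
  let ?g = "nth_elem (T - S)"
  obtain el where el: "\<And>i b. i \<in> rows3 \<Longrightarrow> el i b \<in> {1..6}"
      "\<And>i j b c. i \<in> rows3 \<Longrightarrow> j \<in> rows3 \<Longrightarrow> el i b = el j c \<Longrightarrow> i = j \<and> b = c"
    and trans: "\<And>i l m b b' b''. {i, l, m} = rows3 \<Longrightarrow>
      row_of (submatching_field \<Lambda> S T ?R) {el i b, el l b', el m b''} (el i b) = i"
    and pairs: "\<And>i l m. {i, l, m} = rows3 \<Longrightarrow> \<exists>b. \<forall>c.
      row_of (submatching_field \<Lambda> S T ?R) {el i b, el i (\<not> b), el m c} (el i b) = l \<and>
      row_of (submatching_field \<Lambda> S T ?R) {el i b, el i (\<not> b), el m c} (el i (\<not> b)) = i \<and>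
      row_of (submatching_field \<Lambda> S T ?R) {el i b, el i (\<not> b), el m c} (el m c) = m"
    by (rule hexagonal_rows[OF hex]) (rule that)
  have fT: "finite T" using ST(2) finite_subset by blast
  then have fS: "finite S" using ST(1) finite_subset by blast
  have cTS: "card (T - S) = 6" using ST assms(1) fS by (subst card_Diff_subset) auto
  have g: "bij_betw ?g {1..6} (T - S)" using nth_elem_bij[of "T - S"] fT cTS by simp
  have row: "row_of \<Lambda> (S \<union> {?g x, ?g y, ?g z}) (?g w) =
      nth_elem ?R (row_of (submatching_field \<Lambda> S T ?R) {x, y, z} w)"
    if "{x, y, z} \<subseteq> {1..6}" "x \<noteq> y" "x \<noteq> z" "y \<noteq> z" "w \<in> {x, y, z}" for x y z w
  proof -
    have J: "{x, y, z} \<in> ksets 3 6" using that by (simp add: ksets_def)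
    show ?thesis using submatching_rows[OF mf ST assms(1) pointed J that(5)] by simp
  qed
  have el_ne: "el i b \<noteq> el j c" if "i \<in> rows3" "j \<in> rows3" "i \<noteq> j \<or> b \<noteq> c" for i j b c
    using el(2)[OF that(1,2)] that(3) by blast
  show False
  proof (rule hexagon_impossible[of S \<rho> "\<lambda>i b. ?g (el i b)" "nth_elem ?R"])
    show "S \<subseteq> {1..n}" "card S = k - 3" using ST by auto
    show "row_of \<Lambda> A s = \<rho> s" if "s \<in> S" "A \<in> V" "s \<in> A" for s A
      using pointed that by (auto simp: pointed_via_def)
    show "?g (el i b) \<in> {1..n} - S" if "i \<in> rows3" for i b
    proof -
      have "?g (el i b) \<in> T - S" using bij_betwE[OF g] el(1)[OF that] by blast
      then show ?thesis using ST(2) by blast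
    qed
    show "i = j \<and> b = c" if "i \<in> rows3" "j \<in> rows3" "?g (el i b) = ?g (el j c)" for i j b c
    proof -
      have "el i b = el j c"
        using inj_onD[OF bij_betw_imp_inj_on[OF g] that(3) el(1)[OF that(1)] el(1)[OF that(2)]] .
      then show ?thesis using el(2) that by blast
    qed
  next
    fix i l m :: nat and b b' b'' assume ilm: "{i, l, m} = rows3"
    note rows = rows3_triple[OF ilm]
    have "{el i b, el l b', el m b''} \<subseteq> {1..6}" using el(1) rows by simp
    then have "row_of \<Lambda> (S \<union> {?g (el i b), ?g (el l b'), ?g (el m b'')}) (?g (el i b)) =
        nth_elem ?R (row_of (submatching_field \<Lambda> S T ?R) {el i b, el l b', el m b''} (el i b))"
      by (rule row) (use el_ne rows in simp_all)
    then show "row_of \<Lambda> (S \<union> {?g (el i b), ?g (el l b'), ?g (el m b'')}) (?g (el i b)) = nth_elem ?R i"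
      using trans[OF ilm] by simp
  next
    fix i l m :: nat assume ilm: "{i, l, m} = rows3"
    note rows = rows3_triple[OF ilm]
    obtain b where b: "\<And>c. row_of (submatching_field \<Lambda> S T ?R) {el i b, el i (\<not> b), el m c} (el i b) = l \<and>
      row_of (submatching_field \<Lambda> S T ?R) {el i b, el i (\<not> b), el m c} (el i (\<not> b)) = i \<and>
      row_of (submatching_field \<Lambda> S T ?R) {el i b, el i (\<not> b), el m c} (el m c) = m"
      using pairs[OF ilm] by blast
    have row': "row_of \<Lambda> (S \<union> {?g (el i b), ?g (el i (\<not> b)), ?g (el m c)}) (?g w) =
        nth_elem ?R (row_of (submatching_field \<Lambda> S T ?R) {el i b, el i (\<not> b), el m c} w)"
      if "w \<in> {el i b, el i (\<not> b), el m c}" for w c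
      by (rule row) (use el(1) el_ne rows that in simp_all)
    show "\<exists>b. \<forall>c. row_of \<Lambda> (S \<union> {?g (el i b), ?g (el i (\<not> b)), ?g (el m c)}) (?g (el i b)) = nth_elem ?R l \<and>
        row_of \<Lambda> (S \<union> {?g (el i b), ?g (el i (\<not> b)), ?g (el m c)}) (?g (el i (\<not> b))) = nth_elem ?R i \<and>
        row_of \<Lambda> (S \<union> {?g (el i b), ?g (el i (\<not> b)), ?g (el m c)}) (?g (el m c)) = nth_elem ?R m"
    proof (intro exI[of _ b] allI conjI)
      fix c
      show "row_of \<Lambda> (S \<union> {?g (el i b), ?g (el i (\<not> b)), ?g (el m c)}) (?g (el i b)) = nth_elem ?R l"
        using row'[of "el i b" c] b[of c] by (simp only: insert_iff simp_thms)
      show "row_of \<Lambda> (S \<union> {?g (el i b), ?g (el i (\<not> b)), ?g (el m c)}) (?g (el i (\<not> b))) = nth_elem ?R i"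
        using row'[of "el i (\<not> b)" c] b[of c] by (simp only: insert_iff simp_thms)
      show "row_of \<Lambda> (S \<union> {?g (el i b), ?g (el i (\<not> b)), ?g (el m c)}) (?g (el m c)) = nth_elem ?R m"
        using row'[of "el m c" c] b[of c] by (simp only: insert_iff simp_thms)
    qed
  qed
qed

end
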